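(* Let $v:\mathbb S^2\to\mathbb S^2$ be measurable with $v(\omega)\cdot\omega=0$ for all $\omega\in\mathbb S^2$, and let $Q_b=v\otimes v-\frac13 I$ on $\mathbb S^2=\partial\Omega$. For $\xi,\eta>0$ let $Q_{\xi,\eta}$ minimize $E_{\xi,\eta}$ over $\{Q\in Q_\infty+H^1(\Omega;\mathcal S_0): Q=Q_b \text{ on }\partial\Omega\}$. If $$\frac{\eta}{\xi}\to\lambda\in[0,\infty]\quad\text{as }\xi,\eta\to0,$$ then for any measurable set $U\subset\mathbb S^2$, $$\liminf_{\xi,\eta\to0}\ \eta\,E_{\xi,\eta}(Q_{\xi,\eta};\mathcal C(U))\ \ge\ \int_U D_\lambda(Q_b(\omega))\,d\mathcal H^2(\omega).$$
   Context: $\Omega=\mathbb R^3\setminus B$, where $B$ is the closed unit ball centered at $0$. $\mathcal S_0$ is the space of symmetric traceless real $3\times3$ matrices with the Frobenius norm $|\cdot|$. $Q_\infty=\mathbf e_3\otimes \mathbf e_3-\frac13I$. Potentials: $f(Q)=\frac29-\frac12|Q|^2-\operatorname{tr}(Q^3)+\frac34|Q|^4$, which satisfies $f\ge0$ with equality iff $Q=n\otimes n-\frac13I$ for some $n\in\mathbb S^2$; and $g(Q)=\sqrt{\frac23}-\frac{Q_{33}}{|Q|}$ (the formula is for $Q\neq 0$; no value at $Q=0$ is specified). Energy: for measurable $A\subset\Omega$, $$E_{\xi,\eta}(Q;A)=\int_A\left(\frac12|\nabla Q|^2+\frac1{\xi^2}f(Q)+\frac1{\eta^2}g(Q)\right)dx,\qquad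 E_{\xi,\eta}(Q)=E_{\xi,\eta}(Q;\Omega).$$ For $U\subset\mathbb S^2$, $\mathcal C(U)=\{t\omega: t>1,\ \omega\in U\}$. For $\lambda\in[0,\infty)$ and $Q\in Q_\infty+H^1((1,\infty);\mathcal S_0)$, $$F_\lambda(Q)=\int_1^\infty\left[\frac12\left|\frac{dQ}{dr}\right|^2+\lambda^2f(Q)+g(Q)\right]dr,$$ while $F_\infty(Q)=\int_1^\infty\left[\frac12\left|\frac{dQ}{dr}\right|^2+g(Q)\right]dr$ if $f(Q)=0$ a.e., and $F_\infty(Q)=+\infty$ otherwise. Finally $$D_\lambda(Q_0)=\min\{F_\lambda(Q): Q\in Q_\infty+H^1((1,\infty);\mathcal S_0),\ Q(1)=Q_0\}.$$ $\mathcal H^2$ is the two-dimensional Hausdorff (surface) measure. Limits $\xi,\eta\to0$ are taken along families (or sequences) of positive pairs $(\xi,\eta)\to(0,0)$ with $\eta/\xi\to\lambda$. *)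

theory Defs
  imports "HOL-Analysis.Analysis"
begin

section \<open>Two-dimensional Hausdorff measure and the unit sphere\<close>

text \<open>Covers by arbitrary sets of diameter at most \<open>\<delta>\<close>, each weighted by the area
  \<open>\<pi> (diam / 2)\<^sup>2\<close> of the planar disc of the same diameter. Boundedness is required
  separately because the real-valued \<^const>\<open>diameter\<close> is meaningless on unbounded sets.\<close>

definition hausdorff2_pre :: "real \<Rightarrow> 'a::metric_space set \<Rightarrow> ennreal" where
  "hausdorff2_pre \<delta> A =
     (INF C \<in> {C :: nat \<Rightarrow> 'a set. A \<subseteq> (\<Union>i. C i) \<and> (\<forall>i. bounded (C i) \<and> diameter (C i) \<le> \<delta>)}.
        \<Sum>i. ennreal (pi * (diameter (C i) / 2)\<^sup>2))"

definition hausdorff2 :: "'a::metric_space measure" where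
  "hausdorff2 = measure_of UNIV (sets borel) (\<lambda>A. SUP \<delta>\<in>{0<..}. hausdorff2_pre \<delta> A)"

text \<open>Completed, so that its measurable sets are exactly the Hausdorff-measurable
  (Caratheodory) subsets of the sphere, not just the Borel ones.\<close>

definition sphere_measure :: "(real^3) measure" where
  "sphere_measure = completion (restrict_space hausdorff2 (sphere 0 1))"

section \<open>Sobolev functions\<close>

definition C1_fun :: "('a::real_normed_vector \<Rightarrow> 'b::real_normed_vector) \<Rightarrow> bool" where
  "C1_fun w \<longleftrightarrow> (\<exists>w' :: 'a \<Rightarrow> 'a \<Rightarrow>\<^sub>L 'b.
     (\<forall>x. (w has_derivative blinfun_apply (w' x)) (at x)) \<and> continuous_on UNIV w')"

abbreviation partial_deriv ::
  "'a \<Rightarrow> ('a::euclidean_space \<Rightarrow> 'b::euclidean_space) \<Rightarrow> 'a \<Rightarrow> 'b" where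
  "partial_deriv b w x \<equiv> frechet_derivative w (at x) b"

definition test_fun :: "'a::euclidean_space set \<Rightarrow> ('a \<Rightarrow> real) \<Rightarrow> bool" where
  "test_fun \<Omega> \<phi> \<longleftrightarrow>
     C1_fun \<phi> \<and> compact (closure {x. \<phi> x \<noteq> 0}) \<and> closure {x. \<phi> x \<noteq> 0} \<subseteq> \<Omega>"

definition L2_fun :: "'a measure \<Rightarrow> ('a \<Rightarrow> 'b::euclidean_space) \<Rightarrow> bool" where
  "L2_fun M u \<longleftrightarrow> u \<in> borel_measurable M \<and> integrable M (\<lambda>x. (norm (u x))\<^sup>2)"

text \<open>A gradient of \<open>u\<close> is the family \<open>G b\<close> of its weak partial derivatives in the coordinate
  directions \<open>b \<in> Basis\<close>. Test functions of class C1 with compact support in \<open>\<Omega>\<close> give the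
  same notion as smooth ones.\<close>

definition has_weak_gradient ::
  "'a::euclidean_space set \<Rightarrow> ('a \<Rightarrow> 'b::euclidean_space) \<Rightarrow> ('a \<Rightarrow> 'a \<Rightarrow> 'b) \<Rightarrow> bool" where
  "has_weak_gradient \<Omega> u G \<longleftrightarrow>
     (\<forall>b\<in>Basis. L2_fun (lebesgue_on \<Omega>) (G b) \<and>
        (\<forall>\<phi>. test_fun \<Omega> \<phi> \<longrightarrow>
           (LINT x|lebesgue_on \<Omega>. partial_deriv b \<phi> x *\<^sub>R u x)
             = - (LINT x|lebesgue_on \<Omega>. \<phi> x *\<^sub>R G b x)))"

text \<open>For \<open>u\<close> locally integrable on an open \<open>\<Omega>\<close> the weak gradient is unique up to null sets, so
  the choice does not affect any of the integrals below.\<close>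

definition weak_gradient ::
  "'a::euclidean_space set \<Rightarrow> ('a \<Rightarrow> 'b::euclidean_space) \<Rightarrow> 'a \<Rightarrow> 'a \<Rightarrow> 'b" where
  "weak_gradient \<Omega> u = (SOME G. has_weak_gradient \<Omega> u G)"

definition H1 :: "'a::euclidean_space set \<Rightarrow> 'b::euclidean_space set \<Rightarrow> ('a \<Rightarrow> 'b) set" where
  "H1 \<Omega> S = {u. (\<forall>x\<in>\<Omega>. u x \<in> S) \<and> L2_fun (lebesgue_on \<Omega>) u \<and> (\<exists>G. has_weak_gradient \<Omega> u G)}"

definition exterior_domain :: "(real^3) set" where
  "exterior_domain = - cball 0 1"

text \<open>The trace on the sphere is the continuous extension of restriction: \<open>b\<close> is the trace of
  \<open>u\<close> if C1 functions on the whole space converge to \<open>u\<close> in H1 of the exterior domain and their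
  restrictions converge to \<open>b\<close> in L2 of the sphere. Only the differences \<open>w k - u\<close>
  are measured, so \<open>u\<close> may tend to a nonzero constant at infinity.\<close>

definition has_trace :: "(real^3 \<Rightarrow> 'b::euclidean_space) \<Rightarrow> (real^3 \<Rightarrow> 'b) \<Rightarrow> bool" where
  "has_trace u b \<longleftrightarrow> (\<exists>w :: nat \<Rightarrow> real^3 \<Rightarrow> 'b.
     (\<forall>k. C1_fun (w k)) \<and>
     (\<lambda>k. \<integral>\<^sup>+x\<in>exterior_domain. ennreal ((norm (w k x - u x))\<^sup>2) \<partial>lebesgue) \<longlonglongrightarrow> 0 \<and>
     (\<forall>e\<in>Basis. (\<lambda>k. \<integral>\<^sup>+x\<in>exterior_domain.
        ennreal ((norm (partial_deriv e (w k) x - weak_gradient exterior_domain u e x))\<^sup>2)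
        \<partial>lebesgue) \<longlonglongrightarrow> 0) \<and>
     (\<lambda>k. \<integral>\<^sup>+\<omega>. ennreal ((norm (w k \<omega> - b \<omega>))\<^sup>2) \<partial>sphere_measure) \<longlonglongrightarrow> 0)"

section \<open>Q-tensors and energies\<close>

text \<open>The norm of the type \<open>real^3^3\<close> is the Frobenius norm.\<close>

definition S0 :: "(real^3^3) set" where
  "S0 = {Q. transpose Q = Q \<and> trace Q = 0}"

definition uniaxial :: "real^3 \<Rightarrow> real^3^3" where
  "uniaxial n = (\<chi> i j. n $ i * n $ j) - (1/3) *\<^sub>R mat 1"

definition Q_infty :: "real^3^3" where
  "Q_infty = uniaxial (axis 3 1)"

definition f_pot :: "real^3^3 \<Rightarrow> real" where
  "f_pot Q = 2/9 - (1/2) * (norm Q)^2 - trace (Q ** Q ** Q) + (3/4) * (norm Q)^4"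

text \<open>The defining formula makes sense only for \<open>Q \<noteq> 0\<close>; the value \<open>g0\<close> at \<open>0\<close> is a parameter.\<close>

definition g_pot :: "real \<Rightarrow> real^3^3 \<Rightarrow> real" where
  "g_pot g0 Q = (if Q = 0 then g0 else sqrt (2/3) - Q $ 3 $ 3 / norm Q)"

definition energy ::
  "real \<Rightarrow> real \<Rightarrow> real \<Rightarrow> (real^3) set \<Rightarrow> (real^3 \<Rightarrow> real^3^3) \<Rightarrow> ennreal" where
  "energy g0 \<xi> \<eta> A Q =
     (\<integral>\<^sup>+x\<in>A. ennreal
        ((1/2) * (\<Sum>e\<in>Basis. (norm (weak_gradient exterior_domain Q e x))\<^sup>2)
          + (1/\<xi>\<^sup>2) * f_pot (Q x) + (1/\<eta>\<^sup>2) * g_pot g0 (Q x)) \<partial>lebesgue)"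

definition admissible :: "(real^3 \<Rightarrow> real^3^3) \<Rightarrow> (real^3 \<Rightarrow> real^3^3) set" where
  "admissible Qb = {Q. (\<lambda>x. Q x - Q_infty) \<in> H1 exterior_domain S0 \<and> has_trace Q Qb}"

definition cone_over :: "(real^3) set \<Rightarrow> (real^3) set" where
  "cone_over U = {t *\<^sub>R \<omega> | t \<omega>. t > 1 \<and> \<omega> \<in> U}"

section \<open>The one-dimensional problem\<close>

text \<open>In dimension one \<open>Basis = {1}\<close>, so \<open>weak_gradient {1<..} Q 1\<close> is \<open>dQ/dr\<close>.\<close>

definition F_ray :: "real \<Rightarrow> ennreal \<Rightarrow> (real \<Rightarrow> real^3^3) \<Rightarrow> ennreal" where
  "F_ray g0 l Q =
     (if l = \<infinity> then
        (if (AE r in lebesgue. r > 1 \<longrightarrow> f_pot (Q r) = 0)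
         then (\<integral>\<^sup>+r\<in>{1<..}. ennreal
                ((1/2) * (norm (weak_gradient {1<..} Q 1 r))\<^sup>2 + g_pot g0 (Q r)) \<partial>lebesgue)
         else \<infinity>)
      else (\<integral>\<^sup>+r\<in>{1<..}. ennreal
              ((1/2) * (norm (weak_gradient {1<..} Q 1 r))\<^sup>2
                + (enn2real l)\<^sup>2 * f_pot (Q r) + g_pot g0 (Q r)) \<partial>lebesgue))"

text \<open>The condition \<open>Q 1 = Q0\<close> refers to the representative of \<open>Q\<close> that is continuous up to the
  endpoint, which exists and is unique for H1 functions of one variable.\<close>

definition D_min :: "real \<Rightarrow> ennreal \<Rightarrow> real^3^3 \<Rightarrow> ennreal" where
  "D_min g0 l Q0 =
     (INF Q \<in> {Q. (\<lambda>r. Q r - Q_infty) \<in> H1 {1<..} S0 \<and> continuous_on {1..} Q \<and> Q 1 = Q0}.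
        F_ray g0 l Q)"

end

theory Submission
  imports Defs
begin

text \<open>The Hausdorff measure on the sphere is bounded
  by the polar measure, so the energy in a cone dominates the integral over its rays of
  one-dimensional energies; by the definition of the trace almost every ray carries an H1 curve
  starting at the boundary datum. The substitution \<open>t = 1 + \<eta> (r - 1)\<close> turns \<open>\<eta>\<close> times the
  energy of a ray into the energy \<open>F\<^bsub>\<mu>\<^esub>\<close> with \<open>\<mu> = \<eta> / \<xi>\<close>, and it remains to compare
  \<open>F\<^bsub>\<mu>\<^esub>\<close> with \<open>D\<^bsub>\<lambda>\<^esub>\<close>. For finite \<open>\<lambda>\<close> the energies differ by a factor close to 1.
  For \<open>\<lambda> = \<infinity>\<close> put \<open>M = Q + I/3\<close> and \<open>\<kappa> = (3/2)\<^sup>1\<^sup>/\<^sup>4\<close>. Since \<open>f = (3/2) |M\<^sup>2 - M|\<^sup>2\<close>, the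
  calibration \<open>2 \<kappa> sqrt (\<epsilon> + (3 M\<^sup>2 - 2 M\<^sup>3)\<^sub>3\<^sub>3 + K |M\<^sup>2 - M|\<^sup>2)\<close> has squared gradient at most
  \<open>2 (1 + \<rho>) g + C f\<close>, so for large \<open>\<mu>\<close> the energy is almost at least \<open>2 \<kappa> (1 - |n\<^sub>3|)\<close>,
  while an explicit rotating director attains this value for \<open>D\<^sub>\<infinity>\<close>.\<close>

section \<open>Hausdorff measure and polar coordinates\<close>

text \<open>The obstacle at \<lambda> = \<infinity> is that f is quadratic in the defect W = M^2 -
  M. An error linear in W cannot be charged to it: Young's inequality would leave a constant, which
  is not integrable along an infinite ray. On uniaxial tensors the potential 2 \<kappa> |n_3| is
  optimal, because its squared gradient is exactly 2 g. The naive extension by the root of M_33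
  would react to the eigenvalues in first order, whereas the cubic has slope 0 at the eigenvalues 0
  and 1. The \<epsilon> smooths the kink at n_3 = 0, and the multiple of |W|^2 keeps the radicand
  positive. The remaining first-order errors all pair W with Q - \<open>Q_infty\<close>, so that
  Young's inequality splits them into g and f. A calibration bounds every curve, with one threshold
  for \<eta>/\<xi>, so no compactness of minimizing curves enters. The comparison up to a factor
  \<theta> < 1 then holds on almost all rays for the same indices and is integrated over directions
  as it stands, without Fatou's lemma and without measurability of the minimal energy as a function
  of the direction.\<close>

definition disc_area :: "(complex \<times> real) set \<Rightarrow> ennreal" where
  "disc_area C = (\<integral>\<^sup>+p\<in>C. ennreal (pi * (snd p)\<^sup>2) \<partial>count_space UNIV)"

lemma disc_area_Un: "disc_area (C \<union> D) \<le> disc_area C + disc_area D"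
proof -
  have "disc_area (C \<union> D) \<le> (\<integral>\<^sup>+p. ennreal (pi * (snd p)\<^sup>2) * indicator C p
      + ennreal (pi * (snd p)\<^sup>2) * indicator D p \<partial>count_space UNIV)"
    unfolding disc_area_def by (intro nn_integral_mono) (auto split: split_indicator)
  also have "\<dots> = disc_area C + disc_area D"
    unfolding disc_area_def by (rule nn_integral_add) auto
  finally show ?thesis .
qed

lemma disc_area_disjoint:
  assumes "countable C" "pairwise (\<lambda>p q. disjnt (cball (fst p) (snd p)) (cball (fst q) (snd q))) C"
    and r: "\<And>p. p \<in> C \<Longrightarrow> 0 < snd p" and sub: "(\<Union>p\<in>C. cball (fst p) (snd p)) \<subseteq> O'" and O': "O' \<in> sets borel"
  shows "disc_area C \<le> emeasure lborel O'"
proof -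
  have "disc_area C = (\<integral>\<^sup>+p. ennreal (pi * (snd p)\<^sup>2) \<partial>count_space C)"
    by (simp add: disc_area_def nn_integral_count_space_indicator)
  also have "\<dots> = (\<integral>\<^sup>+p. emeasure lborel (cball (fst p) (snd p)) \<partial>count_space C)"
    using r by (intro nn_integral_cong) (force simp: emeasure_cball unit_ball_vol_2 less_imp_le)
  also have "\<dots> = emeasure lborel (\<Union>p\<in>C. cball (fst p) (snd p))"
    using assms(1,2) by (intro emeasure_UN_countable[symmetric])
      (auto simp: disjoint_family_on_def pairwise_def disjnt_def)
  also have "\<dots> \<le> emeasure lborel O'"
    using sub O' by (intro emeasure_mono) auto
  finally show ?thesis .
qed

text \<open>The disjoint subfamily from the covering lemma lies in an open set of measure at most
  e/25, and its fivefold enlargements, which cover, have 25 times the area. Starting with radii up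
  to d/5 keeps the enlarged ones below d.\<close>

lemma disc_cover_null:
  assumes N: "N \<in> null_sets lebesgue" and "0 < d" "0 < (e::real)"
  obtains C where "countable C" "\<And>p. p \<in> C \<Longrightarrow> 0 < snd p \<and> snd p \<le> d"
    "N \<subseteq> (\<Union>p\<in>C. cball (fst p) (snd p))" "disc_area C \<le> ennreal e"
proof -
  from N have "N \<in> null_sets (completion lborel)" by simp
  then obtain N' where N': "N' \<in> null_sets lborel" "N \<subseteq> N'"
    by (auto simp: null_sets_completion_iff2)
  obtain V where V: "open V" "N' \<subseteq> V" "emeasure lborel (V - N') \<le> ennreal (e/25)"
    using outer_regular_lborel_le[of N' "e/25"] N' assms by (auto simp: null_sets_def)
  have "emeasure lborel V \<le> emeasure lborel (V - N') + emeasure lborel N'"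
    using V N' by (metis Diff_partition add.commute emeasure_subadditive null_setsD2 sets.Diff borel_open sets_lborel)
  then have Vm: "emeasure lborel V \<le> ennreal (e/25)"
    using V N' by (auto simp: null_sets_def)
  define K where "K = {p::complex\<times>real. 0 < snd p \<and> snd p \<le> d/5 \<and> cball (fst p) (snd p) \<subseteq> V}"
  have cov: "V \<subseteq> (\<Union>p\<in>K. cball (fst p) (snd p))"
  proof
    fix x assume "x \<in> V"
    then obtain \<epsilon> where "\<epsilon> > 0" "cball x \<epsilon> \<subseteq> V" using V(1) unfolding open_contains_cball by blast
    then have "(x, min \<epsilon> (d/5)) \<in> K" using \<open>d>0\<close> by (auto simp: K_def)
    then show "x \<in> (\<Union>p\<in>K. cball (fst p) (snd p))" using \<open>\<epsilon>>0\<close> \<open>d>0\<close> by force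
  qed
  obtain C where C: "countable C" "C \<subseteq> K"
     "pairwise (\<lambda>i j. disjnt (cball (fst i) (snd i)) (cball (fst j) (snd j))) C"
     "V \<subseteq> (\<Union>i\<in>C. cball (fst i) (5 * snd i))"
    by (rule Vitali_covering_lemma_cballs[OF cov, of "d/5"]) (auto simp: K_def)
  have "disc_area C \<le> emeasure lborel V"
    using C V by (intro disc_area_disjoint) (auto simp: K_def)
  define D where "D = (\<lambda>p. (fst p, 5 * snd p)) ` C"
  have inj: "inj_on (\<lambda>p. (fst p, 5 * snd p)) C"
    by (auto simp: inj_on_def prod_eq_iff)
  have "disc_area D = (\<integral>\<^sup>+p. ennreal (pi * (snd p)\<^sup>2) \<partial>count_space D)"
    by (simp add: disc_area_def nn_integral_count_space_indicator)
  also have "\<dots> = (\<integral>\<^sup>+p. ennreal (pi * (5 * snd p)\<^sup>2) \<partial>count_space C)"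
    unfolding D_def
    by (subst nn_integral_bij_count_space[symmetric, OF inj_on_imp_bij_betw[OF inj]]) simp
  also have "\<dots> = (\<integral>\<^sup>+p. 25 * ennreal (pi * (snd p)\<^sup>2) \<partial>count_space C)"
  proof (intro nn_integral_cong)
    fix p :: "complex \<times> real"
    show "ennreal (pi * (5 * snd p)\<^sup>2) = 25 * ennreal (pi * (snd p)\<^sup>2)"
      using ennreal_mult''[of "pi * (snd p)\<^sup>2" 25] by (simp add: power_mult_distrib mult.left_commute)
  qed
  also have "\<dots> = 25 * disc_area C"
    by (simp add: disc_area_def nn_integral_count_space_indicator[of C] nn_integral_cmult)
  also have "\<dots> \<le> 25 * ennreal (e/25)"
    using \<open>disc_area C \<le> emeasure lborel V\<close> Vm by (intro mult_left_mono) auto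
  also have "\<dots> = ennreal e"
    using \<open>0 < e\<close> by (simp flip: ennreal_numeral ennreal_mult)
  finally have a: "disc_area D \<le> ennreal e" .
  show thesis
  proof (rule that[of D])
    show "countable D" using C by (simp add: D_def)
    show "disc_area D \<le> ennreal e" by fact
    show "N \<subseteq> (\<Union>p\<in>D. cball (fst p) (snd p))"
      using N' V C by (auto simp: D_def)
    show "\<And>p. p \<in> D \<Longrightarrow> 0 < snd p \<and> snd p \<le> d"
      using C by (auto simp: D_def K_def)
  qed
qed

text \<open>Discs are essential: \<open>hausdorff2_pre\<close> weighs a set by the disc of the same
  diameter, so squares would lose a constant. Disjoint discs inside a slightly larger open set carry
  at most its measure. What the Vitali theorem leaves uncovered is null and costs the other half of
  \<open>e\<close>.\<close>

lemma disc_cover: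
  assumes B: "B \<in> sets borel" and "0 < d" "0 < (e::real)"
  obtains C where "countable C" "\<And>p. p \<in> C \<Longrightarrow> 0 < snd p \<and> snd p \<le> d"
    "B \<subseteq> (\<Union>p\<in>C. cball (fst p) (snd p))" "disc_area C \<le> emeasure lborel B + ennreal e"
proof -
  obtain V where V: "open V" "B \<subseteq> V" "emeasure lborel (V - B) \<le> ennreal (e/2)"
    using outer_regular_lborel_le[of B "e/2"] assms by auto
  have "emeasure lborel V \<le> emeasure lborel B + emeasure lborel (V - B)"
    using V B by (metis Diff_partition emeasure_subadditive sets.Diff borel_open sets_lborel)
  also have "\<dots> \<le> emeasure lborel B + ennreal (e/2)"
    using V by (intro add_left_mono)
  finally have Vm: "emeasure lborel V \<le> emeasure lborel B + ennreal (e/2)" .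
  define K where "K = {p::complex\<times>real. 0 < snd p \<and> snd p \<le> d \<and> cball (fst p) (snd p) \<subseteq> V}"
  have cov: "\<exists>p. p \<in> K \<and> x \<in> cball (fst p) (snd p) \<and> snd p < r" if x: "x \<in> V" "0 < r" for x r
  proof -
    obtain \<epsilon> where "\<epsilon> > 0" "cball x \<epsilon> \<subseteq> V" using V(1) x(1) unfolding open_contains_cball by blast
    then have "(x, min \<epsilon> (min d (r/2))) \<in> K" using \<open>d>0\<close> x by (auto simp: K_def)
    then show ?thesis using \<open>\<epsilon>>0\<close> \<open>d>0\<close> x by (intro exI[of _ "(x, min \<epsilon> (min d (r/2)))"]) auto
  qed
  obtain C where C: "countable C" "C \<subseteq> K"
     "pairwise (\<lambda>i j. disjnt (cball (fst i) (snd i)) (cball (fst j) (snd j))) C"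
     "negligible (V - (\<Union>i\<in>C. cball (fst i) (snd i)))"
    by (rule Vitali_covering_theorem_cballs[of K snd V fst]) (use cov in \<open>auto simp: K_def\<close>)
  have aC: "disc_area C \<le> emeasure lborel V"
    using C V by (intro disc_area_disjoint) (auto simp: K_def)
  obtain D where D: "countable D" "\<And>p. p \<in> D \<Longrightarrow> 0 < snd p \<and> snd p \<le> d"
    "V - (\<Union>i\<in>C. cball (fst i) (snd i)) \<subseteq> (\<Union>p\<in>D. cball (fst p) (snd p))" "disc_area D \<le> ennreal (e/2)"
    by (rule disc_cover_null[OF C(4)[unfolded negligible_iff_null_sets], of d "e/2"]) (use assms in auto)
  have "disc_area (C \<union> D) \<le> (emeasure lborel B + ennreal (e/2)) + ennreal (e/2)"
    using disc_area_Un[of C D] aC Vm D(4) by (meson add_mono order_trans)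
  also have "\<dots> = emeasure lborel B + ennreal e"
    using \<open>0 < e\<close> by (simp add: add.assoc flip: ennreal_plus)
  finally show thesis
    using C D V by (intro that[of "C \<union> D"]) (auto simp: K_def subset_iff)
qed

section \<open>Area of a spherical set against the volume of its cone\<close>

text \<open>Outside the open unit ball the radial projection is the nearest-point projection onto
  the closed ball, and projections onto closed convex sets do not increase distances.\<close>

lemma sgn_Lipschitz:
  fixes x y :: "'a::euclidean_space"
  assumes "1 \<le> norm x" "1 \<le> norm y"
  shows "norm (sgn x - sgn y) \<le> norm (x - y)"
proof -
  have *: "closest_point (cball 0 1) z = sgn z" if "1 \<le> norm z" for z :: 'a
  proof (rule closest_point_unique[symmetric])
    show "\<forall>w\<in>cball 0 1. dist z (sgn z) \<le> dist z w"
    proof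
      fix w :: 'a assume "w \<in> cball 0 1"
      then have w: "norm z - 1 \<le> dist z w" 
        using norm_triangle_ineq2[of z w] by (simp add: dist_norm)
      have "z - sgn z = (1 - 1 / norm z) *\<^sub>R z"
        by (simp add: sgn_div_norm scaleR_diff_left divide_inverse)
      then have d: "dist z (sgn z) = \<bar>1 - 1 / norm z\<bar> * norm z"
        by (simp add: dist_norm)
      have "\<bar>1 - 1 / norm z\<bar> * norm z = norm z - 1" using that
        by (cases "z = 0") (simp_all add: abs_if field_simps)
      with w d show "dist z (sgn z) \<le> dist z w" by simp
    qed
  qed (auto simp: norm_sgn)
  show ?thesis
    using closest_point_lipschitz[of "cball 0 1" x y] *[OF assms(1)] *[OF assms(2)]
    by (simp add: dist_norm)
qed

text \<open>A contraction maps a disc of radius r to a set of diameter at most 2 r, whose weight is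
  at most the area of the disc. A nearly optimal disc cover of B thus yields a cover of the image of
  no greater weight.\<close>

lemma hausdorff2_pre_Lipschitz_image:
  fixes \<phi> :: "complex \<Rightarrow> 'a::real_normed_vector"
  assumes lip: "\<And>y z. norm (\<phi> y - \<phi> z) \<le> norm (y - z)" and B: "B \<in> sets borel" and d: "0 < \<delta>"
  shows "hausdorff2_pre \<delta> (\<phi> ` B) \<le> emeasure lborel B"
proof (rule ennreal_le_epsilon)
  fix e :: real assume "0 < e"
  obtain C where C: "countable C" "\<And>p. p \<in> C \<Longrightarrow> 0 < snd p \<and> snd p \<le> \<delta> / 2"
    "B \<subseteq> (\<Union>p\<in>C. cball (fst p) (snd p))" "disc_area C \<le> emeasure lborel B + ennreal e"
    by (rule disc_cover[OF B, of "\<delta>/2" e]) (use d \<open>0<e\<close> in auto)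
  define I where "I = to_nat_on C ` C"
  define S where "S = (\<lambda>p. \<phi> ` cball (fst p) (snd p))"
  \<comment> \<open>Covers are sequences here. Indices that code no disc receive the empty set,
    which has diameter 0 and weight 0.\<close>
  define T where "T = (\<lambda>i. if i \<in> I then S (from_nat_into C i) else {})"
  have diam: "bounded (S p) \<and> diameter (S p) \<le> 2 * snd p" if "p \<in> C" for p
  proof -
    have "norm (u - v) \<le> 2 * snd p" if uv: "u \<in> S p" "v \<in> S p" for u v
    proof -
      obtain y z where yz: "u = \<phi> y" "v = \<phi> z" "dist (fst p) y \<le> snd p" "dist (fst p) z \<le> snd p"
        using uv unfolding S_def by fastforce
      then have "norm (y - z) \<le> 2 * snd p"
        using dist_triangle3[of y z "fst p"] by (simp add: dist_norm)
      then show ?thesis using lip[of y z] yz by simp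
    qed
    moreover have "bounded (S p)"
      using calculation unfolding bounded_two_points dist_norm by blast
    ultimately show ?thesis using C(2)[OF that] by (auto intro: diameter_le)
  qed
  have bij: "bij_betw (to_nat_on C) C I"
    unfolding I_def using inj_on_to_nat_on[OF C(1)] by (rule inj_on_imp_bij_betw)
  have fr: "from_nat_into C i \<in> C" if "i \<in> I" for i
    using that C(1) by (auto simp: I_def)
  have "hausdorff2_pre \<delta> (\<phi> ` B) \<le> (\<Sum>i. ennreal (pi * (diameter (T i) / 2)\<^sup>2))"
    unfolding hausdorff2_pre_def
  proof (rule INF_lower, safe)
    fix y assume "y \<in> B"
    then obtain p where p: "p \<in> C" "y \<in> cball (fst p) (snd p)" using C(3) by auto
    then have "\<phi> y \<in> T (to_nat_on C p)" using C(1) by (auto simp: T_def I_def S_def)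
    then show "\<phi> y \<in> (\<Union>i. T i)" by blast
  next
    fix i show "bounded (T i)" using diam fr by (auto simp: T_def)
    show "diameter (T i) \<le> \<delta>" using diam[OF fr[of i]] C(2)[OF fr[of i]] d by (auto simp: T_def)
  qed
  also have "\<dots> = (\<integral>\<^sup>+i. ennreal (pi * (diameter (T i) / 2)\<^sup>2) \<partial>count_space UNIV)"
    by (simp add: nn_integral_count_space_nat)
  also have "\<dots> \<le> (\<integral>\<^sup>+i. ennreal (pi * (snd (from_nat_into C i))\<^sup>2) * indicator I i \<partial>count_space UNIV)"
  proof (intro nn_integral_mono)
    fix i
    have "0 \<le> diameter (T i)" if "i \<in> I"
      using diam[OF fr[OF that]] that by (auto simp: T_def intro!: diameter_ge_0)
    then show "ennreal (pi * (diameter (T i) / 2)\<^sup>2) \<le> ennreal (pi * (snd (from_nat_into C i))\<^sup>2) * indicator I i"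
      using diam[OF fr[of i]] by (auto simp: T_def intro!: ennreal_leI power_mono split: split_indicator)
  qed
  also have "\<dots> = (\<integral>\<^sup>+i. ennreal (pi * (snd (from_nat_into C i))\<^sup>2) \<partial>count_space I)"
    by (simp add: nn_integral_count_space_indicator)
  also have "\<dots> = (\<integral>\<^sup>+p. ennreal (pi * (snd p)\<^sup>2) \<partial>count_space C)"
    by (subst nn_integral_bij_count_space[OF bij, symmetric]) (auto intro!: nn_integral_cong simp: C(1))
  also have "\<dots> = disc_area C"
    by (simp add: disc_area_def nn_integral_count_space_indicator)
  finally show "hausdorff2_pre \<delta> (\<phi> ` B) \<le> emeasure lborel B + ennreal e"
    using C(4) by (rule order_trans)
qed

lemma sets_hausdorff2 [simp, measurable_cong]: "sets (hausdorff2 :: 'a::metric_space measure) = sets borel"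
  unfolding hausdorff2_def using sets.sigma_sets_eq[of "borel :: 'a measure"] by simp

text \<open>\<open>measure_of\<close> returns the given set function if that is a measure, and 0
  otherwise; an upper bound is valid in both cases.\<close>

lemma emeasure_hausdorff2_le:
  assumes "\<And>\<delta>. 0 < \<delta> \<Longrightarrow> hausdorff2_pre \<delta> A \<le> c"
  shows "emeasure hausdorff2 A \<le> c"
proof -
  have "(SUP \<delta>\<in>{0<..}. hausdorff2_pre \<delta> A) \<le> c"
    using assms by (intro SUP_least) auto
  then show ?thesis
    unfolding hausdorff2_def emeasure_measure_of_conv by (auto simp only: zero_le split: if_split)
qed

lemma Basis_real3: "(Basis :: (real^3) set) = {axis 1 1, axis 2 1, axis 3 1}"
proof -
  have "(Basis :: (real^3) set) = (\<lambda>i. axis i 1) ` UNIV"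
    by (auto simp: Basis_vec_def)
  then show ?thesis by (simp only: UNIV_3 image_insert image_empty)
qed

text \<open>Space is viewed as plane times axis with p on the axis: disc covers live in the plane,
  and Fubini slices along the axis. V is the coordinate identification followed by a rotation that
  takes the third axis to p; both preserve Lebesgue measure, as is tested on boxes.\<close>

lemma isometric_frame:
  fixes p :: "real^3"
  assumes "norm p = 1"
  obtains V :: "complex \<times> real \<Rightarrow> real^3"
  where "linear V" "surj V" "\<And>x y. V x \<bullet> V y = x \<bullet> y" "V (0, 1) = p" "distr lborel borel V = lborel"
proof -
  define L :: "complex \<times> real \<Rightarrow> real^3" where "L = (\<lambda>x. vector [Re (fst x), Im (fst x), snd x])"
  have linL: "linear L"
    by (rule linearI) (simp_all add: L_def vec_eq_iff forall_3)
  have [measurable]: "L \<in> borel_measurable borel"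
    using linL by (simp add: borel_measurable_continuous_onI linear_continuous_on linear_conv_bounded_linear)
  have distrL: "distr lborel borel L = lborel"
  proof (rule lborel_eqI[symmetric])
    fix l u :: "real^3" assume le: "\<And>b. b \<in> Basis \<Longrightarrow> l \<bullet> b \<le> u \<bullet> b"
    have eq: "L -` box l u = box (Complex (l$1) (l$2), l$3) (Complex (u$1) (u$2), u$3)"
      by (auto simp: L_def mem_box Basis_real3 Basis_prod_def Basis_complex_def inner_axis)
    have le': "l$1 \<le> u$1" "l$2 \<le> u$2" "l$3 \<le> u$3"
      using le[of "axis 1 1"] le[of "axis 2 1"] le[of "axis 3 1"] by (auto simp: Basis_real3 inner_axis)
    have "emeasure (distr lborel borel L) (box l u) = emeasure lborel (L -` box l u)"
      by (subst emeasure_distr) auto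
    also have "\<dots> = ennreal ((u$1 - l$1) * (u$2 - l$2) * (u$3 - l$3))"
      using le' unfolding eq emeasure_lborel_box_eq
      by (subst if_P) (auto simp: Basis_prod_def Basis_complex_def complex_eq_iff inner_complex_def image_Un prod.union_disjoint algebra_simps)
    also have "\<dots> = ennreal (\<Prod>b\<in>Basis. (u - l) \<bullet> b)"
      by (simp add: Basis_real3 inner_axis axis_eq_axis algebra_simps)
    finally show "emeasure (distr lborel borel L) (box l u) = ennreal (\<Prod>b\<in>Basis. (u - l) \<bullet> b)" .
  qed simp
  obtain R :: "real^3 \<Rightarrow> real^3" where R: "orthogonal_transformation R" "R (axis 3 1) = p"
    by (rule orthogonal_transformation_exists[of "axis 3 1 :: real^3" p]) (use assms in auto)
  have linR: "linear R" using R(1) by (rule orthogonal_transformation_linear)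
  have [measurable]: "R \<in> borel_measurable borel"
    using linR by (simp add: borel_measurable_continuous_onI linear_continuous_on linear_conv_bounded_linear)
  have distrR: "distr lborel borel R = lborel"
  proof (rule lborel_eqI[symmetric])
    fix l u :: "real^3" assume le: "\<And>b. b \<in> Basis \<Longrightarrow> l \<bullet> b \<le> u \<bullet> b"
    have "emeasure (distr lborel borel R) (box l u) = emeasure lborel (R -` box l u)"
      by (subst emeasure_distr) auto
    also have "R -` box l u = inv R ` box l u"
      using R(1) by (simp add: bij_vimage_eq_inv_image orthogonal_transformation_bij)
    also have "emeasure lborel (inv R ` box l u) = emeasure lebesgue (inv R ` box l u)"
    proof -
      have "R -` box l u \<in> sets borel"
        using measurable_sets[of R borel borel "box l u"] by simp
      then show ?thesis using \<open>R -` box l u = inv R ` box l u\<close> by simp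
    qed
    also have "\<dots> = ennreal (measure lebesgue (inv R ` box l u))"
      using measurable_orthogonal_image[OF orthogonal_transformation_inv[OF R(1)], of "box l u"]
      by (intro emeasure_eq_measure2) auto
    also have "\<dots> = ennreal (measure lebesgue (box l u))"
      using measure_orthogonal_image[OF orthogonal_transformation_inv[OF R(1)], of "box l u"] by simp
    also have "\<dots> = ennreal (\<Prod>b\<in>Basis. (u - l) \<bullet> b)"
      using le by (simp add: measure_lborel_box)
    finally show "emeasure (distr lborel borel R) (box l u) = ennreal (\<Prod>b\<in>Basis. (u - l) \<bullet> b)" .
  qed simp
  show thesis
  proof (rule that[of "R \<circ> L"])
    show "linear (R \<circ> L)" using linL linR by (rule linear_compose)
    have "x = L (Complex (x$1) (x$2), x$3)" for x
      by (simp add: L_def vec_eq_iff forall_3)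
    then have "surj L" by (metis surj_def)
    then show "surj (R \<circ> L)"
      using orthogonal_transformation_surj[OF R(1)] by (rule comp_surj)
    show "(R \<circ> L) x \<bullet> (R \<circ> L) y = x \<bullet> y" for x y
      using R(1) by (simp add: orthogonal_transformation_def L_def inner_vec_def sum_3 inner_prod_def inner_complex_def)
    have "L (0, 1) = axis 3 1"
      by (simp add: L_def vec_eq_iff forall_3 axis_def)
    then show "(R \<circ> L) (0, 1) = p" using R(2) by simp
    show "distr lborel borel (R \<circ> L) = lborel"
      using distr_distr[of R borel borel L lborel] distrL distrR by simp
  qed
qed

lemma emeasure_lborel_scaled:
  fixes B :: "'a::euclidean_space set"
  assumes B: "B \<in> sets borel" and t: "t > 0"
  shows "emeasure lborel {z. (1 / t) *\<^sub>R z \<in> B} = ennreal (t ^ DIM('a)) * emeasure lborel B"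
proof -
  have eq: "{z. (1 / t) *\<^sub>R z \<in> B} = (\<lambda>x. t *\<^sub>R x + 0) ` B"
    using t by (force simp: image_iff)
  have m: "{z. (1 / t) *\<^sub>R z \<in> B} \<in> sets borel"
    using measurable_sets[of "\<lambda>z. (1 / t) *\<^sub>R z" borel borel B] B by (simp add: vimage_def)
  have "emeasure lborel {z. (1 / t) *\<^sub>R z \<in> B} = emeasure lebesgue ((\<lambda>x. t *\<^sub>R x + 0) ` B)"
    using m unfolding eq by simp
  also have "\<dots> = ennreal (t ^ DIM('a)) * emeasure lborel B"
    unfolding emeasure_lebesgue_affine using B t by simp
  finally show ?thesis .
qed

text \<open>Three times the volume of this cone is the polar surface measure of A.\<close>

definition unit_cone :: "'a::euclidean_space set \<Rightarrow> 'a set" where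
  "unit_cone A = {x. x \<in> cball 0 1 \<and> x \<noteq> 0 \<and> sgn x \<in> A}"

lemma unit_cone_borel [measurable]:
  assumes "A \<in> sets borel"
  shows "unit_cone A \<in> sets borel"
proof -
  have "unit_cone A = cball 0 1 \<inter> - {0} \<inter> sgn -` A"
    by (auto simp: unit_cone_def)
  then show ?thesis
    using measurable_sets[OF borel_measurable_sgn, of A] assms by auto
qed

text \<open>Radial projection from the tangent plane at p contracts, so the Hausdorff measure of A
  is at most the planar measure of its chart image B. The flat cone over B of height \<rho> has
  \<rho>^3/3 times that measure as volume, and it fits into the unit cone since A stays where the
  cosine to p exceeds \<rho>.\<close>

lemma hausdorff2_le_cone_patch:
  fixes p :: "real^3"
  assumes p: "norm p = 1" and \<rho>: "0 < \<rho>" and A: "A \<in> sets borel"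
    and sub: "\<And>\<omega>. \<omega> \<in> A \<Longrightarrow> norm \<omega> = 1 \<and> \<omega> \<bullet> p > \<rho>"
  shows "ennreal (\<rho>^3) * emeasure hausdorff2 A \<le> 3 * emeasure lborel (unit_cone A)"
proof -
  obtain V :: "complex \<times> real \<Rightarrow> real^3" where V: "linear V" "surj V" "\<And>x y. V x \<bullet> V y = x \<bullet> y"
    "V (0, 1) = p" "distr lborel borel V = lborel"
    using isometric_frame[OF p] by blast
  have [measurable]: "V \<in> borel_measurable borel"
    using V(1) by (simp add: borel_measurable_continuous_onI linear_continuous_on linear_conv_bounded_linear)
  have normV: "norm (V x) = norm x" for x
    by (simp add: norm_eq_sqrt_inner V(3))
  have V1: "1 \<le> norm (V (y, 1))" for y
    by (simp add: normV norm_Pair)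
  \<comment> \<open>the gnomonic chart centred at \<open>p\<close>; it is a contraction of the plane onto a half-sphere\<close>
  define \<phi> where "\<phi> = (\<lambda>y. sgn (V (y, 1)))"
  have [measurable]: "\<phi> \<in> borel_measurable borel"
    unfolding \<phi>_def by measurable
  define B where "B = \<phi> -` A"
  have B: "B \<in> sets borel" using measurable_sets[of \<phi> borel borel A] A by (simp add: B_def)
  have image: "\<phi> ` B = A"
  proof
    show "A \<subseteq> \<phi> ` B"
    proof
      fix \<omega> assume "\<omega> \<in> A"
      obtain z \<tau> where z: "\<omega> = V (z, \<tau>)" using V(2) by (metis surjD surj_pair)
      have "\<tau> = \<omega> \<bullet> p"
        using V(3)[of "(z,\<tau>)" "(0,1)"] V(4) by (simp add: z)
      then have \<tau>: "\<tau> > 0" "norm \<omega> = 1" using sub[OF \<open>\<omega> \<in> A\<close>] \<rho> by auto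
      have "V ((1/\<tau>) *\<^sub>R z, 1) = (1/\<tau>) *\<^sub>R V (z, \<tau>)"
        using linear_scale[OF V(1), of "1/\<tau>" "(z,\<tau>)"] \<tau> by simp
      then have "\<phi> ((1/\<tau>) *\<^sub>R z) = \<omega>"
        using \<tau> by (simp add: \<phi>_def z[symmetric] sgn_scaleR sgn_div_norm)
      then show "\<omega> \<in> \<phi> ` B" using \<open>\<omega> \<in> A\<close> by (force simp: B_def)
    qed
  qed (auto simp: B_def)
  have lip: "norm (\<phi> y - \<phi> z) \<le> norm (y - z)" for y z
  proof -
    have "norm (\<phi> y - \<phi> z) \<le> norm (V (y, 1) - V (z, 1))"
      unfolding \<phi>_def by (rule sgn_Lipschitz) (rule V1)+
    also have "\<dots> = norm (y - z)"
      using linear_diff[OF V(1), of "(y,1)" "(z,1)"] by (simp add: normV norm_Pair flip: linear_diff[OF V(1)])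
    finally show ?thesis .
  qed
  have H: "emeasure hausdorff2 A \<le> emeasure lborel B"
    using emeasure_hausdorff2_le[of A] hausdorff2_pre_Lipschitz_image[OF lip B] unfolding image by blast
  define K where "K = {x :: complex \<times> real. 0 < snd x \<and> snd x < \<rho> \<and> (1 / snd x) *\<^sub>R fst x \<in> B}"
  have K[measurable]: "K \<in> sets borel"
  proof -
    have [measurable]: "snd \<in> borel_measurable (borel :: (complex \<times> real) measure)"
        "fst \<in> borel_measurable (borel :: (complex \<times> real) measure)"
      by (auto intro!: borel_measurable_continuous_onI continuous_intros)
    have "K = {x. 0 < snd x} \<inter> {x. snd x < \<rho>} \<inter> (\<lambda>x. (1 / snd x) *\<^sub>R fst x) -` B"
      by (auto simp: K_def)
    moreover have "(\<lambda>x :: complex \<times> real. (1 / snd x) *\<^sub>R fst x) \<in> borel_measurable borel"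
      by measurable
    then have "(\<lambda>x :: complex \<times> real. (1 / snd x) *\<^sub>R fst x) -` B \<in> sets borel"
      using measurable_sets[of _ borel borel B] B by fastforce
    moreover have "{x :: complex \<times> real. 0 < snd x} \<in> sets borel" "{x :: complex \<times> real. snd x < \<rho>} \<in> sets borel"
      by (auto intro!: borel_open open_Collect_less continuous_intros)
    ultimately show ?thesis by auto
  qed
  \<comment> \<open>The point of height t over y lies at distance t /
    (\<open>\<phi> y \<bullet> p\<close>) from the origin, which is below 1 for t < \<rho>.\<close>
  have "K \<subseteq> V -` unit_cone A"
  proof
    fix x assume x: "x \<in> K"
    obtain z t where zt: "x = (z, t)" by fastforce
    define y where "y = (1/t) *\<^sub>R z"
    have t: "0 < t" "t < \<rho>" "y \<in> B" "x = t *\<^sub>R (y, 1)"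
      using x by (auto simp: K_def zt y_def)
    have Vx: "V x = t *\<^sub>R V (y, 1)" unfolding t(4) by (rule linear_scale[OF V(1)])
    have "\<phi> y \<in> A" using t by (simp add: B_def)
    then have "\<rho> < \<phi> y \<bullet> p" using sub by blast
    also have "\<phi> y \<bullet> p = 1 / norm (V (y,1))"
      using V(3)[of "(y,1)" "(0,1)"] V(4) by (simp add: \<phi>_def sgn_div_norm divide_inverse)
    finally have "norm (V (y,1)) * \<rho> < 1"
      using V1[of y] by (subst (asm) pos_less_divide_eq) (auto simp: mult.commute)
    moreover have "norm (V x) \<le> \<rho> * norm (V (y, 1))"
    proof -
      have "norm (V x) = t * norm (V (y, 1))" using t(1) by (simp only: Vx norm_scaleR abs_of_pos)
      then show ?thesis using t(2) by (simp add: mult_right_mono)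
    qed
    ultimately have "norm (V x) \<le> 1" by (simp add: mult.commute)
    moreover have "V x \<noteq> 0" using t(1) V1[of y] unfolding Vx by auto
    moreover have "sgn (V x) = \<phi> y" using t(1) by (simp only: Vx \<phi>_def sgn_scaleR sgn_pos scaleR_one)
    ultimately show "x \<in> V -` unit_cone A"
      using \<open>\<phi> y \<in> A\<close> by (simp add: unit_cone_def)
  qed
  \<comment> \<open>Fubini over the height: the slice of K at height t is t B, of area t^2 times
    that of B. The end heights 0 and \<rho> form a null set.\<close>
  have "ennreal (\<rho>^3 / 3) * emeasure lborel B = (\<integral>\<^sup>+t\<in>{0..\<rho>}. ennreal (t\<^sup>2) \<partial>lborel) * emeasure lborel B"
    using nn_integral_FTC_Icc[of "\<lambda>t. t\<^sup>2" 0 \<rho> "\<lambda>t. t^3/3"] \<rho>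
    by (subst nn_integral_FTC_Icc[of "\<lambda>t. t\<^sup>2" 0 \<rho> "\<lambda>t. t^3/3"]) (auto intro!: derivative_eq_intros)
  also have "\<dots> = (\<integral>\<^sup>+t. ennreal (t\<^sup>2) * indicator {0..\<rho>} t * emeasure lborel B \<partial>lborel)"
    by (simp add: nn_integral_multc)
  also have "\<dots> = (\<integral>\<^sup>+t. emeasure lborel ((\<lambda>z. (z, t)) -` K) \<partial>lborel)"
  proof (rule nn_integral_cong_AE, rule AE_mp[OF AE_lborel_singleton[of 0] AE_mp[OF AE_lborel_singleton[of \<rho>]]], intro AE_I2 impI)
    fix t :: real assume t: "t \<noteq> \<rho>" "t \<noteq> 0"
    show "ennreal (t\<^sup>2) * indicator {0..\<rho>} t * emeasure lborel B = emeasure lborel ((\<lambda>z. (z, t)) -` K)"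
    proof (cases "0 < t \<and> t < \<rho>")
      case True
      then have "(\<lambda>z. (z, t)) -` K = {z. (1 / t) *\<^sub>R z \<in> B}" by (auto simp: K_def)
      then show ?thesis using True emeasure_lborel_scaled[OF B, of t] by simp
    next
      case False
      then have "(\<lambda>z. (z, t)) -` K = {}" by (auto simp: K_def)
      then show ?thesis using False t by auto
    qed
  qed
  also have "\<dots> = emeasure lborel K"
    using lborel_pair.emeasure_pair_measure_alt2[of K] K
    unfolding lborel_prod sets_lborel by auto
  also have "\<dots> \<le> emeasure lborel (V -` unit_cone A)"
    using \<open>K \<subseteq> _\<close> measurable_sets[of V borel borel "unit_cone A"] unit_cone_borel[OF A]
    by (intro emeasure_mono) auto
  also have "\<dots> = emeasure (distr lborel borel V) (unit_cone A)"
    using unit_cone_borel[OF A] by (subst emeasure_distr) auto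
  finally have C: "ennreal (\<rho>^3 / 3) * emeasure lborel B \<le> emeasure lborel (unit_cone A)"
    by (simp add: V(5))
  have e: "ennreal (\<rho>^3) = 3 * ennreal (\<rho>^3/3)"
    using \<rho> ennreal_mult''[of "\<rho>^3/3" 3] by simp
  have "ennreal (\<rho>^3) * emeasure hausdorff2 A \<le> ennreal (\<rho>^3) * emeasure lborel B"
    by (intro mult_left_mono H) auto
  also have "\<dots> \<le> 3 * emeasure lborel (unit_cone A)"
    unfolding e mult.assoc by (intro mult_left_mono C) auto
  finally show ?thesis .
qed

text \<open>Finitely many caps of cosine above \<rho> cover the sphere. Both sides are additive over
  disjoint pieces of A, so the factor \<rho>^3 does not worsen with the number of caps, and it
  disappears as \<rho> tends to 1.\<close>

lemma hausdorff2_le_cone: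
  fixes A :: "(real^3) set"
  assumes A: "A \<in> sets borel" "A \<subseteq> sphere 0 1"
  shows "emeasure hausdorff2 A \<le> 3 * emeasure lborel (unit_cone A)"
proof -
  have *: "ennreal (\<rho>^3) * emeasure hausdorff2 A \<le> 3 * emeasure lborel (unit_cone A)" if \<rho>: "0 < \<rho>" "\<rho> < 1" for \<rho>
  proof -
    define P :: "real^3 \<Rightarrow> (real^3) set" where "P = (\<lambda>p. {x. \<rho> < x \<bullet> p})"
    have "compact (sphere (0::real^3) 1)" by simp
    moreover have "\<And>p. p \<in> sphere (0::real^3) 1 \<Longrightarrow> open (P p)"
      unfolding P_def by (intro open_Collect_less continuous_intros)
    moreover have "sphere 0 1 \<subseteq> (\<Union>p\<in>sphere 0 1. P p)"
      using \<rho> by (auto simp: P_def norm_eq_1 intro!: bexI)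
    ultimately obtain F where F: "F \<subseteq> sphere 0 1" "finite F" "sphere 0 1 \<subseteq> (\<Union>p\<in>F. P p)"
      by (rule compactE_image)
    have P[measurable]: "P p \<in> sets borel" for p unfolding P_def by measurable
    \<comment> \<open>Generalised over A, because the step cuts A along one cap and applies the
      hypothesis to the remainder.\<close>
    have "\<forall>A. A \<in> sets borel \<and> A \<subseteq> sphere 0 1 \<and> A \<subseteq> (\<Union>p\<in>F. P p) \<longrightarrow>
       ennreal (\<rho>^3) * emeasure hausdorff2 A \<le> 3 * emeasure lborel (unit_cone A)"
      using F(2,1)
    proof (induction F)
      case empty then show ?case by auto
    next
      case (insert p F)
      show ?case
      proof (intro allI impI, elim conjE)
        fix A :: "(real^3) set"
        assume A[measurable]: "A \<in> sets borel" and A': "A \<subseteq> sphere 0 1" "A \<subseteq> (\<Union>p\<in>insert p F. P p)"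
        have 1: "ennreal (\<rho>^3) * emeasure hausdorff2 (A \<inter> P p) \<le> 3 * emeasure lborel (unit_cone (A \<inter> P p))"
          using insert.prems A' \<rho> A by (intro hausdorff2_le_cone_patch[of p]) (auto simp: P_def)
        have 2: "ennreal (\<rho>^3) * emeasure hausdorff2 (A - P p) \<le> 3 * emeasure lborel (unit_cone (A - P p))"
        proof -
          have "A - P p \<in> sets borel" "A - P p \<subseteq> sphere 0 1" "A - P p \<subseteq> (\<Union>p\<in>F. P p)"
            using A' by auto
          moreover have "F \<subseteq> sphere 0 1" using insert.prems by simp
          ultimately show ?thesis using insert.IH by blast
        qed
        have "emeasure hausdorff2 A = emeasure hausdorff2 (A \<inter> P p) + emeasure hausdorff2 (A - P p)"
          by (subst plus_emeasure) (auto intro: arg_cong[where f="emeasure hausdorff2"])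
        moreover have "unit_cone A = unit_cone (A \<inter> P p) \<union> unit_cone (A - P p)"
          by (auto simp: unit_cone_def)
        then have "emeasure lborel (unit_cone A) = emeasure lborel (unit_cone (A \<inter> P p)) + emeasure lborel (unit_cone (A - P p))"
          by (simp only:) (subst plus_emeasure, simp_all add: unit_cone_borel, auto simp: unit_cone_def)
        ultimately show "ennreal (\<rho>^3) * emeasure hausdorff2 A \<le> 3 * emeasure lborel (unit_cone A)"
          using add_mono[OF 1 2] by (simp add: distrib_left)
      qed
    qed
    then show ?thesis using A F(3) by blast
  qed
  have "((\<lambda>\<rho>. ennreal (\<rho>^3) * emeasure hausdorff2 A) \<longlongrightarrow> ennreal (1^3) * emeasure hausdorff2 A) (at_left (1::real))"
    by (intro tendsto_mult_ennreal tendsto_ennrealI tendsto_intros) auto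
  moreover have "eventually (\<lambda>\<rho>. ennreal (\<rho>^3) * emeasure hausdorff2 A \<le> 3 * emeasure lborel (unit_cone A)) (at_left (1::real))"
    using eventually_at_left_real[of 0 "1::real"] * by (auto elim!: eventually_mono)
  ultimately have "ennreal (1^3) * emeasure hausdorff2 A \<le> 3 * emeasure lborel (unit_cone A)"
    by (rule tendsto_upperbound) simp
  then show ?thesis by simp
qed

section \<open>Polar integration\<close>

lemma nn_integral_lborel_scale:
  fixes h :: "'a::euclidean_space \<Rightarrow> ennreal"
  assumes [measurable]: "h \<in> borel_measurable borel" and r: "r > 0"
  shows "(\<integral>\<^sup>+x. h x \<partial>lborel) = ennreal (r ^ DIM('a)) * (\<integral>\<^sup>+y. h (r *\<^sub>R y) \<partial>lborel)"
proof -
  have "(\<integral>\<^sup>+x. h x \<partial>lborel) =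
      (\<integral>\<^sup>+x. h x \<partial>density (distr lborel borel (\<lambda>x. 0 + r *\<^sub>R x)) (\<lambda>_. ennreal (\<bar>r\<bar> ^ DIM('a))))"
    using lborel_affine[of r "0::'a"] r by simp
  also have "\<dots> = ennreal (r ^ DIM('a)) * (\<integral>\<^sup>+y. h (r *\<^sub>R y) \<partial>lborel)"
    using r by (simp add: nn_integral_density nn_integral_distr nn_integral_cmult)
  finally show ?thesis .
qed

lemma nn_integral_inverse_power4:
  assumes "0 < a"
  shows "(\<integral>\<^sup>+r\<in>{a..}. ennreal (1 / r^4) \<partial>lborel) = ennreal (1 / (3 * a^3))"
proof -
  have "(\<integral>\<^sup>+r\<in>{a..}. ennreal (1 / r^4) \<partial>lborel) = ennreal (0 - (- 1 / (3 * a^3)))"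
  proof (rule nn_integral_FTC_atLeast)
    show "((\<lambda>r. - 1 / (3 * r^3)) has_real_derivative 1 / r^4) (at r)" if "a \<le> r" for r
      using that assms by (auto intro!: derivative_eq_intros simp: field_simps power2_eq_square eval_nat_numeral)
    show "((\<lambda>r::real. - 1 / (3 * r^3)) \<longlongrightarrow> 0) at_top"
      by real_asymp
  qed auto
  then show ?thesis by simp
qed

text \<open>The direction is sampled by \<open>sgn y\<close> with y in the unit ball, and the factor
  3 turns volume into surface measure. Substituting t = |y| r on the ray, and then x = r y at fixed
  r, leaves the weight |x|^3 / r^4, whose integral over r \<ge> |x| is 1/3.\<close>

lemma polar_coordinates:
  fixes h :: "real^3 \<Rightarrow> ennreal"
  assumes h[measurable]: "h \<in> borel_measurable borel"
  shows "3 * (\<integral>\<^sup>+y\<in>{y. 0 < norm y \<and> norm y \<le> 1}. (\<integral>\<^sup>+t\<in>{1<..}. ennreal (t\<^sup>2) * h (t *\<^sub>R sgn y) \<partial>lborel) \<partial>lborel)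
    = (\<integral>\<^sup>+x\<in>{x. 1 < norm x}. h x \<partial>lborel)"
proof -
  define A :: "(real \<times> (real^3)) set" where "A = {(r, y). 0 < norm y \<and> norm y \<le> 1 \<and> 1 < norm y * r}"
  define F where "F r y = ennreal (norm y ^ 3 * r\<^sup>2) * h (r *\<^sub>R y) * indicator A (r, y)" for r y
  define B :: "(real \<times> (real^3)) set" where "B = {(r, x). 0 < r \<and> 1 < norm x \<and> norm x \<le> r}"
  define G where "G r x = ennreal (norm x ^ 3 / r^4) * h x * indicator B (r, x)" for r x
  have [measurable]: "A \<in> sets (borel \<Otimes>\<^sub>M borel)" "B \<in> sets (borel \<Otimes>\<^sub>M borel)"
  proof -
    have "{p \<in> space (borel \<Otimes>\<^sub>M borel). 0 < norm (snd p) \<and> norm (snd p) \<le> 1 \<and> 1 < norm (snd p) * fst p}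
        \<in> sets (borel \<Otimes>\<^sub>M (borel :: (real^3) measure))"
      by measurable
    then show "A \<in> sets (borel \<Otimes>\<^sub>M borel)"
      by (simp add: A_def case_prod_beta' space_pair_measure)
    have "{p \<in> space (borel \<Otimes>\<^sub>M borel). 0 < fst p \<and> 1 < norm (snd p) \<and> norm (snd p) \<le> fst p}
        \<in> sets (borel \<Otimes>\<^sub>M (borel :: (real^3) measure))"
      by measurable
    then show "B \<in> sets (borel \<Otimes>\<^sub>M borel)"
      by (simp add: B_def case_prod_beta' space_pair_measure)
  qed
  have [measurable]: "(\<lambda>(r, y). F r y) \<in> borel_measurable (borel \<Otimes>\<^sub>M borel)"
      "(\<lambda>(r, y). G r y) \<in> borel_measurable (borel \<Otimes>\<^sub>M borel)"
    unfolding F_def G_def by measurable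
  have 1: "(\<integral>\<^sup>+t\<in>{1<..}. ennreal (t\<^sup>2) * h (t *\<^sub>R sgn y) \<partial>lborel) * indicator {y. 0 < norm y \<and> norm y \<le> 1} y
      = (\<integral>\<^sup>+r. F r y \<partial>lborel)" for y
  proof (cases "0 < norm y \<and> norm y \<le> 1")
    case True
    have "(\<integral>\<^sup>+t\<in>{1<..}. ennreal (t\<^sup>2) * h (t *\<^sub>R sgn y) \<partial>lborel) =
        norm y * (\<integral>\<^sup>+r. ennreal ((norm y * r)\<^sup>2) * h ((norm y * r) *\<^sub>R sgn y) * indicator {1<..} (norm y * r) \<partial>lborel)"
      using True by (subst nn_integral_real_affine[of _ "norm y" 0]) auto
    also have "\<dots> = (\<integral>\<^sup>+r. norm y * (ennreal ((norm y * r)\<^sup>2) * h ((norm y * r) *\<^sub>R sgn y) * indicator {1<..} (norm y * r)) \<partial>lborel)"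
      by (simp add: nn_integral_cmult)
    also have "\<dots> = (\<integral>\<^sup>+r. F r y \<partial>lborel)"
    proof (rule nn_integral_cong)
      fix r
      have "(norm y * r) *\<^sub>R sgn y = r *\<^sub>R y" using True by (simp add: sgn_div_norm)
      moreover have "ennreal (norm y) * ennreal ((norm y * r)\<^sup>2) = ennreal (norm y ^ 3 * r\<^sup>2)"
        by (subst ennreal_mult[symmetric])
          (use zero_le_power2[of "norm y * r"] in \<open>simp_all add: power2_eq_square power3_eq_cube mult_ac\<close>)
      ultimately show "ennreal (norm y) * (ennreal ((norm y * r)\<^sup>2) * h ((norm y * r) *\<^sub>R sgn y) * indicator {1<..} (norm y * r)) = F r y"
        using True by (simp add: F_def A_def indicator_def flip: mult.assoc)
    qed
    finally show ?thesis using True by simp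
  qed (auto simp: F_def A_def)
  have 2: "(\<integral>\<^sup>+y. F r y \<partial>lborel) = (\<integral>\<^sup>+x. G r x \<partial>lborel)" for r
  proof (cases "0 < r")
    case True
    have "(\<integral>\<^sup>+x. G r x \<partial>lborel) = ennreal (r ^ 3) * (\<integral>\<^sup>+y. G r (r *\<^sub>R y) \<partial>lborel)"
      using True by (subst nn_integral_lborel_scale[of _ r]) auto
    also have "\<dots> = (\<integral>\<^sup>+y. ennreal (r ^ 3) * G r (r *\<^sub>R y) \<partial>lborel)"
      by (simp add: nn_integral_cmult)
    also have "\<dots> = (\<integral>\<^sup>+y. F r y \<partial>lborel)"
    proof (rule nn_integral_cong)
      fix y :: "real^3"
      have "(r, r *\<^sub>R y) \<in> B \<longleftrightarrow> (r, y) \<in> A" using True by (auto simp: A_def B_def mult.commute)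
      moreover have "ennreal (r ^ 3) * ennreal (norm (r *\<^sub>R y) ^ 3 / r^4) = ennreal (norm y ^ 3 * r\<^sup>2)"
        using True by (subst ennreal_mult[symmetric]) (simp_all add: power_mult_distrib eval_nat_numeral field_simps)
      ultimately show "ennreal (r ^ 3) * G r (r *\<^sub>R y) = F r y"
        by (simp add: F_def G_def indicator_def flip: mult.assoc)
    qed
    finally show ?thesis ..
  next
    case False
    have "(r, y) \<notin> A" for y
    proof
      assume "(r, y) \<in> A"
      then have "1 < norm y * r" by (auto simp: A_def)
      moreover have "norm y * r \<le> 0" using False by (simp add: mult_nonneg_nonpos)
      ultimately show False by simp
    qed
    then show ?thesis using False by (simp add: F_def G_def B_def)
  qed
  have 3: "(\<integral>\<^sup>+r. G r x \<partial>lborel) = h x * indicator {x. 1 < norm x} x * ennreal (1/3)" for x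
  proof (cases "1 < norm x")
    case True
    have "(\<integral>\<^sup>+r. G r x \<partial>lborel) = (\<integral>\<^sup>+r. (ennreal (norm x ^ 3) * h x) * (ennreal (1 / r^4) * indicator {norm x..} r) \<partial>lborel)"
    proof (rule nn_integral_cong)
      fix r
      show "G r x = (ennreal (norm x ^ 3) * h x) * (ennreal (1 / r^4) * indicator {norm x..} r)"
      proof (cases "norm x \<le> r")
        case r: True
        have "ennreal (norm x ^ 3 / r^4) = ennreal (norm x ^ 3) * ennreal (1 / r^4)"
          by (simp flip: ennreal_mult)
        moreover have "0 < r" using True r by linarith
        ultimately show ?thesis using True r by (simp add: G_def B_def mult_ac)
      qed (auto simp: G_def B_def)
    qed
    also have "\<dots> = (ennreal (norm x ^ 3) * h x) * ennreal (1 / (3 * norm x ^ 3))"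
    proof -
      have "0 < norm x" using True by linarith
      then show ?thesis by (subst nn_integral_cmult) (simp_all add: nn_integral_inverse_power4)
    qed
    also have "\<dots> = h x * (ennreal (norm x ^ 3) * ennreal (1 / (3 * norm x ^ 3)))"
      by (simp add: mult_ac)
    also have "ennreal (norm x ^ 3) * ennreal (1 / (3 * norm x ^ 3)) = ennreal (1/3)"
      using True by (subst ennreal_mult[symmetric]) (auto simp: field_simps)
    finally show ?thesis using True by simp
  qed (simp add: G_def B_def)
  have "(\<integral>\<^sup>+y\<in>{y. 0 < norm y \<and> norm y \<le> 1}. (\<integral>\<^sup>+t\<in>{1<..}. ennreal (t\<^sup>2) * h (t *\<^sub>R sgn y) \<partial>lborel) \<partial>lborel)
      = (\<integral>\<^sup>+y. (\<integral>\<^sup>+r. F r y \<partial>lborel) \<partial>lborel)"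
    by (simp only: 1)
  also have "\<dots> = (\<integral>\<^sup>+r. (\<integral>\<^sup>+y. F r y \<partial>lborel) \<partial>lborel)"
    by (rule lborel_pair.Fubini') simp
  also have "\<dots> = (\<integral>\<^sup>+r. (\<integral>\<^sup>+x. G r x \<partial>lborel) \<partial>lborel)"
    by (simp add: 2)
  also have "\<dots> = (\<integral>\<^sup>+x. (\<integral>\<^sup>+r. G r x \<partial>lborel) \<partial>lborel)"
    by (rule lborel_pair.Fubini'[symmetric]) simp
  also have "\<dots> = (\<integral>\<^sup>+x\<in>{x. 1 < norm x}. h x \<partial>lborel) * ennreal (1/3)"
    unfolding 3 by (rule nn_integral_multc) measurable
  finally have "3 * (\<integral>\<^sup>+y\<in>{y. 0 < norm y \<and> norm y \<le> 1}. (\<integral>\<^sup>+t\<in>{1<..}. ennreal (t\<^sup>2) * h (t *\<^sub>R sgn y) \<partial>lborel) \<partial>lborel)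
     = (\<integral>\<^sup>+x\<in>{x. 1 < norm x}. h x \<partial>lborel) * (3 * ennreal (1/3))"
    by (simp add: mult_ac)
  also have "3 * ennreal (1/3) = 1"
    using ennreal_mult''[of "1/3" 3] by simp
  finally show ?thesis by simp
qed

text \<open>A lower bound for the energy tolerates both losses made here: the Hausdorff measure is
  at most the polar measure, and the Jacobian t^2 is at least 1 along the ray.\<close>

lemma ray_integral_le:
  fixes h :: "real^3 \<Rightarrow> ennreal"
  assumes h[measurable]: "h \<in> borel_measurable borel"
  shows "(\<integral>\<^sup>+\<omega>. (\<integral>\<^sup>+t\<in>{1<..}. h (t *\<^sub>R \<omega>) \<partial>lborel) \<partial>sphere_measure)
    \<le> (\<integral>\<^sup>+x\<in>exterior_domain. h x \<partial>lborel)"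
proof -
  let ?S = "sphere (0::real^3) 1" and ?C = "{y::real^3. 0 < norm y \<and> norm y \<le> 1}"
  let ?M = "restrict_space hausdorff2 ?S"
  \<comment> \<open>The polar measure on the sphere: three times the image of Lebesgue measure on
    the punctured unit ball under radial projection.\<close>
  define N where "N = scale_measure 3 (distr (restrict_space lborel ?C) (restrict_space borel ?S) sgn)"
  have [measurable]: "?C \<in> sets borel" by measurable
  have sgn[measurable]: "sgn \<in> restrict_space lborel ?C \<rightarrow>\<^sub>M restrict_space borel ?S"
    by (intro measurable_restrict_space3) (auto simp: norm_sgn)
  have sets: "sets ?M = sets N"
    by (simp add: N_def sets_restrict_space)
  \<comment> \<open>It is enough to compare Borel sets, since completing a measure does not change
    its integrals.\<close>
  have le: "?M \<le> N"
  proof (subst le_measure[OF sets], intro ballI)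
    fix A assume "A \<in> sets ?M"
    then have A: "A \<in> sets borel" "A \<subseteq> ?S"
      by (auto simp: sets_restrict_space)
    have "emeasure ?M A = emeasure hausdorff2 A"
      using A by (subst emeasure_restrict_space) auto
    also have "\<dots> \<le> 3 * emeasure lborel (unit_cone A)"
      by (rule hausdorff2_le_cone[OF A])
    also have "unit_cone A = sgn -` A \<inter> ?C"
      by (auto simp: unit_cone_def)
    also have "3 * emeasure lborel (sgn -` A \<inter> ?C) = emeasure N A"
    proof -
      have "sgn -` A \<inter> space (restrict_space lborel ?C) = sgn -` A \<inter> ?C"
        by (auto simp: space_restrict_space)
      moreover have "A \<in> sets (restrict_space borel ?S)"
        using A by (auto simp: sets_restrict_space)
      ultimately show ?thesis
        unfolding N_def emeasure_scale_measure emeasure_distr[OF sgn \<open>A \<in> sets (restrict_space borel ?S)\<close>]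
        by (subst emeasure_restrict_space) auto
    qed
    finally show "emeasure ?M A \<le> emeasure N A" .
  qed
  have [measurable]: "(\<lambda>\<omega>. \<integral>\<^sup>+t\<in>{1<..}. h (t *\<^sub>R \<omega>) \<partial>lborel) \<in> borel_measurable borel"
    by measurable
  then have m: "(\<lambda>\<omega>. \<integral>\<^sup>+t\<in>{1<..}. h (t *\<^sub>R \<omega>) \<partial>lborel) \<in> borel_measurable (restrict_space borel ?S)"
    by (rule measurable_restrict_space1)
  have "(\<integral>\<^sup>+\<omega>. (\<integral>\<^sup>+t\<in>{1<..}. h (t *\<^sub>R \<omega>) \<partial>lborel) \<partial>sphere_measure)
      = (\<integral>\<^sup>+\<omega>. (\<integral>\<^sup>+t\<in>{1<..}. h (t *\<^sub>R \<omega>) \<partial>lborel) \<partial>?M)"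
    by (simp add: sphere_measure_def nn_integral_completion)
  also have "\<dots> \<le> (\<integral>\<^sup>+\<omega>. (\<integral>\<^sup>+t\<in>{1<..}. h (t *\<^sub>R \<omega>) \<partial>lborel) \<partial>N)"
    by (rule nn_integral_mono_measure[OF sets le])
  also have "\<dots> = 3 * (\<integral>\<^sup>+y. (\<integral>\<^sup>+t\<in>{1<..}. h (t *\<^sub>R sgn y) \<partial>lborel) \<partial>restrict_space lborel ?C)"
    unfolding N_def using m
    by (subst nn_integral_scale_measure, simp) (subst nn_integral_distr[OF sgn], simp_all)
  also have "\<dots> = 3 * (\<integral>\<^sup>+y\<in>?C. (\<integral>\<^sup>+t\<in>{1<..}. h (t *\<^sub>R sgn y) \<partial>lborel) \<partial>lborel)"
    by (subst nn_integral_restrict_space) auto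
  also have "\<dots> \<le> 3 * (\<integral>\<^sup>+y\<in>?C. (\<integral>\<^sup>+t\<in>{1<..}. ennreal (t\<^sup>2) * h (t *\<^sub>R sgn y) \<partial>lborel) \<partial>lborel)"
  proof (rule mult_left_mono[OF nn_integral_mono[OF mult_right_mono[OF nn_integral_mono]]])
    fix y :: "real^3" and t :: real
    show "h (t *\<^sub>R sgn y) * indicator {1<..} t \<le> ennreal (t\<^sup>2) * h (t *\<^sub>R sgn y) * indicator {1<..} t"
    proof (cases "1 < t")
      case True
      then have "1 \<le> ennreal (t\<^sup>2)" by (simp add: one_le_power)
      then have "1 * h (t *\<^sub>R sgn y) \<le> ennreal (t\<^sup>2) * h (t *\<^sub>R sgn y)"
        by (rule mult_right_mono) simp
      then show ?thesis using True by simp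
    qed simp
  qed auto
  also have "\<dots> = (\<integral>\<^sup>+x\<in>{x. 1 < norm x}. h x \<partial>lborel)"
    by (rule polar_coordinates[OF h])
  also have "{x::real^3. 1 < norm x} = exterior_domain"
    by (auto simp: exterior_domain_def)
  finally show ?thesis .
qed

section \<open>Identities and bounds for the potentials\<close>

text \<open>At the minima of f this is the rank-one projection n \<otimes> n. It is written M in the
  remarks below, and W stands for the defect M^2 - M, which vanishes at the minima.\<close>

definition shifted :: "real^3^3 \<Rightarrow> real^3^3" where
  "shifted Q = Q + (1/3) *\<^sub>R mat 1"

definition defect :: "real^3^3 \<Rightarrow> real^3^3" where
  "defect Q = shifted Q ** shifted Q - shifted Q"

text \<open>For M = n \<otimes> n this is the vector n_3 n. Its squared norm is then n_3^2, and its
  squared distance to e_3 is 1 - n_3^2, a multiple of g.\<close>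

definition col3 :: "real^3^3 \<Rightarrow> real^3" where
  "col3 Q = shifted Q *v axis 3 1"

text \<open>The cubic \<open>3 x\<^sup>2 - 2 x\<^sup>3\<close> fixes 0 and 1 with vanishing slope there, so this smooth replacement
  of the squared third component of the director is insensitive to first order to changes of the eigenvalues.\<close>

definition smooth33 :: "real^3^3 \<Rightarrow> real" where
  "smooth33 Q = 3 * (shifted Q ** shifted Q) $ 3 $ 3 - 2 * (shifted Q ** shifted Q ** shifted Q) $ 3 $ 3"

text \<open>In five free coordinates the tensor relations below become polynomial identities, which
  \<open>algebra\<close> decides.\<close>

lemma S0_entriesE:
  assumes "Q \<in> S0"
  obtains a b c d e where "Q $ 1 $ 1 = a" "Q $ 2 $ 2 = b" "Q $ 3 $ 3 = - a - b" "Q $ 1 $ 2 = c" "Q $ 2 $ 1 = c"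
    "Q $ 1 $ 3 = d" "Q $ 3 $ 1 = d" "Q $ 2 $ 3 = e" "Q $ 3 $ 2 = e"
proof -
  have "Q $ i $ j = Q $ j $ i" for i j
    using assms by (auto simp: S0_def transpose_def vec_eq_iff)
  moreover have "Q $ 1 $ 1 + Q $ 2 $ 2 + Q $ 3 $ 3 = 0"
    using assms by (simp add: S0_def trace_def sum_3)
  ultimately show thesis
    by (intro that[of "Q$1$1" "Q$2$2" "Q$1$2" "Q$1$3" "Q$2$3"]) auto
qed

lemma norm_matrix_sq: "(norm (A::real^3^3))\<^sup>2 = (A$1$1)\<^sup>2 + (A$1$2)\<^sup>2 + (A$1$3)\<^sup>2 + (A$2$1)\<^sup>2 + (A$2$2)\<^sup>2 + (A$2$3)\<^sup>2
    + (A$3$1)\<^sup>2 + (A$3$2)\<^sup>2 + (A$3$3)\<^sup>2"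
  unfolding power2_norm_eq_inner by (simp add: inner_vec_def sum_3 power2_eq_square)

lemma norm_vector_sq: "(norm (x::real^3))\<^sup>2 = (x$1)\<^sup>2 + (x$2)\<^sup>2 + (x$3)\<^sup>2"
  unfolding power2_norm_eq_inner by (simp add: inner_vec_def sum_3 power2_eq_square)

lemmas coord_simps = shifted_def defect_def col3_def smooth33_def matrix_matrix_mult_def matrix_vector_mult_def
  mat_def axis_def sum_3 trace_def inner_vec_def norm_matrix_sq norm_vector_sq Q_infty_def uniaxial_def

text \<open>Symmetric traceless 3 x 3 matrices satisfy tr Q^4 = |Q|^4 / 2. With this, f is the trace
  of a quartic polynomial in Q, and that polynomial is 3/2 (M^2 - M)^2.\<close>

lemma f_pot_eq_defect:
  assumes "Q \<in> S0"
  shows "f_pot Q = 3/2 * (norm (defect Q))\<^sup>2"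
proof -
  have 4: "(norm Q)^4 = ((norm Q)\<^sup>2)\<^sup>2" by simp
  obtain a b c d e where Q: "Q $ 1 $ 1 = a" "Q $ 2 $ 2 = b" "Q $ 3 $ 3 = - a - b" "Q $ 1 $ 2 = c" "Q $ 2 $ 1 = c"
    "Q $ 1 $ 3 = d" "Q $ 3 $ 1 = d" "Q $ 2 $ 3 = e" "Q $ 3 $ 2 = e"
    using S0_entriesE[OF assms] .
  show ?thesis
    unfolding f_pot_def 4 by (simp add: coord_simps Q) algebra
qed

text \<open>Both sides equal 1 - M_33 + W_33. The distance to \<open>Q_infty\<close> is the quantity
  comparable with g; the terms linear in W are handled by \<open>defect33_identity\<close>.\<close>

lemma col3_identity:
  assumes "Q \<in> S0"
  shows "(norm (axis 3 1 - col3 Q))\<^sup>2 = (norm (Q - Q_infty))\<^sup>2 / 2 + defect Q $ 3 $ 3 - trace (defect Q) / 2"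
proof -
  obtain a b c d e where Q: "Q $ 1 $ 1 = a" "Q $ 2 $ 2 = b" "Q $ 3 $ 3 = - a - b" "Q $ 1 $ 2 = c" "Q $ 2 $ 1 = c"
    "Q $ 1 $ 3 = d" "Q $ 3 $ 1 = d" "Q $ 2 $ 3 = e" "Q $ 3 $ 2 = e"
    using S0_entriesE[OF assms] .
  show ?thesis
    by (simp add: coord_simps Q) algebra
qed

text \<open>The combination linear in W left by \<open>col3_identity\<close> is really of second
  order: each term on the right has a further factor W or Q - \<open>Q_infty\<close>. The entry W_33
  cancels against the inner product, and what remains is a relation between the invariants of a
  symmetric M with tr M = 1.\<close>

lemma defect33_identity:
  assumes "Q \<in> S0"
  shows "2 * defect Q $ 3 $ 3 - trace (defect Q)
    = 3/2 * (trace (defect Q))\<^sup>2 - 3 * (norm (defect Q))\<^sup>2 - 2 * (defect Q \<bullet> (Q - Q_infty))"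
proof -
  obtain a b c d e where Q: "Q $ 1 $ 1 = a" "Q $ 2 $ 2 = b" "Q $ 3 $ 3 = - a - b" "Q $ 1 $ 2 = c" "Q $ 2 $ 1 = c"
    "Q $ 1 $ 3 = d" "Q $ 3 $ 1 = d" "Q $ 2 $ 3 = e" "Q $ 3 $ 2 = e"
    using S0_entriesE[OF assms] .
  show ?thesis
    by (simp add: coord_simps Q) algebra
qed

lemma norm_sq_defect:
  assumes "Q \<in> S0"
  shows "(norm Q)\<^sup>2 = 2/3 + trace (defect Q)"
    and "(norm (Q - Q_infty))\<^sup>2 = 4/3 + trace (defect Q) - 2 * Q $ 3 $ 3"
    and "(norm (shifted Q))\<^sup>2 = 1 + trace (defect Q)"
proof -
  obtain a b c d e where Q: "Q $ 1 $ 1 = a" "Q $ 2 $ 2 = b" "Q $ 3 $ 3 = - a - b" "Q $ 1 $ 2 = c" "Q $ 2 $ 1 = c"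
    "Q $ 1 $ 3 = d" "Q $ 3 $ 1 = d" "Q $ 2 $ 3 = e" "Q $ 3 $ 2 = e"
    using S0_entriesE[OF assms] .
  show "(norm Q)\<^sup>2 = 2/3 + trace (defect Q)"
    by (simp add: coord_simps Q) algebra
  show "(norm (Q - Q_infty))\<^sup>2 = 4/3 + trace (defect Q) - 2 * Q $ 3 $ 3"
    by (simp add: coord_simps Q) algebra
  show "(norm (shifted Q))\<^sup>2 = 1 + trace (defect Q)"
    by (simp add: coord_simps Q) algebra
qed

lemma trace_sq_le: "(trace A)\<^sup>2 \<le> 3 * (norm (A::real^3^3))\<^sup>2"
proof -
  have "(x + y + z)\<^sup>2 \<le> 3 * (x\<^sup>2 + y\<^sup>2 + z\<^sup>2)" for x y z :: real
    using sum_squares_ge_zero[of "x - y" "y - z"] zero_le_power2[of "x - z"]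
    by (simp add: power2_eq_square algebra_simps)
  from this[of "A$1$1" "A$2$2" "A$3$3"] show ?thesis
    unfolding norm_matrix_sq trace_def sum_3
    using zero_le_power2[of "A$1$2"] zero_le_power2[of "A$1$3"] zero_le_power2[of "A$2$1"]
      zero_le_power2[of "A$2$3"] zero_le_power2[of "A$3$1"] zero_le_power2[of "A$3$2"]
    by argo
qed

text \<open>In (M^3)_33 = M e_3 \<bullet> M^2 e_3 the square is replaced by M + W.\<close>

lemma smooth33_eq:
  assumes "Q \<in> S0"
  shows "smooth33 Q = (norm (col3 Q))\<^sup>2 - 2 * (col3 Q \<bullet> (defect Q *v axis 3 1))"
proof -
  obtain a b c d e where Q: "Q $ 1 $ 1 = a" "Q $ 2 $ 2 = b" "Q $ 3 $ 3 = - a - b" "Q $ 1 $ 2 = c" "Q $ 2 $ 1 = c"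
    "Q $ 1 $ 3 = d" "Q $ 3 $ 1 = d" "Q $ 2 $ 3 = e" "Q $ 3 $ 2 = e"
    using S0_entriesE[OF assms] .
  show ?thesis
    by (simp add: coord_simps Q) algebra
qed

text \<open>The left side is the derivative of \<open>smooth33\<close> in direction H. At W = 0 only
  the pairing of M e_3 with (1 - M) e_3 survives, which is the derivative of n_3^2 along the sphere
  of directors.\<close>

lemma smooth33_derivative_identity:
  assumes "Q \<in> S0" "H \<in> S0"
  shows "3 * (shifted Q ** H + H ** shifted Q) $ 3 $ 3
      - 2 * ((shifted Q ** shifted Q) ** H + (shifted Q ** H + H ** shifted Q) ** shifted Q) $ 3 $ 3
    = 2 * (col3 Q \<bullet> (H *v (axis 3 1 - col3 Q))) - 4 * ((H *v axis 3 1) \<bullet> (defect Q *v axis 3 1))"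
proof -
  obtain a b c d e where Q: "Q $ 1 $ 1 = a" "Q $ 2 $ 2 = b" "Q $ 3 $ 3 = - a - b" "Q $ 1 $ 2 = c" "Q $ 2 $ 1 = c"
    "Q $ 1 $ 3 = d" "Q $ 3 $ 1 = d" "Q $ 2 $ 3 = e" "Q $ 3 $ 2 = e"
    using S0_entriesE[OF assms(1)] .
  obtain a' b' c' d' e' where H: "H $ 1 $ 1 = a'" "H $ 2 $ 2 = b'" "H $ 3 $ 3 = - a' - b'" "H $ 1 $ 2 = c'" "H $ 2 $ 1 = c'"
    "H $ 1 $ 3 = d'" "H $ 3 $ 1 = d'" "H $ 2 $ 3 = e'" "H $ 3 $ 2 = e'"
    using S0_entriesE[OF assms(2)] .
  show ?thesis
    by (simp add: coord_simps Q H) algebra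
qed

text \<open>A symmetric H sees only the symmetrised dyad X. For orthogonal m and q its squared norm
  is half of the crude bound 4 |m|^2 |q|^2, and this gain is needed for the sharp constant in the
  calibration.\<close>

lemma dyadic_bound:
  fixes m q :: "real^3"
  assumes "H \<in> S0"
  shows "(2 * (m \<bullet> (H *v q)))\<^sup>2 \<le> (norm H)\<^sup>2 * (2 * (norm m)\<^sup>2 * (norm q)\<^sup>2 + 2 * (m \<bullet> q)\<^sup>2)"
proof -
  define X :: "real^3^3" where "X = (\<chi> i j. m $ i * q $ j + q $ i * m $ j)"
  obtain a' b' c' d' e' where H: "H $ 1 $ 1 = a'" "H $ 2 $ 2 = b'" "H $ 3 $ 3 = - a' - b'" "H $ 1 $ 2 = c'" "H $ 2 $ 1 = c'"
    "H $ 1 $ 3 = d'" "H $ 3 $ 1 = d'" "H $ 2 $ 3 = e'" "H $ 3 $ 2 = e'"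
    using S0_entriesE[OF assms] .
  have 1: "2 * (m \<bullet> (H *v q)) = H \<bullet> X"
    by (simp add: X_def coord_simps H) algebra
  have 2: "(norm X)\<^sup>2 = 2 * (norm m)\<^sup>2 * (norm q)\<^sup>2 + 2 * (m \<bullet> q)\<^sup>2"
    by (simp add: X_def coord_simps) algebra
  show ?thesis
    using Cauchy_Schwarz_ineq[of H X] unfolding 1 2[symmetric] by (simp only: power2_norm_eq_inner)
qed

lemma g_pot_bounds:
  assumes "Q \<in> S0" "Q \<noteq> 0"
  shows "0 \<le> g_pot g0 Q" "g_pot g0 Q \<le> 2"
proof -
  obtain a b c d e where Q: "Q $ 1 $ 1 = a" "Q $ 2 $ 2 = b" "Q $ 3 $ 3 = - a - b" "Q $ 1 $ 2 = c" "Q $ 2 $ 1 = c"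
    "Q $ 1 $ 3 = d" "Q $ 3 $ 1 = d" "Q $ 2 $ 3 = e" "Q $ 3 $ 2 = e"
    using S0_entriesE[OF assms(1)] .
  have "2/3 * (norm Q)\<^sup>2 - (Q $ 3 $ 3)\<^sup>2 = 1/3 * (a - b)\<^sup>2 + 4/3 * c\<^sup>2 + 4/3 * d\<^sup>2 + 4/3 * e\<^sup>2"
    unfolding norm_matrix_sq Q by (simp add: power2_eq_square field_simps)
  then have "(Q $ 3 $ 3)\<^sup>2 \<le> 2/3 * (norm Q)\<^sup>2"
    using zero_le_power2[of "a - b"] zero_le_power2[of c] zero_le_power2[of d] zero_le_power2[of e] by linarith
  then have "\<bar>Q $ 3 $ 3\<bar> \<le> sqrt (2/3 * (norm Q)\<^sup>2)"
    by (intro real_le_rsqrt) simp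
  also have "\<dots> = sqrt (2/3) * norm Q" by (subst real_sqrt_mult) simp
  finally have "\<bar>Q $ 3 $ 3 / norm Q\<bar> \<le> sqrt (2/3)"
    using assms by (simp add: field_simps)
  moreover have "sqrt (2/3) \<le> 1" by simp
  moreover have "g_pot g0 Q = sqrt (2/3) - Q $ 3 $ 3 / norm Q"
    using assms(2) by (simp add: g_pot_def)
  ultimately show "0 \<le> g_pot g0 Q" "g_pot g0 Q \<le> 2"
    unfolding abs_le_iff by linarith+
qed

lemma g_pot_nonneg:
  assumes "Q \<in> S0" "0 \<le> g0"
  shows "0 \<le> g_pot g0 Q"
proof (cases "Q = 0")
  case True
  then show ?thesis using assms(2) by (simp add: g_pot_def)
qed (rule g_pot_bounds(1)[OF assms(1)])

lemma f_pot_nonneg: "Q \<in> S0 \<Longrightarrow> 0 \<le> f_pot Q"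
  by (simp add: f_pot_eq_defect)

text \<open>With y the root, the difference of the two sides is y (y - 1)^2 (y + 2) / 2. The linear
  coefficient has to be exact for the later cancellation; the quadratic one matters only up to a
  constant.\<close>

lemma sqrt_taylor_lower: "1 + x/2 - x\<^sup>2/2 \<le> sqrt (1 + x)" if "-1 \<le> (x::real)"
proof -
  define y where "y = sqrt (1 + x)"
  have y: "0 \<le> y" "x = y\<^sup>2 - 1" using that by (auto simp: y_def)
  have "0 \<le> (y - 1)\<^sup>2 * (y + 2) * y / 2" using y by simp
  also have "(y - 1)\<^sup>2 * (y + 2) * y / 2 = y - (1 + x/2 - x\<^sup>2/2)"
    unfolding y(2) by (simp add: power2_eq_square field_simps)
  finally have "1 + x/2 - x\<^sup>2/2 \<le> y" by simp
  then show ?thesis by (simp add: y_def)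
qed

text \<open>For |Q| = sqrt(2/3) the left side is exactly sqrt(2/3) g. In general the terms linear in
  tr W cancel between |Q - \<open>Q_infty\<close>|^2 / 2 and sqrt(2/3) |Q|, so the error is
  quadratic in W and f can pay for it.\<close>

lemma dist_Q_infty_le_g_pot:
  assumes Q: "Q \<in> S0" and g0: "0 \<le> g0" and \<delta>: "0 < \<delta>"
  shows "(norm (Q - Q_infty))\<^sup>2 / 2 \<le> (sqrt (2/3) + \<delta>) * g_pot g0 Q + (2/\<delta> + 9/4) * (norm (defect Q))\<^sup>2"
proof -
  let ?N = "norm (defect Q)" and ?\<tau> = "trace (defect Q)"
  have \<tau>: "?\<tau>\<^sup>2 \<le> 3 * ?N\<^sup>2" by (rule trace_sq_le)
  have nQ: "(norm Q)\<^sup>2 = 2/3 + ?\<tau>" by (rule norm_sq_defect[OF Q])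
  have x: "-1 \<le> 3/2 * ?\<tau>" using nQ zero_le_power2[of "norm Q"] by linarith
  have "sqrt (2/3) * norm Q = sqrt ((2/3) * (norm Q)\<^sup>2)" by (subst real_sqrt_mult) simp
  also have "(2/3) * (norm Q)\<^sup>2 = (2/3)\<^sup>2 * (1 + 3/2 * ?\<tau>)" unfolding nQ by (simp add: power2_eq_square algebra_simps)
  also have "sqrt \<dots> = 2/3 * sqrt (1 + 3/2 * ?\<tau>)" by (simp add: real_sqrt_mult)
  also have "\<dots> \<ge> 2/3 * (1 + (3/2 * ?\<tau>)/2 - (3/2 * ?\<tau>)\<^sup>2/2)"
    using sqrt_taylor_lower[OF x] by simp
  finally have "2/3 + ?\<tau>/2 - 3/4 * ?\<tau>\<^sup>2 \<le> sqrt (2/3) * norm Q"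
    by (simp add: power2_eq_square algebra_simps)
  then have E: "(norm (Q - Q_infty))\<^sup>2 / 2 \<le> (sqrt (2/3) * norm Q - Q $ 3 $ 3) + 9/4 * ?N\<^sup>2"
    using norm_sq_defect(2)[OF Q] \<tau> by argo
  show ?thesis
  proof (cases "Q = 0")
    \<comment> \<open>Here g has the value \<open>g0\<close>, and E alone suffices, the term in g
      being nonnegative.\<close>
    case True
    have "0 \<le> (sqrt (2/3) + \<delta>) * g_pot g0 Q" "0 \<le> 2/\<delta> * ?N\<^sup>2"
      using True g0 \<delta> by (auto simp: g_pot_def)
    with E True show ?thesis by (simp add: algebra_simps)
  next
    case False
    let ?g = "g_pot g0 Q"
    have g: "0 \<le> ?g" "?g \<le> 2" using g_pot_bounds[OF Q False] .
    have Qg: "sqrt (2/3) * norm Q - Q $ 3 $ 3 = norm Q * ?g"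
      using False by (simp add: g_pot_def algebra_simps)
    have "\<bar>?\<tau>\<bar> \<le> 2 * ?N"
    proof (rule power2_le_imp_le)
      show "\<bar>?\<tau>\<bar>\<^sup>2 \<le> (2 * ?N)\<^sup>2" by (auto simp: power_mult_distrib intro: order_trans[OF \<tau>])
    qed simp
    have "norm Q \<le> sqrt (2/3) + 2 * ?N"
    proof (rule power2_le_imp_le)
      have "1/2 \<le> sqrt (2/3)" by (rule real_le_rsqrt) (simp add: power2_eq_square)
      then have "1/2 * ?N \<le> sqrt (2/3) * ?N" by (rule mult_right_mono) simp
      then have "(norm Q)\<^sup>2 \<le> 2/3 + 2 * (sqrt (2/3) * (2 * ?N)) + (2 * ?N)\<^sup>2"
        using nQ \<open>\<bar>?\<tau>\<bar> \<le> 2 * ?N\<close> zero_le_power2[of "2 * ?N"] by linarith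
      then show "(norm Q)\<^sup>2 \<le> (sqrt (2/3) + 2 * ?N)\<^sup>2"
        by (simp add: power2_sum)
    qed simp
    then have "norm Q * ?g \<le> sqrt (2/3) * ?g + 2 * ?N * ?g"
      using g by (metis distrib_right mult_right_mono)
    \<comment> \<open>The excess of |Q| over sqrt(2/3) multiplies g. Young's inequality produces
      g^2, and g \<le> 2 turns it back into a small multiple of g.\<close>
    also have "2 * ?N * ?g \<le> \<delta>/2 * ?g\<^sup>2 + 2/\<delta> * ?N\<^sup>2"
    proof -
      have "0 \<le> (\<delta>/2 * ?g - ?N)\<^sup>2 * (2/\<delta>)" using \<delta> by simp
      also have "\<dots> = \<delta>/2 * ?g\<^sup>2 + 2/\<delta> * ?N\<^sup>2 - 2 * ?N * ?g"
        using \<delta> by (simp add: power2_eq_square field_simps)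
      finally show ?thesis by simp
    qed
    also have "\<delta>/2 * ?g\<^sup>2 \<le> \<delta> * ?g"
      using mult_right_mono[OF g(2) g(1)] \<delta> by (simp add: power2_eq_square)
    finally show ?thesis using E unfolding Qg by (simp add: algebra_simps)
  qed
qed

text \<open>The two identities leave the error -W \<bullet> (Q - \<open>Q_infty\<close>). Splitting
  it with weight \<delta> spoils the leading factor 1/2 only slightly and sends the rest to
  |W|^2.\<close>

lemma col3_gap_le:
  assumes Q: "Q \<in> S0" and \<delta>: "0 < \<delta>"
  shows "(norm (axis 3 1 - col3 Q))\<^sup>2
    \<le> (1/2 + \<delta>) * (norm (Q - Q_infty))\<^sup>2 + (3/4 + 1/(4*\<delta>)) * (norm (defect Q))\<^sup>2"
proof -
  let ?N = "norm (defect Q)" and ?E = "norm (Q - Q_infty)"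
  have "- (defect Q \<bullet> (Q - Q_infty)) \<le> ?N * ?E"
    using Cauchy_Schwarz_ineq2[of "defect Q" "Q - Q_infty"] by linarith
  also have "\<dots> \<le> \<delta> * ?E\<^sup>2 + 1/(4*\<delta>) * ?N\<^sup>2"
  proof -
    have "0 \<le> (\<delta> * ?E - ?N/2)\<^sup>2 * (1/\<delta>)" using \<delta> by simp
    also have "\<dots> = \<delta> * ?E\<^sup>2 + 1/(4*\<delta>) * ?N\<^sup>2 - ?N * ?E"
      using \<delta> by (simp add: power2_eq_square field_simps)
    finally show ?thesis by simp
  qed
  finally show ?thesis
    using col3_identity[OF Q] defect33_identity[OF Q] trace_sq_le[of "defect Q"]
    by (simp add: algebra_simps)
qed

section \<open>Norms of matrix products\<close>

lemma norm_matrix_matrix_mult_le: "norm ((A::real^'n^'m) ** (B::real^'k^'n)) \<le> norm A * norm B"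
proof (rule power2_le_imp_le)
  have "(norm (A ** B))\<^sup>2 = (\<Sum>i\<in>UNIV. \<Sum>j\<in>UNIV. ((A ** B) $ i $ j)\<^sup>2)"
    unfolding power2_norm_eq_inner by (simp add: inner_vec_def power2_eq_square)
  also have "\<dots> = (\<Sum>i\<in>UNIV. \<Sum>j\<in>UNIV. (A $ i \<bullet> column j B)\<^sup>2)"
    by (simp add: matrix_matrix_mult_def inner_vec_def column_def)
  also have "\<dots> \<le> (\<Sum>i\<in>UNIV. \<Sum>j\<in>UNIV. (A $ i \<bullet> A $ i) * (column j B \<bullet> column j B))"
    by (intro sum_mono Cauchy_Schwarz_ineq)
  also have "\<dots> = (\<Sum>i\<in>UNIV. A $ i \<bullet> A $ i) * (\<Sum>j\<in>UNIV. column j B \<bullet> column j B)"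
    by (simp add: sum_product)
  also have "(\<Sum>j\<in>UNIV. column j B \<bullet> column j B) = (\<Sum>j\<in>UNIV. \<Sum>i\<in>UNIV. B $ i $ j * B $ i $ j)"
    by (simp add: inner_vec_def column_def)
  also have "\<dots> = (\<Sum>i\<in>UNIV. \<Sum>j\<in>UNIV. B $ i $ j * B $ i $ j)"
    by (rule sum.swap)
  also have "\<dots> = B \<bullet> B"
    by (simp add: inner_vec_def)
  finally show "(norm (A ** B))\<^sup>2 \<le> (norm A * norm B)\<^sup>2"
    by (simp add: power_mult_distrib power2_norm_eq_inner inner_vec_def[of A A])
qed simp

lemma norm_matrix_vector_mult_le: "norm ((A::real^'n^'m) *v x) \<le> norm A * norm x"
proof (rule power2_le_imp_le)
  have "(norm (A *v x))\<^sup>2 = (\<Sum>i\<in>UNIV. (A $ i \<bullet> x)\<^sup>2)"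
    unfolding power2_norm_eq_inner by (simp add: inner_vec_def power2_eq_square matrix_vector_mult_def)
  also have "\<dots> \<le> (\<Sum>i\<in>UNIV. (A $ i \<bullet> A $ i) * (x \<bullet> x))"
    by (intro sum_mono Cauchy_Schwarz_ineq)
  also have "\<dots> = (norm A * norm x)\<^sup>2"
    by (simp add: power_mult_distrib power2_norm_eq_inner inner_vec_def[of A A] sum_distrib_right)
  finally show "(norm (A *v x))\<^sup>2 \<le> (norm A * norm x)\<^sup>2" .
qed simp

lemma bounded_bilinear_matrix_mult: "bounded_bilinear ((**) :: real^'n^'m \<Rightarrow> real^'k^'n \<Rightarrow> real^'k^'m)"
proof
  fix A A' :: "real^'n^'m" and B B' :: "real^'k^'n" and r :: real
  show "(A + A') ** B = A ** B + A' ** B"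
    by (simp add: matrix_matrix_mult_def vec_eq_iff distrib_right sum.distrib)
  show "A ** (B + B') = A ** B + A ** B'"
    by (rule matrix_add_ldistrib)
  show "(r *\<^sub>R A) ** B = r *\<^sub>R (A ** B)" 
    by (simp add: matrix_matrix_mult_def vec_eq_iff sum_distrib_left mult.assoc)
  show "A ** (r *\<^sub>R B) = r *\<^sub>R (A ** B)"
    by (simp add: matrix_matrix_mult_def vec_eq_iff sum_distrib_left mult.left_commute)
  show "\<exists>K. \<forall>a b. norm (a ** b :: real^'k^'m) \<le> norm (a::real^'n^'m) * norm (b::real^'k^'n) * K"
    using norm_matrix_matrix_mult_le by (intro exI[of _ 1]) auto
qed

section \<open>The calibration\<close>

text \<open>On uniaxial tensors this is \<epsilon> + n_3^2, the square of a regularised |n_3|. Away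
  from them \<open>smooth33\<close> can be negative, as for a large eigenvalue of M in direction
  e_3, and the multiple of |W|^2 restores positivity.\<close>

definition calib :: "real \<Rightarrow> real \<Rightarrow> real^3^3 \<Rightarrow> real" where
  "calib \<epsilon> K Q = \<epsilon> + smooth33 Q + K * (norm (defect Q))\<^sup>2"

lemma norm_entry33_le: "\<bar>A $ 3 $ 3\<bar> \<le> norm (A :: real^3^3)"
  using component_le_norm_cart[of "A $ 3" 3] Finite_Cartesian_Product.norm_nth_le[of A 3]
  by linarith

lemma norm_shifted_le:
  assumes "Q \<in> S0"
  shows "norm (shifted Q) \<le> 1 + norm (defect Q)"
proof (rule power2_le_imp_le)
  have "(trace (defect Q))\<^sup>2 \<le> (2 * norm (defect Q))\<^sup>2"
    by (auto simp: power_mult_distrib intro: order_trans[OF trace_sq_le])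
  then have "\<bar>trace (defect Q)\<bar> \<le> 2 * norm (defect Q)"
    using abs_le_square_iff[of "trace (defect Q)" "2 * norm (defect Q)"] by simp
  then show "(norm (shifted Q))\<^sup>2 \<le> (1 + norm (defect Q))\<^sup>2"
    unfolding norm_sq_defect(3)[OF assms] power2_sum by (simp add: abs_le_iff add_increasing)
qed simp

text \<open>One half of the weight 2/\<delta> absorbs the cross term of \<open>smooth33_eq\<close>.
  The other half is kept, because the root of \<open>calib\<close> must also dominate |W|.\<close>

lemma calib_lower_bound:
  assumes Q: "Q \<in> S0" and \<delta>: "0 < \<delta>"
  shows "\<epsilon> + (1 - \<delta>) * (norm (col3 Q))\<^sup>2 + (norm (defect Q))\<^sup>2 / \<delta> \<le> calib \<epsilon> (2/\<delta>) Q"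
proof -
  let ?m = "norm (col3 Q)" and ?N = "norm (defect Q)"
  have "col3 Q \<bullet> (defect Q *v axis 3 1) \<le> ?m * norm (defect Q *v axis 3 1)"
    by (rule norm_cauchy_schwarz)
  also have "\<dots> \<le> ?m * ?N"
    using norm_matrix_vector_mult_le[of "defect Q" "axis 3 1"] by (intro mult_left_mono) auto
  finally have "?m\<^sup>2 - 2 * (?m * ?N) \<le> smooth33 Q"
    unfolding smooth33_eq[OF Q] by simp
  moreover have "2 * (?m * ?N) \<le> \<delta> * ?m\<^sup>2 + ?N\<^sup>2 / \<delta>"
  proof -
    have "0 \<le> (\<delta> * ?m - ?N)\<^sup>2 / \<delta>" using \<delta> by simp
    also have "\<dots> = \<delta> * ?m\<^sup>2 + ?N\<^sup>2 / \<delta> - 2 * (?m * ?N)"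
      using \<delta> by (simp add: power2_eq_square field_simps)
    finally show ?thesis by simp
  qed
  ultimately show ?thesis
    unfolding calib_def by (simp add: algebra_simps)
qed

text \<open>The vectors M e_3 and e_3 - M e_3 are orthogonal up to the defect, which is the
  situation in which \<open>dyadic_bound\<close> gains.\<close>

lemma col3_inner_gap:
  assumes "Q \<in> S0"
  shows "col3 Q \<bullet> (axis 3 1 - col3 Q) = - defect Q $ 3 $ 3"
proof -
  obtain a b c d e where Q: "Q $ 1 $ 1 = a" "Q $ 2 $ 2 = b" "Q $ 3 $ 3 = - a - b" "Q $ 1 $ 2 = c" "Q $ 2 $ 1 = c"
    "Q $ 1 $ 3 = d" "Q $ 3 $ 1 = d" "Q $ 2 $ 3 = e" "Q $ 3 $ 2 = e"
    using S0_entriesE[OF assms] .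
  show ?thesis
    by (simp add: coord_simps Q) algebra
qed

text \<open>Only the first term survives at W = 0, with the constant sqrt 2 that comes from near
  orthogonality. Everything else carries a factor |W|.\<close>

lemma calib_has_derivative:
  assumes Q: "(Q has_vector_derivative H) (at t)" and S: "Q t \<in> S0" "H \<in> S0"
  shows "\<exists>D. ((\<lambda>t. calib \<epsilon> K (Q t)) has_real_derivative D) (at t) \<and>
    \<bar>D\<bar> \<le> norm H * (sqrt 2 * norm (col3 (Q t)) * norm (axis 3 1 - col3 (Q t))
       + norm (defect (Q t)) * (6 + 2 * \<bar>K\<bar> * (3 + 2 * norm (defect (Q t)))))"
proof -
  let ?M = "shifted (Q t)" and ?W = "defect (Q t)" and ?m = "col3 (Q t)" and ?q = "axis 3 1 - col3 (Q t)"
  let ?M2 = "?M ** H + H ** ?M"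
  note mult = bounded_bilinear.has_vector_derivative[OF bounded_bilinear_matrix_mult]
  have M: "((\<lambda>t. shifted (Q t)) has_vector_derivative H) (at t)"
    unfolding shifted_def using Q by (auto intro!: derivative_eq_intros)
  have MM: "((\<lambda>t. shifted (Q t) ** shifted (Q t)) has_vector_derivative ?M2) (at t)"
    by (rule mult[OF M M])
  have MMM: "((\<lambda>t. shifted (Q t) ** shifted (Q t) ** shifted (Q t)) has_vector_derivative ?M ** ?M ** H + ?M2 ** ?M) (at t)"
    by (rule mult[OF MM M])
  have W: "((\<lambda>t. defect (Q t)) has_vector_derivative ?M2 - H) (at t)"
    unfolding defect_def using MM M by (rule has_vector_derivative_diff)
  have bl: "bounded_linear (\<lambda>A::real^3^3. A $ 3 $ 3)"
    by (intro bounded_linear_compose[OF bounded_linear_vec_nth bounded_linear_vec_nth])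
  define D1 where "D1 = 3 * ?M2 $ 3 $ 3 - 2 * (?M ** ?M ** H + ?M2 ** ?M) $ 3 $ 3"
  define D where "D = D1 + K * (2 * (?W \<bullet> (?M2 - H)))"
  have s: "((\<lambda>t. smooth33 (Q t)) has_real_derivative D1) (at t)"
    unfolding smooth33_def D1_def
    using bounded_linear.has_vector_derivative[OF bl MM] bounded_linear.has_vector_derivative[OF bl MMM]
    by (intro DERIV_diff DERIV_cmult) (simp_all only: has_real_derivative_iff_has_vector_derivative)
  have N: "((\<lambda>t. (norm (defect (Q t)))\<^sup>2) has_real_derivative 2 * (?W \<bullet> (?M2 - H))) (at t)"
    unfolding power2_norm_eq_inner
    using bounded_bilinear.has_vector_derivative[OF bounded_bilinear_inner W W]
    by (simp add: has_real_derivative_iff_has_vector_derivative inner_commute)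
  have "((\<lambda>t. calib \<epsilon> K (Q t)) has_real_derivative D) (at t)"
    unfolding calib_def D_def using DERIV_add[OF DERIV_add[OF DERIV_const s] DERIV_cmult[OF N]] by simp
  moreover have "\<bar>D\<bar> \<le> norm H * (sqrt 2 * norm ?m * norm ?q + norm ?W * (6 + 2 * \<bar>K\<bar> * (3 + 2 * norm ?W)))"
  proof -
    \<comment> \<open>The squared dyadic bound is a main term plus at most (2 |W|)^2, and the root
      of a sum of squares is at most the sum of the roots.\<close>
    have b1: "\<bar>2 * (?m \<bullet> (H *v ?q))\<bar> \<le> norm H * (sqrt 2 * norm ?m * norm ?q + 2 * norm ?W)"
    proof (rule power2_le_imp_le)
      have "(?m \<bullet> ?q)\<^sup>2 \<le> (norm ?W)\<^sup>2"
        unfolding col3_inner_gap[OF S(1)] using norm_entry33_le[of ?W] by (simp add: abs_le_square_iff[symmetric])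
      then have "2 * (norm ?m)\<^sup>2 * (norm ?q)\<^sup>2 + 2 * (?m \<bullet> ?q)\<^sup>2 \<le> (sqrt 2 * norm ?m * norm ?q)\<^sup>2 + (2 * norm ?W)\<^sup>2"
        by (simp add: power_mult_distrib) (rule order_trans, assumption, simp)
      also have "\<dots> \<le> (sqrt 2 * norm ?m * norm ?q + 2 * norm ?W)\<^sup>2"
        by (simp add: power2_sum)
      finally have "(norm H)\<^sup>2 * (2 * (norm ?m)\<^sup>2 * (norm ?q)\<^sup>2 + 2 * (?m \<bullet> ?q)\<^sup>2)
          \<le> (norm H)\<^sup>2 * (sqrt 2 * norm ?m * norm ?q + 2 * norm ?W)\<^sup>2"
        by (intro mult_left_mono) auto
      then show "\<bar>2 * (?m \<bullet> (H *v ?q))\<bar>\<^sup>2 \<le> (norm H * (sqrt 2 * norm ?m * norm ?q + 2 * norm ?W))\<^sup>2"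
        using dyadic_bound[OF S(2), of ?m ?q] by (simp add: power_mult_distrib)
    qed simp
    have b2: "\<bar>4 * ((H *v axis 3 1) \<bullet> (?W *v axis 3 1))\<bar> \<le> norm H * (4 * norm ?W)"
    proof -
      have "\<bar>(H *v axis 3 1) \<bullet> (?W *v axis 3 1)\<bar> \<le> norm (H *v axis 3 1) * norm (?W *v axis 3 1)"
        by (rule Cauchy_Schwarz_ineq2)
      also have "\<dots> \<le> norm H * norm ?W"
        using norm_matrix_vector_mult_le[of H "axis 3 1"] norm_matrix_vector_mult_le[of ?W "axis 3 1"]
        by (intro mult_mono) auto
      finally show ?thesis by simp
    qed
    have b3: "\<bar>?W \<bullet> (?M2 - H)\<bar> \<le> norm H * (norm ?W * (3 + 2 * norm ?W))"
    proof -
      have "norm (?M2 - H) \<le> norm (?M ** H) + norm (H ** ?M) + norm H"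
        by (meson add_mono norm_triangle_ineq norm_triangle_ineq4 order_refl order_trans)
      also have "\<dots> \<le> norm ?M * norm H + norm H * norm ?M + norm H"
        by (intro add_mono norm_matrix_matrix_mult_le order_refl)
      also have "\<dots> = norm H * (2 * norm ?M + 1)" by (simp add: algebra_simps)
      also have "\<dots> \<le> norm H * (3 + 2 * norm ?W)"
        using norm_shifted_le[OF S(1)] by (intro mult_left_mono) auto
      finally have "norm ?W * norm (?M2 - H) \<le> norm ?W * (norm H * (3 + 2 * norm ?W))"
        by (rule mult_left_mono) simp
      then show ?thesis
        using Cauchy_Schwarz_ineq2[of ?W "?M2 - H"] by (simp add: mult_ac)
    qed
    have "\<bar>K * (2 * (?W \<bullet> (?M2 - H)))\<bar> \<le> norm H * (norm ?W * (2 * \<bar>K\<bar> * (3 + 2 * norm ?W)))"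
    proof -
      have "\<bar>K * (2 * (?W \<bullet> (?M2 - H)))\<bar> = 2 * \<bar>K\<bar> * \<bar>?W \<bullet> (?M2 - H)\<bar>"
        by (simp only: abs_mult abs_numeral mult.assoc mult.left_commute)
      also have "\<dots> \<le> 2 * \<bar>K\<bar> * (norm H * (norm ?W * (3 + 2 * norm ?W)))"
        by (rule mult_left_mono[OF b3]) simp
      also have "\<dots> = norm H * (norm ?W * (2 * \<bar>K\<bar> * (3 + 2 * norm ?W)))"
        by (simp only: mult_ac)
      finally show ?thesis .
    qed
    then have "\<bar>D\<bar> \<le> norm H * (sqrt 2 * norm ?m * norm ?q + 2 * norm ?W) + norm H * (4 * norm ?W)
        + norm H * (norm ?W * (2 * \<bar>K\<bar> * (3 + 2 * norm ?W)))"
      using b1 b2 unfolding D_def D1_def smooth33_derivative_identity[OF S] by linarith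
    also have "\<dots> = norm H * (sqrt 2 * norm ?m * norm ?q + norm ?W * (6 + 2 * \<bar>K\<bar> * (3 + 2 * norm ?W)))"
      by (simp add: algebra_simps)
    finally show ?thesis .
  qed
  ultimately show ?thesis by blast
qed

text \<open>Twice the gradient bound for the root of \<open>calib\<close>. The factor |M e_3| of the
  derivative has cancelled against the root, so the leading term measures the distance to e_3 alone,
  also where n_3 vanishes.\<close>

definition calib_slope :: "real \<Rightarrow> real \<Rightarrow> real^3^3 \<Rightarrow> real" where
  "calib_slope \<epsilon> \<delta> Q = sqrt 2 / sqrt (1 - \<delta>) * norm (axis 3 1 - col3 Q)
     + ((6 + 12/\<delta>) / sqrt \<epsilon> + 8/\<delta>) * norm (defect Q)"

lemma sqrt_calib_derivative_le:
  assumes Q: "(Q has_vector_derivative H) (at t)" and S: "Q t \<in> S0" "H \<in> S0"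
    and \<epsilon>: "0 < \<epsilon>" and \<delta>: "0 < \<delta>" "\<delta> < 1"
  shows "\<exists>D. ((\<lambda>t. sqrt (calib \<epsilon> (2/\<delta>) (Q t))) has_real_derivative D) (at t) \<and>
    \<bar>D\<bar> \<le> norm H * (calib_slope \<epsilon> \<delta> (Q t) / 2)"
proof -
  let ?m = "norm (col3 (Q t))" and ?q = "norm (axis 3 1 - col3 (Q t))" and ?N = "norm (defect (Q t))"
  obtain D where D: "((\<lambda>t. calib \<epsilon> (2/\<delta>) (Q t)) has_real_derivative D) (at t)"
    "\<bar>D\<bar> \<le> norm H * (sqrt 2 * ?m * ?q + ?N * (6 + 2 * \<bar>2/\<delta>\<bar> * (3 + 2 * ?N)))"
    using calib_has_derivative[OF Q S] by blast
  define z where "z = sqrt (calib \<epsilon> (2/\<delta>) (Q t))"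
  have Z: "\<epsilon> + (1 - \<delta>) * ?m\<^sup>2 + ?N\<^sup>2 / \<delta> \<le> calib \<epsilon> (2/\<delta>) (Q t)"
    by (rule calib_lower_bound[OF S(1) \<delta>(1)])
  have n: "0 \<le> (1 - \<delta>) * ?m\<^sup>2" "?N\<^sup>2 \<le> ?N\<^sup>2 / \<delta>" "0 \<le> ?N\<^sup>2" using \<delta> by (auto simp: field_simps mult_left_le_one_le)
  have pos: "0 < calib \<epsilon> (2/\<delta>) (Q t)" using Z n \<epsilon> by linarith
  have z: "0 < z" using pos by (simp add: z_def)
  \<comment> \<open>The three lower bounds for the root z serve one term each: the second cancels |M
    e_3| in the main term, the first divides the term linear in |W|, the third reduces |W|^2 to
    |W|.\<close>
  have z1: "sqrt \<epsilon> \<le> z" "sqrt (1 - \<delta>) * ?m \<le> z" "?N \<le> z"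
  proof -
    show "sqrt \<epsilon> \<le> z" unfolding z_def using Z n by (intro real_sqrt_le_mono) linarith
    have "sqrt (1 - \<delta>) * ?m = sqrt ((1 - \<delta>) * ?m\<^sup>2)" by (simp add: real_sqrt_mult)
    also have "\<dots> \<le> z" unfolding z_def using Z n \<epsilon> by (intro real_sqrt_le_mono) linarith
    finally show "sqrt (1 - \<delta>) * ?m \<le> z" .
    show "?N \<le> z" unfolding z_def using Z n \<epsilon> by (intro real_le_rsqrt) linarith
  qed
  have "((\<lambda>t. sqrt (calib \<epsilon> (2/\<delta>) (Q t))) has_real_derivative D / (2 * z)) (at t)"
    using DERIV_chain2[OF DERIV_real_sqrt[OF pos] D(1)] by (simp add: z_def field_simps)
  moreover have "\<bar>D / (2 * z)\<bar> \<le> norm H * (calib_slope \<epsilon> \<delta> (Q t) / 2)"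
  proof -
    have "\<bar>D / (2 * z)\<bar> \<le> norm H * ((sqrt 2 * ?m * ?q + ?N * (6 + 2 * \<bar>2/\<delta>\<bar> * (3 + 2 * ?N))) / z / 2)"
      using divide_right_mono[OF D(2), of "2 * z"] z by (simp add: abs_mult mult.commute)
    also have "\<dots> \<le> norm H * (calib_slope \<epsilon> \<delta> (Q t) / 2)"
    proof (intro mult_left_mono divide_right_mono)
      have "?m / z \<le> 1 / sqrt (1 - \<delta>)" using z1(2) z \<delta> by (simp add: field_simps)
      then have 1: "(?m / z) * (sqrt 2 * ?q) \<le> 1 / sqrt (1 - \<delta>) * (sqrt 2 * ?q)"
        by (rule mult_right_mono) simp
      have "1 / z \<le> 1 / sqrt \<epsilon>" using z1(1) \<epsilon> z by (intro divide_left_mono mult_pos_pos) auto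
      then have 2: "(1/z) * (?N * (6 + 12/\<delta>)) \<le> 1 / sqrt \<epsilon> * (?N * (6 + 12/\<delta>))"
        using \<delta> by (intro mult_right_mono) auto
      have "?N / z \<le> 1" using z1(3) z by simp
      then have 3: "(?N / z) * (8/\<delta> * ?N) \<le> 1 * (8/\<delta> * ?N)"
        using \<delta> by (intro mult_right_mono) auto
      have "(sqrt 2 * ?m * ?q + ?N * (6 + 2 * \<bar>2/\<delta>\<bar> * (3 + 2 * ?N))) / z
          = (?m / z) * (sqrt 2 * ?q) + (1/z) * (?N * (6 + 12/\<delta>)) + (?N / z) * (8/\<delta> * ?N)"
        using z \<delta> by (simp add: field_simps)
      also have "\<dots> \<le> 1 / sqrt (1 - \<delta>) * (sqrt 2 * ?q) + 1 / sqrt \<epsilon> * (?N * (6 + 12/\<delta>)) + 1 * (8/\<delta> * ?N)"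
        using 1 2 3 by linarith
      also have "\<dots> = calib_slope \<epsilon> \<delta> (Q t)"
        by (simp add: calib_slope_def algebra_simps add_divide_distrib)
      finally show "(sqrt 2 * ?m * ?q + ?N * (6 + 2 * \<bar>2/\<delta>\<bar> * (3 + 2 * ?N))) / z \<le> calib_slope \<epsilon> \<delta> (Q t)" .
    qed auto
    finally show ?thesis .
  qed
  ultimately show ?thesis by blast
qed

text \<open>The squared slope is compared with |e_3 - M e_3|^2, then with |Q -
  \<open>Q_infty\<close>|^2, then with g. Each passage costs a factor near 1 and a multiple of
  |W|^2, which is collected in C. As \<delta> tends to 0 the coefficient of g tends to 2 sqrt(2/3),
  which \<kappa>^2 = sqrt(3/2) turns into 2.\<close>

lemma calib_slope_sq_le:
  assumes \<epsilon>: "0 < \<epsilon>" and \<delta>: "0 < \<delta>" "\<delta> < 1" and g0: "0 \<le> g0"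
  shows "\<exists>C\<ge>0. \<forall>Q\<in>S0. (calib_slope \<epsilon> \<delta> Q)\<^sup>2
     \<le> 2 * ((1 + \<delta>) * (1 + 2 * \<delta>) / (1 - \<delta>) * (sqrt (2/3) + \<delta>)) * g_pot g0 Q + C * f_pot Q"
proof -
  define c1 where "c1 = (6 + 12/\<delta>) / sqrt \<epsilon> + 8/\<delta>"
  define a where "a = (1 + \<delta>) * (2 / (1 - \<delta>))"
  define k1 k2 k3 where k: "k1 = (1 + 1/\<delta>) * c1\<^sup>2" "k2 = 3/4 + 1/(4*\<delta>)" "k3 = 2/\<delta> + 9/4"
  define c2 where "c2 = k1 + a * k2 + a * (1 + 2 * \<delta>) * k3"
  have a: "0 \<le> a" using \<delta> by (simp add: a_def)
  have c2: "0 \<le> c2" using \<delta> a by (simp add: c2_def k)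
  show ?thesis
  proof (intro exI[of _ "2/3 * c2"] conjI ballI)
    fix Q assume Q: "Q \<in> S0"
    let ?q = "norm (axis 3 1 - col3 Q)" and ?N = "norm (defect Q)" and ?E = "norm (Q - Q_infty)" and ?g = "g_pot g0 Q"
    have sq: "(x + y)\<^sup>2 \<le> (1 + \<delta>) * x\<^sup>2 + (1 + 1/\<delta>) * y\<^sup>2" for x y :: real
    proof -
      have "0 \<le> (\<delta> * x - y)\<^sup>2 / \<delta>" using \<delta> by simp
      also have "\<dots> = (1 + \<delta>) * x\<^sup>2 + (1 + 1/\<delta>) * y\<^sup>2 - (x + y)\<^sup>2"
        using \<delta> by (simp add: power2_eq_square field_simps)
      finally show ?thesis by simp
    qed
    have "(calib_slope \<epsilon> \<delta> Q)\<^sup>2 \<le> (1 + \<delta>) * (sqrt 2 / sqrt (1 - \<delta>) * ?q)\<^sup>2 + (1 + 1/\<delta>) * (c1 * ?N)\<^sup>2"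
      unfolding calib_slope_def c1_def by (rule sq)
    also have "\<dots> = a * ?q\<^sup>2 + k1 * ?N\<^sup>2"
      using \<delta> by (simp add: a_def k power_mult_distrib power_divide)
    also have "a * ?q\<^sup>2 \<le> a * ((1/2 + \<delta>) * ?E\<^sup>2 + k2 * ?N\<^sup>2)"
      using col3_gap_le[OF Q \<delta>(1)] a unfolding k by (rule mult_left_mono)
    also have "\<dots> = a * (1 + 2 * \<delta>) * (?E\<^sup>2 / 2) + a * k2 * ?N\<^sup>2"
      by (simp add: algebra_simps)
    also have "a * (1 + 2 * \<delta>) * (?E\<^sup>2 / 2) \<le> a * (1 + 2 * \<delta>) * ((sqrt (2/3) + \<delta>) * ?g + k3 * ?N\<^sup>2)"
      unfolding k using a \<delta> by (intro mult_left_mono dist_Q_infty_le_g_pot Q g0) auto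
    finally have "(calib_slope \<epsilon> \<delta> Q)\<^sup>2 \<le> a * (1 + 2 * \<delta>) * (sqrt (2/3) + \<delta>) * ?g + c2 * ?N\<^sup>2"
      by (simp add: c2_def algebra_simps)
    also have "c2 * ?N\<^sup>2 = 2/3 * c2 * f_pot Q" by (simp add: f_pot_eq_defect[OF Q])
    also have "a * (1 + 2 * \<delta>) * (sqrt (2/3) + \<delta>) * ?g = 2 * ((1 + \<delta>) * (1 + 2 * \<delta>) / (1 - \<delta>) * (sqrt (2/3) + \<delta>)) * ?g"
      by (simp add: a_def)
    finally show "(calib_slope \<epsilon> \<delta> Q)\<^sup>2
     \<le> 2 * ((1 + \<delta>) * (1 + 2 * \<delta>) / (1 - \<delta>) * (sqrt (2/3) + \<delta>)) * ?g + 2/3 * c2 * f_pot Q" by simp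
  qed (use c2 in simp)
qed

section \<open>Sobolev functions on a half-line\<close>

lemma C1_zero_derivative_outside:
  fixes \<psi> :: "'a::euclidean_space \<Rightarrow> 'b::euclidean_space"
  assumes der: "\<And>x. (\<psi> has_derivative blinfun_apply (\<psi>' x)) (at x)"
    and zero: "\<And>x. x \<notin> S \<Longrightarrow> \<psi> x = 0" and S: "closed S" and x: "x \<notin> S"
  shows "\<psi>' x = 0"
proof -
  have "((\<lambda>_. 0) has_derivative (\<lambda>_. 0)) (at x)" by simp
  then have "(\<psi> has_derivative (\<lambda>_. 0)) (at x)"
    by (rule has_derivative_transform_within_open[OF _ open_Compl[OF S]]) (use zero x in auto)
  then have "blinfun_apply (\<psi>' x) = (\<lambda>_. 0)"
    using der has_derivative_unique by blast
  then show ?thesis by (simp add: blinfun_eqI)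
qed

text \<open>Difference quotients in direction b have integral 0 by translation invariance, and
  dominated convergence hands this on to the derivative.\<close>

lemma C1_compact_support_integral:
  fixes \<psi> :: "'a::euclidean_space \<Rightarrow> 'b::euclidean_space"
  assumes der: "\<And>x. (\<psi> has_derivative blinfun_apply (\<psi>' x)) (at x)"
    and cont: "continuous_on UNIV \<psi>'"
    and zero: "\<And>x. x \<notin> cball 0 R \<Longrightarrow> \<psi> x = 0" and b: "norm b = 1"
  shows "integrable lborel (\<lambda>x. \<psi>' x b)" "(\<integral>x. \<psi>' x b \<partial>lborel) = 0"
proof -
  have zero': "\<psi>' x = 0" if "x \<notin> cball 0 R" for x
    using C1_zero_derivative_outside[OF der zero closed_cball that] .
  have cont\<psi>: "continuous_on UNIV \<psi>"
    using der by (intro continuous_at_imp_continuous_on ballI has_derivative_continuous) auto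
  have "integrable lborel (\<lambda>x. indicator (cball 0 R) x *\<^sub>R \<psi> x)"
    by (intro borel_integrable_compact continuous_on_subset[OF cont\<psi>]) auto
  also have "(\<lambda>x. indicator (cball 0 R) x *\<^sub>R \<psi> x) = \<psi>"
    using zero by (auto simp: indicator_def)
  finally have int: "integrable lborel \<psi>" .
  have [measurable]: "\<psi> \<in> borel_measurable borel"
    by (rule borel_measurable_continuous_onI[OF cont\<psi>])
  have "integrable lborel (\<lambda>x. indicator (cball 0 R) x *\<^sub>R \<psi>' x b)"
    by (intro borel_integrable_compact continuous_intros continuous_on_subset[OF cont]) auto
  also have "(\<lambda>x. indicator (cball 0 R) x *\<^sub>R \<psi>' x b) = (\<lambda>x. \<psi>' x b)"
    using zero' by (auto simp: indicator_def)
  finally show int': "integrable lborel (\<lambda>x. \<psi>' x b)" .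
  have "bounded (\<psi>' ` cball 0 R)"
    by (intro compact_imp_bounded compact_continuous_image continuous_on_subset[OF cont]) auto
  then obtain C where C: "0 < C" "\<And>x. x \<in> cball 0 R \<Longrightarrow> norm (\<psi>' x) \<le> C"
    unfolding bounded_pos by auto
  have bound: "norm (\<psi>' x) \<le> C" for x
    using C zero'[of x] by (cases "x \<in> cball 0 R") auto
  have lip: "norm (\<psi> x - \<psi> y) \<le> C * norm (x - y)" for x y
    by (rule differentiable_bound[of UNIV \<psi> "\<lambda>x. blinfun_apply (\<psi>' x)"])
      (use der bound in \<open>auto simp flip: norm_blinfun.rep_eq\<close>)
  \<comment> \<open>The steps 1/(n+1) are at most 1, so all quotients vanish outside the ball of
    radius R + 1, and the Lipschitz constant C bounds them inside.\<close>
  define s where "s n x = real (Suc n) *\<^sub>R (\<psi> ((1 / real (Suc n)) *\<^sub>R b + x) - \<psi> x)" for n x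
  have shift: "integrable lborel (\<lambda>x. \<psi> (c + x))" "(\<integral>x. \<psi> (c + x) \<partial>lborel) = (\<integral>x. \<psi> x \<partial>lborel)" for c
  proof -
    have "integrable (distr lborel borel ((+) c)) \<psi>" using int by (simp add: lborel_distr_plus)
    then show "integrable lborel (\<lambda>x. \<psi> (c + x))" by (subst (asm) integrable_distr_eq) auto
    have "(\<integral>x. \<psi> x \<partial>lborel) = (\<integral>x. \<psi> x \<partial>distr lborel borel ((+) c))" by (simp add: lborel_distr_plus)
    also have "\<dots> = (\<integral>x. \<psi> (c + x) \<partial>lborel)" using int by (subst integral_distr) auto
    finally show "(\<integral>x. \<psi> (c + x) \<partial>lborel) = (\<integral>x. \<psi> x \<partial>lborel)" ..
  qed
  have s0: "(\<integral>x. s n x \<partial>lborel) = 0" for n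
    unfolding s_def using shift int by (simp add: Bochner_Integration.integral_diff)
  have "(\<lambda>n. \<integral>x. s n x \<partial>lborel) \<longlonglongrightarrow> (\<integral>x. \<psi>' x b \<partial>lborel)"
  proof (rule integral_dominated_convergence[where w="\<lambda>x. C * indicator (cball 0 (R + 1)) x"])
    show "integrable lborel (\<lambda>x. C * indicat_real (cball 0 (R + 1)) x :: real)"
      by (intro integrable_mult_right integrable_real_indicator emeasure_lborel_cball_finite) auto
    show "s n \<in> borel_measurable lborel" for n
      unfolding s_def using shift(1) int by (intro borel_measurable_scaleR borel_measurable_diff) auto
    show "AE x in lborel. norm (s n x) \<le> C * indicat_real (cball 0 (R + 1)) x" for n
    proof (rule AE_I2)
      fix x
      let ?y = "(1 / real (Suc n)) *\<^sub>R b + x"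
      show "norm (s n x) \<le> C * indicat_real (cball 0 (R + 1)) x"
      proof (cases "x \<in> cball 0 (R + 1)")
        case True
        have "norm (\<psi> ?y - \<psi> x) \<le> C * (1 / real (Suc n))"
          using lip[of ?y x] b by simp
        then have "norm (s n x) \<le> real (Suc n) * (C * (1 / real (Suc n)))"
          unfolding s_def norm_scaleR by (intro mult_mono) auto
        then show ?thesis using True by simp
      next
        case False
        have "norm x \<le> norm ?y + norm ((1 / real (Suc n)) *\<^sub>R b)"
          using norm_triangle_ineq4[of ?y "(1 / real (Suc n)) *\<^sub>R b"] by simp
        also have "norm ((1 / real (Suc n)) *\<^sub>R b) \<le> 1" using b by simp
        finally have "?y \<notin> cball 0 R" "x \<notin> cball 0 R" using False by auto
        then have "norm (s n x) = 0" using zero by (simp add: s_def)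
        also have "0 \<le> C * indicat_real (cball 0 (R + 1)) x" using C(1) by (intro mult_nonneg_nonneg) auto
        finally show ?thesis .
      qed
    qed
    show "AE x in lborel. (\<lambda>n. s n x) \<longlonglongrightarrow> \<psi>' x b"
    proof (rule AE_I2)
      fix x
      let ?y = "\<lambda>n. (1 / real (Suc n)) *\<^sub>R b + x"
      have "(\<lambda>n. (1 / real (Suc n)) *\<^sub>R b + x) \<longlonglongrightarrow> 0 *\<^sub>R b + x"
        using LIMSEQ_Suc[OF lim_1_over_n] by (intro tendsto_intros)
      then have "filterlim ?y (at x) sequentially"
        using b by (auto simp: filterlim_at)
      moreover have "((\<lambda>y. norm (\<psi> y - \<psi> x - \<psi>' x (y - x)) / norm (y - x)) \<longlongrightarrow> 0) (at x)"
        using der[of x] by (simp add: has_derivative_iff_norm)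
      ultimately have "(\<lambda>n. norm (\<psi> (?y n) - \<psi> x - \<psi>' x (?y n - x)) / norm (?y n - x)) \<longlonglongrightarrow> 0"
        by (rule filterlim_compose[rotated])
      moreover have "norm (\<psi> (?y n) - \<psi> x - \<psi>' x (?y n - x)) / norm (?y n - x) = norm (s n x - \<psi>' x b)" for n
      proof -
        define X where "X = \<psi> (?y n) - \<psi> x - \<psi>' x (?y n - x)"
        have "s n x - \<psi>' x b = real (Suc n) *\<^sub>R X"
          by (simp add: X_def s_def scaleR_diff_right blinfun.scaleR_right)
        then have "norm (s n x - \<psi>' x b) = real (Suc n) * norm X" by simp
        moreover have "norm (?y n - x) = 1 / real (Suc n)" using b by simp
        ultimately have "norm X / norm (?y n - x) = norm (s n x - \<psi>' x b)" by simp
        then show ?thesis by (simp only: X_def)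
      qed
      ultimately have "(\<lambda>n. norm (s n x - \<psi>' x b)) \<longlonglongrightarrow> 0" by (simp only:)
      then show "(\<lambda>n. s n x) \<longlonglongrightarrow> \<psi>' x b"
        by (rule LIM_zero_cancel[OF tendsto_norm_zero_cancel])
    qed
  qed (use int' in auto)
  with s0 show "(\<integral>x. \<psi>' x b \<partial>lborel) = 0"
    by (simp add: LIMSEQ_const_iff)
qed

lemma test_funD:
  assumes "test_fun \<Omega> \<phi>"
  obtains \<phi>' R where "\<And>x. (\<phi> has_derivative blinfun_apply (\<phi>' x)) (at x)" "continuous_on UNIV \<phi>'"
    "\<And>x. x \<notin> cball 0 R \<Longrightarrow> \<phi> x = 0" "\<And>x. x \<notin> \<Omega> \<Longrightarrow> \<phi> x = 0" "\<And>x. x \<notin> \<Omega> \<Longrightarrow> \<phi>' x = 0"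
    "\<And>b x. partial_deriv b \<phi> x = \<phi>' x b" "continuous_on UNIV \<phi>"
proof -
  obtain \<phi>' where \<phi>': "\<And>x. (\<phi> has_derivative blinfun_apply (\<phi>' x)) (at x)" "continuous_on UNIV \<phi>'"
    using assms by (auto simp: test_fun_def C1_fun_def)
  let ?K = "closure {x. \<phi> x \<noteq> 0}"
  have K: "compact ?K" "?K \<subseteq> \<Omega>" using assms by (auto simp: test_fun_def)
  have z: "x \<notin> ?K \<Longrightarrow> \<phi> x = 0" for x using closure_subset[of "{x. \<phi> x \<noteq> 0}"] by auto
  have "bounded ?K" by (rule compact_imp_bounded[OF K(1)])
  then obtain R where "\<forall>x\<in>?K. norm x \<le> R" unfolding bounded_iff ..
  then have R: "?K \<subseteq> cball 0 R" by (auto simp only: subset_iff mem_cball_0 Ball_def)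
  show thesis
  proof (rule that[of \<phi>' R, OF \<phi>'])
    fix x
    show "\<phi> x = 0" if "x \<notin> cball 0 R" using z R that by blast
    show "\<phi> x = 0" if "x \<notin> \<Omega>" using z K(2) that by blast
    show "\<phi>' x = 0" if x: "x \<notin> \<Omega>"
    proof -
      have "x \<notin> ?K" using K(2) x by (meson subsetD)
      then show ?thesis using C1_zero_derivative_outside[OF \<phi>'(1) z closed_closure] by metis
    qed
    show "partial_deriv b \<phi> x = \<phi>' x b" for b
      using frechet_derivative_at[OF \<phi>'(1)[of x]] by simp
  next
    show "continuous_on UNIV \<phi>"
      using \<phi>'(1) by (intro continuous_at_imp_continuous_on ballI has_derivative_continuous) auto
  qed
qed

lemma L2_fun_integrable_mult:
  fixes u :: "'a \<Rightarrow> 'b::euclidean_space"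
  assumes u: "L2_fun M u" and \<phi>: "\<phi> \<in> borel_measurable M" "integrable M (\<lambda>x. (\<phi> x)\<^sup>2)"
  shows "integrable M (\<lambda>x. \<phi> x *\<^sub>R u x)"
proof (rule Bochner_Integration.integrable_bound)
  show "integrable M (\<lambda>x. (\<phi> x)\<^sup>2 + (norm (u x))\<^sup>2)"
    using u \<phi> by (simp add: L2_fun_def)
  show "(\<lambda>x. \<phi> x *\<^sub>R u x) \<in> borel_measurable M"
    using u \<phi> by (auto simp: L2_fun_def)
  have "\<bar>a\<bar> * b \<le> a\<^sup>2 + b\<^sup>2" for a b :: real
  proof -
    have "2 * (\<bar>a\<bar> * b) \<le> a\<^sup>2 + b\<^sup>2" "0 \<le> a\<^sup>2 + b\<^sup>2"
      using zero_le_power2[of "\<bar>a\<bar> - b"] by (simp_all add: power2_diff)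
    then show ?thesis by linarith
  qed
  then show "AE x in M. norm (\<phi> x *\<^sub>R u x) \<le> norm ((\<phi> x)\<^sup>2 + (norm (u x))\<^sup>2)"
    by (intro AE_I2) simp
qed

lemma integral_lebesgue_on:
  fixes f :: "'a::euclidean_space \<Rightarrow> 'b::euclidean_space"
  assumes f: "f \<in> borel_measurable borel" and \<Omega>: "\<Omega> \<in> sets borel"
  shows "(LINT x|lebesgue_on \<Omega>. f x) = (LINT x|lborel. indicator \<Omega> x *\<^sub>R f x)"
    and "integrable (lebesgue_on \<Omega>) f \<longleftrightarrow> integrable lborel (\<lambda>x. indicator \<Omega> x *\<^sub>R f x)"
proof -
  have m: "(\<lambda>x. indicator \<Omega> x *\<^sub>R f x) \<in> lborel \<rightarrow>\<^sub>M borel" using f \<Omega> by measurable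
  have \<Omega>': "\<Omega> \<inter> space lebesgue \<in> sets lebesgue" using \<Omega> by simp
  show "(LINT x|lebesgue_on \<Omega>. f x) = (LINT x|lborel. indicator \<Omega> x *\<^sub>R f x)"
    unfolding integral_restrict_space[OF \<Omega>'] by (rule integral_completion[OF m])
  show "integrable (lebesgue_on \<Omega>) f \<longleftrightarrow> integrable lborel (\<lambda>x. indicator \<Omega> x *\<^sub>R f x)"
    unfolding integrable_restrict_space[OF \<Omega>'] by (rule integrable_completion[OF m])
qed

text \<open>For an admissible Q only Q - \<open>Q_infty\<close> is square integrable, while the
  energy refers to the weak gradient of Q itself. The constant drops out because derivatives of test
  functions have integral 0.\<close>

lemma has_weak_gradient_add_const:
  fixes u :: "'a::euclidean_space \<Rightarrow> 'b::euclidean_space"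
  assumes G: "has_weak_gradient \<Omega> (\<lambda>x. u x - c) G" and u: "L2_fun (lebesgue_on \<Omega>) (\<lambda>x. u x - c)"
    and \<Omega>: "\<Omega> \<in> sets borel"
  shows "has_weak_gradient \<Omega> u G"
  unfolding has_weak_gradient_def
proof (intro ballI conjI allI impI)
  fix b :: 'a assume b: "b \<in> Basis"
  then show "L2_fun (lebesgue_on \<Omega>) (G b)" using G by (simp add: has_weak_gradient_def)
  fix \<phi> assume \<phi>: "test_fun \<Omega> \<phi>"
  obtain \<phi>' R where p: "\<And>x. (\<phi> has_derivative blinfun_apply (\<phi>' x)) (at x)" "continuous_on UNIV \<phi>'"
    "\<And>x. x \<notin> cball 0 R \<Longrightarrow> \<phi> x = 0" "\<And>x. x \<notin> \<Omega> \<Longrightarrow> \<phi> x = 0" "\<And>x. x \<notin> \<Omega> \<Longrightarrow> \<phi>' x = 0"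
    "\<And>b x. partial_deriv b \<phi> x = \<phi>' x b" "continuous_on UNIV \<phi>"
    using test_funD[OF \<phi>] by metis
  have [measurable]: "(\<lambda>x. \<phi>' x b) \<in> borel_measurable borel"
    by (intro borel_measurable_continuous_onI continuous_intros p)
  have z: "\<phi>' x = 0" if "x \<notin> cball 0 R" for x
    using C1_zero_derivative_outside[OF p(1,3) closed_cball that] .
  have supp: "indicator \<Omega> x *\<^sub>R \<phi>' x b = \<phi>' x b" for x
    using p(5)[of x] by (cases "x \<in> \<Omega>") auto
  have int: "integrable (lebesgue_on \<Omega>) (\<lambda>x. \<phi>' x b)" "(LINT x|lebesgue_on \<Omega>. \<phi>' x b) = 0"
    using C1_compact_support_integral[OF p(1-3) norm_Basis[OF b]]
    by (simp_all add: integral_lebesgue_on \<Omega> supp del: real_scaleR_def)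
  have "integrable lborel (\<lambda>x. indicator (cball 0 R) x *\<^sub>R (\<phi>' x b)\<^sup>2)"
    by (intro borel_integrable_compact continuous_intros continuous_on_subset[OF p(2)]) auto
  also have "(\<lambda>x. indicator (cball 0 R) x *\<^sub>R (\<phi>' x b)\<^sup>2) = (\<lambda>x. indicator \<Omega> x *\<^sub>R (\<phi>' x b)\<^sup>2)"
  proof
    fix x show "indicator (cball 0 R) x *\<^sub>R (\<phi>' x b)\<^sup>2 = indicator \<Omega> x *\<^sub>R (\<phi>' x b)\<^sup>2"
      using z[of x] p(5)[of x] by (cases "x \<in> cball 0 R"; cases "x \<in> \<Omega>") (auto simp del: mem_cball)
  qed
  finally have "integrable (lebesgue_on \<Omega>) (\<lambda>x. (\<phi>' x b)\<^sup>2)"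
    by (subst integral_lebesgue_on(2)[OF _ \<Omega>]) auto
  moreover have "(\<lambda>x. \<phi>' x b) \<in> borel_measurable (lebesgue_on \<Omega>)"
    using int(1) by (rule borel_measurable_integrable)
  ultimately have int2: "integrable (lebesgue_on \<Omega>) (\<lambda>x. \<phi>' x b *\<^sub>R (u x - c))"
    by (intro L2_fun_integrable_mult[OF u])
  have "(LINT x|lebesgue_on \<Omega>. \<phi>' x b *\<^sub>R u x) = (LINT x|lebesgue_on \<Omega>. \<phi>' x b *\<^sub>R (u x - c) + \<phi>' x b *\<^sub>R c)"
    by (simp add: scaleR_diff_right)
  also have "\<dots> = (LINT x|lebesgue_on \<Omega>. \<phi>' x b *\<^sub>R (u x - c)) + (LINT x|lebesgue_on \<Omega>. \<phi>' x b *\<^sub>R c)"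
    using int2 int(1) by (intro Bochner_Integration.integral_add) auto
  also have "(LINT x|lebesgue_on \<Omega>. \<phi>' x b *\<^sub>R c) = 0"
    using int by simp
  also have "(LINT x|lebesgue_on \<Omega>. \<phi>' x b *\<^sub>R (u x - c)) = - (LINT x|lebesgue_on \<Omega>. \<phi> x *\<^sub>R G b x)"
  proof -
    have "(LINT x|lebesgue_on \<Omega>. partial_deriv b \<phi> x *\<^sub>R (u x - c)) = - (LINT x|lebesgue_on \<Omega>. \<phi> x *\<^sub>R G b x)"
      using G b \<phi> unfolding has_weak_gradient_def by blast
    then show ?thesis by (simp only: p(6))
  qed
  finally show "(LINT x|lebesgue_on \<Omega>. partial_deriv b \<phi> x *\<^sub>R u x) = - (LINT x|lebesgue_on \<Omega>. \<phi> x *\<^sub>R G b x)"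
    by (simp add: p(6))
qed

lemma Int_stable_greaterThanLessThan: "Int_stable (range (\<lambda>(a, b). {a<..<b::real}))"
proof (rule Int_stableI)
  fix A B assume "A \<in> range (\<lambda>(a, b). {a<..<b::real})" "B \<in> range (\<lambda>(a, b). {a<..<b::real})"
  then obtain a b c d where "A = {a<..<b}" "B = {c<..<d}" by auto
  then have "A \<inter> B = (\<lambda>(a, b). {a<..<b}) (max a c, min b d)" by auto
  then show "A \<inter> B \<in> range (\<lambda>(a, b). {a<..<b::real})" by blast
qed

text \<open>Open intervals are closed under intersection and generate the Borel sets; the vanishing
  total integral settles complements. Hence the integral over every Borel set is 0.\<close>

lemma AE_eq_0_if_interval_integrals_eq_0:
  fixes f :: "real \<Rightarrow> 'b::euclidean_space"
  assumes f: "integrable lborel f" and tot: "(\<integral>x. f x \<partial>lborel) = 0"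
    and zero: "\<And>a b. (LINT x:{a<..<b}|lborel. f x) = 0"
  shows "AE x in lborel. f x = 0"
proof (rule sigma_finite_measure.density_zero[OF _ f])
  fix A :: "real set" assume "A \<in> sets lborel"
  have sig: "sigma_sets UNIV (range (\<lambda>(a, b). {a<..<b::real})) = sets lborel"
    by (simp add: borel_eq_box[where 'a=real] box_real)
  with \<open>A \<in> sets lborel\<close> have A: "A \<in> sigma_sets UNIV (range (\<lambda>(a, b). {a<..<b::real}))"
    by simp
  have G: "range (\<lambda>(a, b). {a<..<b::real}) \<subseteq> Pow UNIV" by simp
  have si: "set_integrable lborel A f" if "A \<in> sets lborel" for A
    using f that unfolding set_integrable_def by (intro integrable_mult_indicator) auto
  show "(LINT x:A|lborel. f x) = 0"
    using Int_stable_greaterThanLessThan G A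
  proof (induction rule: sigma_sets_induct_disjoint)
    case (compl A)
    then have "A \<in> sets lborel" using sig by simp
    have "(LINT x:UNIV|lborel. f x) = (LINT x:A \<union> (UNIV - A)|lborel. f x)" by simp
    also have "\<dots> = (LINT x:A|lborel. f x) + (LINT x:(UNIV - A)|lborel. f x)"
      using \<open>A \<in> sets lborel\<close> by (intro set_integral_Un si) auto
    finally show ?case using tot compl by (simp add: set_lebesgue_integral_def)
  next
    case (union A)
    then have A: "A i \<in> sets lborel" for i using sig by auto
    have "(LINT x:(\<Union>i. A i)|lborel. f x) = (\<Sum>i. (LINT x:A i|lborel. f x))"
      using A union(1) by (intro lebesgue_integral_countable_add si) (auto simp: disjoint_family_on_def)
    then show ?case using union by simp
  qed (use zero in \<open>auto simp: set_lebesgue_integral_def[of _ "{}"]\<close>)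
qed (rule sigma_finite_lborel)

section \<open>The half-line as a measure space, and L2 pairings on it\<close>

text \<open>The Borel counterpart of \<open>lebesgue_on {1<..}\<close>. Borel functions on the line
  are measurable for it, and the integrals agree with those in the definitions.\<close>

definition ray :: "real measure" where
  "ray = restrict_space lborel {1<..}"

lemma space_ray [simp]: "space ray = {1<..}"
  by (simp add: ray_def space_restrict_space)

lemma measurable_ray [measurable (raw)]: "f \<in> borel_measurable borel \<Longrightarrow> f \<in> borel_measurable ray"
  unfolding ray_def by (rule measurable_restrict_space1) simp

lemma nn_integral_ray: "(\<integral>\<^sup>+r. F r \<partial>ray) = (\<integral>\<^sup>+r\<in>{1<..}. F r \<partial>lborel)"
  unfolding ray_def by (rule nn_integral_restrict_space) simp

lemma nn_integral_ray_lebesgue: "(\<integral>\<^sup>+r\<in>{1<..}. F r \<partial>lebesgue) = (\<integral>\<^sup>+r. F r \<partial>ray)"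
  unfolding nn_integral_ray by (rule nn_integral_completion)

lemma AE_ray: "(AE r in ray. P r) \<longleftrightarrow> (AE r in lborel. 1 < r \<longrightarrow> P r)"
  unfolding ray_def by (subst AE_restrict_space_iff) auto

lemma integral_ray:
  fixes f :: "real \<Rightarrow> 'b::euclidean_space"
  shows "(\<integral>r. f r \<partial>ray) = (\<integral>r. indicator {1<..} r *\<^sub>R f r \<partial>lborel)"
    and "integrable ray f \<longleftrightarrow> integrable lborel (\<lambda>r. indicator {1<..} r *\<^sub>R f r)"
  unfolding ray_def by (simp_all add: integral_restrict_space integrable_restrict_space)

lemma integral_lebesgue_on_ray:
  fixes f :: "real \<Rightarrow> 'b::euclidean_space"
  assumes "f \<in> borel_measurable borel"
  shows "(LINT r|lebesgue_on {1<..}. f r) = (\<integral>r. f r \<partial>ray)"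
    and "integrable (lebesgue_on {1<..}) f \<longleftrightarrow> integrable ray f"
  using integral_lebesgue_on[OF assms, of "{1<..}"] by (simp_all add: integral_ray)

lemma L2_integrable_mult:
  fixes f :: "'a \<Rightarrow> 'b::euclidean_space"
  assumes [measurable]: "\<phi> \<in> borel_measurable M" "f \<in> borel_measurable M"
    and \<phi>: "(\<integral>\<^sup>+x. ennreal ((\<phi> x)\<^sup>2) \<partial>M) < \<infinity>" and f: "(\<integral>\<^sup>+x. ennreal ((norm (f x))\<^sup>2) \<partial>M) < \<infinity>"
  shows "integrable M (\<lambda>x. \<phi> x *\<^sub>R f x)"
proof (rule L2_fun_integrable_mult)
  show "L2_fun M f" using f by (simp add: L2_fun_def integrable_iff_bounded)
  show "integrable M (\<lambda>x. (\<phi> x)\<^sup>2)" using \<phi> by (simp add: integrable_iff_bounded)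
qed simp

lemma ennreal_tendsto_0_if_square:
  fixes X :: "'a \<Rightarrow> ennreal"
  assumes "((\<lambda>k. (X k)\<^sup>2) \<longlongrightarrow> 0) F"
  shows "(X \<longlongrightarrow> 0) F"
proof (rule order_tendstoI)
  fix a :: ennreal assume "0 < a"
  then have "0 < a\<^sup>2" by (simp add: power2_eq_square ennreal_zero_less_mult_iff)
  then have "eventually (\<lambda>k. (X k)\<^sup>2 < a\<^sup>2) F" using order_tendstoD(2)[OF assms] by blast
  then show "eventually (\<lambda>k. X k < a) F"
  proof eventually_elim
    case (elim k)
    show ?case
    proof (rule ccontr)
      assume "\<not> X k < a"
      then have "a\<^sup>2 \<le> (X k)\<^sup>2" by (intro power_mono) auto
      with elim show False by simp
    qed
  qed
qed simp

lemma L2_pairing_tendsto: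
  fixes f :: "'a \<Rightarrow> 'b::euclidean_space"
  assumes [measurable]: "\<phi> \<in> borel_measurable M" "f \<in> borel_measurable M" "\<And>k. u k \<in> borel_measurable M"
    and \<phi>: "(\<integral>\<^sup>+x. ennreal ((\<phi> x)\<^sup>2) \<partial>M) < \<infinity>" and f: "(\<integral>\<^sup>+x. ennreal ((norm (f x))\<^sup>2) \<partial>M) < \<infinity>"
    and conv: "(\<lambda>k. \<integral>\<^sup>+x. ennreal ((norm (u k x - f x))\<^sup>2) \<partial>M) \<longlonglongrightarrow> 0"
    and int: "\<And>k. integrable M (\<lambda>x. \<phi> x *\<^sub>R u k x)"
  shows "(\<lambda>k. \<integral>x. \<phi> x *\<^sub>R u k x \<partial>M) \<longlonglongrightarrow> (\<integral>x. \<phi> x *\<^sub>R f x \<partial>M)"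
proof (rule tendsto_L1_int[OF int])
  show "integrable M (\<lambda>x. \<phi> x *\<^sub>R f x)" by (rule L2_integrable_mult) (use \<phi> f in auto)
  define X where "X k = (\<integral>\<^sup>+x. ennreal \<bar>\<phi> x\<bar> * ennreal (norm (u k x - f x)) \<partial>M)" for k
  have X: "(\<integral>\<^sup>+x. ennreal (norm (\<phi> x *\<^sub>R u k x - \<phi> x *\<^sub>R f x)) \<partial>M) = X k" for k
    unfolding X_def by (intro nn_integral_cong) (simp add: ennreal_mult[symmetric] flip: scaleR_diff_right)
  have "(X k)\<^sup>2 \<le> (\<integral>\<^sup>+x. ennreal ((\<phi> x)\<^sup>2) \<partial>M) * (\<integral>\<^sup>+x. ennreal ((norm (u k x - f x))\<^sup>2) \<partial>M)" for k
    using Cauchy_Schwarz_nn_integral[of "\<lambda>x. ennreal \<bar>\<phi> x\<bar>" M "\<lambda>x. ennreal (norm (u k x - f x))"]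
    by (simp add: X_def ennreal_power)
  moreover have "(\<lambda>k. (\<integral>\<^sup>+x. ennreal ((\<phi> x)\<^sup>2) \<partial>M) * (\<integral>\<^sup>+x. ennreal ((norm (u k x - f x))\<^sup>2) \<partial>M)) \<longlonglongrightarrow> 
      (\<integral>\<^sup>+x. ennreal ((\<phi> x)\<^sup>2) \<partial>M) * 0"
    using \<phi> by (intro tendsto_mult_ennreal tendsto_const conv) auto
  ultimately have "(\<lambda>k. (X k)\<^sup>2) \<longlonglongrightarrow> 0"
    by (intro tendsto_sandwich[where f="\<lambda>_. 0" and g="\<lambda>k. (X k)\<^sup>2" and net=sequentially
        and h="\<lambda>k. (\<integral>\<^sup>+x. ennreal ((\<phi> x)\<^sup>2) \<partial>M) * (\<integral>\<^sup>+x. ennreal ((norm (u k x - f x))\<^sup>2) \<partial>M)"]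
        always_eventually allI) simp_all
  then show "(\<lambda>k. \<integral>\<^sup>+x. ennreal (norm (\<phi> x *\<^sub>R u k x - \<phi> x *\<^sub>R f x)) \<partial>M) \<longlonglongrightarrow> 0"
    unfolding X by (rule ennreal_tendsto_0_if_square)
qed

lemma test_fun_ray:
  assumes "test_fun {1<..} \<phi>"
  shows "\<phi> \<in> borel_measurable borel" "partial_deriv 1 \<phi> \<in> borel_measurable borel"
    "(\<integral>\<^sup>+r. ennreal ((\<phi> r)\<^sup>2) \<partial>ray) < \<infinity>" "(\<integral>\<^sup>+r. ennreal ((partial_deriv 1 \<phi> r)\<^sup>2) \<partial>ray) < \<infinity>"
proof -
  obtain \<phi>' R where p: "\<And>x. (\<phi> has_derivative blinfun_apply (\<phi>' x)) (at x)" "continuous_on UNIV \<phi>'"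
    "\<And>x. x \<notin> cball 0 R \<Longrightarrow> \<phi> x = 0" "\<And>x. x \<notin> {1<..} \<Longrightarrow> \<phi> x = 0" "\<And>x. x \<notin> {1<..} \<Longrightarrow> \<phi>' x = 0"
    "\<And>b x. partial_deriv b \<phi> x = \<phi>' x b" "continuous_on UNIV \<phi>"
    using test_funD[OF assms] by metis
  have c: "continuous_on UNIV (partial_deriv 1 \<phi>)"
    unfolding p(6) by (intro continuous_intros p)
  show "\<phi> \<in> borel_measurable borel" "partial_deriv 1 \<phi> \<in> borel_measurable borel"
    by (intro borel_measurable_continuous_onI p c)+
  have *: "(\<integral>\<^sup>+r. ennreal ((h r)\<^sup>2) \<partial>ray) < \<infinity>" if h: "continuous_on UNIV h" "\<And>x. x \<notin> cball 0 R \<Longrightarrow> h x = 0" for h :: "real \<Rightarrow> real"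
  proof -
    have "integrable lborel (\<lambda>x. indicator (cball 0 R) x *\<^sub>R (h x)\<^sup>2)"
      by (intro borel_integrable_compact continuous_intros continuous_on_subset[OF h(1)]) auto
    also have "(\<lambda>x. indicator (cball 0 R) x *\<^sub>R (h x)\<^sup>2) = (\<lambda>x. (h x)\<^sup>2)"
    proof
      fix x show "indicator (cball 0 R) x *\<^sub>R (h x)\<^sup>2 = (h x)\<^sup>2"
        using h(2)[of x] by (cases "x \<in> cball 0 R") auto
    qed
    finally have "(\<integral>\<^sup>+r. ennreal ((h r)\<^sup>2) \<partial>lborel) < \<infinity>" by (simp add: integrable_iff_bounded)
    moreover have "(\<integral>\<^sup>+r. ennreal ((h r)\<^sup>2) \<partial>ray) \<le> (\<integral>\<^sup>+r. ennreal ((h r)\<^sup>2) \<partial>lborel)"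
      unfolding nn_integral_ray by (intro nn_integral_mono) (auto simp: indicator_def)
    ultimately show ?thesis by (rule le_less_trans[rotated])
  qed
  show "(\<integral>\<^sup>+r. ennreal ((\<phi> r)\<^sup>2) \<partial>ray) < \<infinity>" by (rule *[OF p(7,3)])
  have "partial_deriv 1 \<phi> x = 0" if "x \<notin> cball 0 R" for x
    unfolding p(6) using C1_zero_derivative_outside[OF p(1,3) closed_cball that] by simp
  then show "(\<integral>\<^sup>+r. ennreal ((partial_deriv 1 \<phi> r)\<^sup>2) \<partial>ray) < \<infinity>" by (rule *[OF c])
qed

text \<open>The product of \<phi> and V is C1 with compact support, so its derivative has integral
  0.\<close>

lemma integration_by_parts_ray:
  fixes V :: "real \<Rightarrow> 'b::euclidean_space"
  assumes \<phi>: "test_fun {1<..} \<phi>" and V: "\<And>r. (V has_vector_derivative V' r) (at r)" "continuous_on UNIV V'"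
  shows "integrable ray (\<lambda>r. partial_deriv 1 \<phi> r *\<^sub>R V r)" "integrable ray (\<lambda>r. \<phi> r *\<^sub>R V' r)"
    "(\<integral>r. partial_deriv 1 \<phi> r *\<^sub>R V r \<partial>ray) = - (\<integral>r. \<phi> r *\<^sub>R V' r \<partial>ray)"
proof -
  obtain \<phi>' R where p: "\<And>x. (\<phi> has_derivative blinfun_apply (\<phi>' x)) (at x)" "continuous_on UNIV \<phi>'"
    "\<And>x. x \<notin> cball 0 R \<Longrightarrow> \<phi> x = 0" "\<And>x. x \<notin> {1<..} \<Longrightarrow> \<phi> x = 0" "\<And>x. x \<notin> {1<..} \<Longrightarrow> \<phi>' x = 0"
    "\<And>b x. partial_deriv b \<phi> x = \<phi>' x b" "continuous_on UNIV \<phi>"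
    using test_funD[OF \<phi>] by metis
  have Vc: "continuous_on UNIV V"
    using V(1) by (intro continuous_at_imp_continuous_on ballI has_vector_derivative_continuous) auto
  have z: "\<phi>' x = 0" if "x \<notin> cball 0 R" for x
    using C1_zero_derivative_outside[OF p(1,3) closed_cball that] .
  have *: "integrable ray h \<and> (\<integral>r. h r \<partial>ray) = (\<integral>r. h r \<partial>lborel)"
    if h: "continuous_on UNIV h" "\<And>x. x \<notin> cball 0 R \<Longrightarrow> h x = 0" "\<And>x. x \<notin> {1<..} \<Longrightarrow> h x = 0" for h :: "real \<Rightarrow> 'b"
  proof -
    have "integrable lborel (\<lambda>x. indicator (cball 0 R) x *\<^sub>R h x)"
      by (intro borel_integrable_compact continuous_intros continuous_on_subset[OF h(1)]) auto
    also have "(\<lambda>x. indicator (cball 0 R) x *\<^sub>R h x) = h"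
      using h(2) by (auto simp: indicator_def)
    finally have "integrable lborel h" .
    moreover have "(\<lambda>x. indicator {1<..} x *\<^sub>R h x) = h"
      using h(3) by (auto simp: indicator_def)
    ultimately show ?thesis by (simp add: integral_ray)
  qed
  have 1: "integrable ray (\<lambda>r. \<phi>' r 1 *\<^sub>R V r) \<and> (\<integral>r. \<phi>' r 1 *\<^sub>R V r \<partial>ray) = (\<integral>r. \<phi>' r 1 *\<^sub>R V r \<partial>lborel)"
    by (rule *) (use z p(5) in \<open>auto intro!: continuous_intros p Vc\<close>)
  have 2: "integrable ray (\<lambda>r. \<phi> r *\<^sub>R V' r) \<and> (\<integral>r. \<phi> r *\<^sub>R V' r \<partial>ray) = (\<integral>r. \<phi> r *\<^sub>R V' r \<partial>lborel)"
    by (rule *) (use p in \<open>auto intro!: continuous_intros p V\<close>)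
  have 3: "integrable ray (\<lambda>r. \<phi>' r 1 *\<^sub>R V r + \<phi> r *\<^sub>R V' r) \<and>
      (\<integral>r. \<phi>' r 1 *\<^sub>R V r + \<phi> r *\<^sub>R V' r \<partial>ray) = (\<integral>r. \<phi>' r 1 *\<^sub>R V r + \<phi> r *\<^sub>R V' r \<partial>lborel)"
    by (rule *) (use z p in \<open>auto intro!: continuous_intros p V Vc\<close>)
  show "integrable ray (\<lambda>r. partial_deriv 1 \<phi> r *\<^sub>R V r)" "integrable ray (\<lambda>r. \<phi> r *\<^sub>R V' r)"
    using 1 2 by (simp_all add: p(6))
  define \<psi>' where "\<psi>' r = blinfun_scaleR_left (\<phi> r *\<^sub>R V' r + \<phi>' r 1 *\<^sub>R V r)" for r
  have d: "((\<lambda>r. \<phi> r *\<^sub>R V r) has_derivative blinfun_apply (\<psi>' r)) (at r)" for r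
  proof -
    have "(\<phi> has_vector_derivative \<phi>' r 1) (at r)"
    proof -
      have "blinfun_apply (\<phi>' r) = (\<lambda>h. h *\<^sub>R \<phi>' r 1)"
      proof
        fix h show "\<phi>' r h = h *\<^sub>R \<phi>' r 1"
          using blinfun.scaleR_right[of "\<phi>' r" h 1] by simp
      qed
      then show ?thesis using p(1)[of r] by (simp add: has_vector_derivative_def)
    qed
    note bounded_bilinear.has_vector_derivative[OF bounded_bilinear_scaleR this V(1)[of r]]
    then show ?thesis
      unfolding \<psi>'_def has_vector_derivative_eq_has_derivative_blinfun .
  qed
  have "(\<integral>r. \<psi>' r 1 \<partial>lborel) = 0"
    by (rule C1_compact_support_integral(2)[OF d, of R])
      (use p in \<open>auto simp: \<psi>'_def intro!: continuous_intros p V Vc\<close>)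
  then have "(\<integral>r. \<phi>' r 1 *\<^sub>R V r + \<phi> r *\<^sub>R V' r \<partial>ray) = 0"
    using 3 by (simp add: \<psi>'_def add.commute)
  also have "(\<integral>r. \<phi>' r 1 *\<^sub>R V r + \<phi> r *\<^sub>R V' r \<partial>ray) = (\<integral>r. \<phi>' r 1 *\<^sub>R V r \<partial>ray) + (\<integral>r. \<phi> r *\<^sub>R V' r \<partial>ray)"
    using 1 2 by (intro Bochner_Integration.integral_add) auto
  finally show "(\<integral>r. partial_deriv 1 \<phi> r *\<^sub>R V r \<partial>ray) = - (\<integral>r. \<phi> r *\<^sub>R V' r \<partial>ray)"
    by (simp add: p(6) eq_neg_iff_add_eq_0)
qed

lemma completion_ex_borel_measurable_euclidean:
  fixes g :: "'a \<Rightarrow> 'b::euclidean_space"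
  assumes g: "g \<in> borel_measurable (completion M)"
  shows "\<exists>g'\<in>borel_measurable M. AE x in M. g x = g' x"
proof -
  have "\<exists>h\<in>borel_measurable M. AE x in M. g x \<bullet> b = h x" for b
    by (rule completion_ex_borel_measurable_real) (use g in measurable)
  then obtain h where h: "\<And>b. h b \<in> borel_measurable M" "\<And>b. AE x in M. g x \<bullet> b = h b x"
    by metis
  have "AE x in M. \<forall>b\<in>Basis. g x \<bullet> b = h b x"
    using h(2) by (simp add: AE_finite_all)
  then have "AE x in M. g x = (\<Sum>b\<in>Basis. h b x *\<^sub>R b)"
    by eventually_elim (subst euclidean_representation[symmetric], auto intro!: sum.cong)
  then show ?thesis
    using h(1) by (intro bexI[of _ "\<lambda>x. \<Sum>b\<in>Basis. h b x *\<^sub>R b"]) auto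
qed

section \<open>Uniqueness of the weak derivative on the half-line\<close>

text \<open>Squaring removes the kink of the positive part, which makes polynomial bumps of class C1
  available.\<close>

lemma DERIV_max_sq: "((\<lambda>y::real. (max 0 y)\<^sup>2) has_real_derivative 2 * max 0 y) (at y)"
proof -
  consider "y > 0" | "y < 0" | "y = 0" by linarith
  then show ?thesis
  proof cases
    case 1
    have "((\<lambda>y::real. y\<^sup>2) has_real_derivative 2 * max 0 y) (at y)"
      using 1 by (auto intro!: derivative_eq_intros)
    then show ?thesis
      by (rule has_field_derivative_transform_within_open[where S="{0<..}"]) (use 1 in auto)
  next
    case 2
    have "((\<lambda>y::real. 0) has_real_derivative 2 * max 0 y) (at y)"
      using 2 by (auto intro!: derivative_eq_intros)
    then show ?thesis
      by (rule has_field_derivative_transform_within_open[where S="{..<0}"]) (use 2 in auto)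
  next
    case 3
    have "((\<lambda>h::real. max 0 h * (max 0 h / h)) \<longlongrightarrow> 0) (at 0)"
    proof (rule Lim_null_comparison)
      show "eventually (\<lambda>h. norm (max 0 h * (max 0 h / h)) \<le> \<bar>h\<bar>) (at (0::real))"
        by (intro always_eventually allI) (auto simp: max_def)
      show "((\<lambda>h::real. \<bar>h\<bar>) \<longlongrightarrow> 0) (at 0)"
        by (intro tendsto_rabs_zero tendsto_ident_at)
    qed
    then show ?thesis using 3 by (simp add: DERIV_def power2_eq_square)
  qed
qed

text \<open>With p of class C1 and positive exactly on the interval, p / (p + 1/(k+1)) tends to the
  indicator and stays below it. Its support is the closed interval, compact in the half-line because
  a > 1.\<close>

lemma test_fun_interval_approx:
  fixes a b :: real
  assumes ab: "1 < a" "a < b"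
  obtains \<phi> :: "nat \<Rightarrow> real \<Rightarrow> real" where "\<And>k. test_fun {1<..} (\<phi> k)"
    "\<And>k x. \<bar>\<phi> k x\<bar> \<le> indicator {a<..<b} x" "\<And>x. (\<lambda>k. \<phi> k x) \<longlonglongrightarrow> indicator {a<..<b} x"
proof -
  define p where "p x = (max 0 ((x - a) * (b - x)))\<^sup>2" for x
  define p' where "p' x = 2 * max 0 ((x - a) * (b - x)) * (a + b - 2 * x)" for x
  define \<phi> where "\<phi> k x = p x / (p x + 1 / real (Suc k))" for k x
  have dp: "(p has_real_derivative p' x) (at x)" for x
  proof -
    have "((\<lambda>x. (x - a) * (b - x)) has_real_derivative (a + b - 2 * x)) (at x)"
      by (auto intro!: derivative_eq_intros)
    from DERIV_chain2[OF DERIV_max_sq this] show ?thesis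
      unfolding p_def p'_def .
  qed
  have p0: "0 \<le> p x" for x by (simp add: p_def)
  have pos: "0 < p x + 1 / real (Suc k)" for x k
    using p0[of x] by (intro add_nonneg_pos) auto
  have ppos: "0 < p x \<longleftrightarrow> x \<in> {a<..<b}" for x
  proof -
    have "0 < (max 0 z)\<^sup>2 \<longleftrightarrow> 0 < z" for z :: real by (cases "0 < z") (auto simp: max_def)
    then have "0 < p x \<longleftrightarrow> 0 < (x - a) * (b - x)" by (simp only: p_def)
    also have "\<dots> \<longleftrightarrow> x \<in> {a<..<b}" using ab by (auto simp: zero_less_mult_iff)
    finally show ?thesis .
  qed
  have pz: "x \<notin> {a<..<b} \<Longrightarrow> p x = 0" for x
    using ppos[of x] p0[of x] by linarith
  define \<phi>' where "\<phi>' k x = (p' x * (p x + 1 / real (Suc k)) - p x * p' x) / (p x + 1 / real (Suc k))\<^sup>2" for k x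
  have d\<phi>: "(\<phi> k has_real_derivative \<phi>' k x) (at x)" for k x
  proof -
    have "p x + 1 / real (Suc k) \<noteq> 0" using pos[of x k] by simp
    moreover have "((\<lambda>x. p x + 1 / real (Suc k)) has_real_derivative p' x) (at x)"
      by (auto intro!: derivative_eq_intros dp)
    ultimately show ?thesis
      unfolding \<phi>_def \<phi>'_def power2_eq_square by (intro DERIV_divide dp)
  qed
  have cp: "continuous_on UNIV p" using dp by (intro DERIV_continuous_on) auto
  have c\<phi>: "continuous_on UNIV (\<phi>' k)" for k
  proof -
    have "(p x + 1 / real (Suc k))\<^sup>2 \<noteq> 0" for x using pos[of x k] by simp
    then show ?thesis unfolding \<phi>'_def p'_def by (intro continuous_intros cp) auto
  qed
  have ne: "{x. \<phi> k x \<noteq> 0} = {a<..<b}" for k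
  proof -
    have "\<phi> k x \<noteq> 0 \<longleftrightarrow> x \<in> {a<..<b}" for x
    proof -
      have "\<phi> k x \<noteq> 0 \<longleftrightarrow> 0 < p x" using pos[of x k] p0[of x] by (auto simp: \<phi>_def)
      then show ?thesis by (simp only: ppos)
    qed
    then show ?thesis by (intro set_eqI) (simp only: mem_Collect_eq)
  qed
  show thesis
  proof (rule that[of \<phi>])
    fix k x
    have "C1_fun (\<phi> k)"
      unfolding C1_fun_def using d\<phi>[of k] c\<phi>[of k]
      by (intro exI[of _ "\<lambda>x. blinfun_scaleR_left (\<phi>' k x)"])
        (auto simp: has_real_derivative_iff_has_vector_derivative has_vector_derivative_eq_has_derivative_blinfun
          intro!: continuous_intros)
    moreover have "closure {x. \<phi> k x \<noteq> 0} = {a..b}" using ab ne by simp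
    ultimately show "test_fun {1<..} (\<phi> k)" using ab by (auto simp add: test_fun_def)
    show "\<bar>\<phi> k x\<bar> \<le> indicator {a<..<b} x"
      using pos[of x k] p0[of x] pz[of x] by (auto simp: \<phi>_def indicator_def)
    show "(\<lambda>k. \<phi> k x) \<longlonglongrightarrow> indicator {a<..<b} x"
    proof (cases "x \<in> {a<..<b}")
      case True
      have "(\<lambda>k. p x / (p x + 1 / real (Suc k))) \<longlonglongrightarrow> p x / (p x + 0)"
        using True ppos[of x] LIMSEQ_Suc[OF lim_1_over_n] by (intro tendsto_intros) auto
      then show ?thesis using True ppos[of x] by (simp add: \<phi>_def)
    next
      case False
      then show ?thesis using pz[of x] by (simp add: \<phi>_def)
    qed
  qed
qed

text \<open>\<open>weak_gradient\<close> is an arbitrary choice, so a computed derivative can be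
  identified with it only through uniqueness. The difference of two candidates annihilates all test
  functions and therefore, by approximation, has integral 0 over every bounded interval that starts
  beyond 1.\<close>

lemma weak_gradient_ray_unique:
  fixes u :: "real \<Rightarrow> 'b::euclidean_space"
  assumes G: "has_weak_gradient {1<..} u G1" "has_weak_gradient {1<..} u G2"
  shows "AE r in lebesgue. 1 < r \<longrightarrow> G1 1 r = G2 1 r"
proof -
  let ?L = "lebesgue_on {1<..} :: real measure"
  have L: "{1<..} \<inter> space lebesgue \<in> sets (lebesgue :: real measure)" by simp
  have G': "L2_fun ?L (G1 1)" "L2_fun ?L (G2 1)"
    using G by (auto simp: has_weak_gradient_def)
  define D where "D r = G1 1 r - G2 1 r" for r
  have "(\<lambda>r. indicator {1<..} r *\<^sub>R D r) \<in> borel_measurable lebesgue"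
    using G' by (subst borel_measurable_restrict_space_iff[OF L, symmetric]) (auto simp: L2_fun_def D_def[abs_def])
  \<comment> \<open>The candidates are only Lebesgue measurable; their difference, extended by 0, is
    replaced by a Borel function.\<close>
  then obtain D' where D'0: "D' \<in> borel_measurable lborel" and
    D'eq: "AE r in lborel. indicator {1<..} r *\<^sub>R D r = D' r"
    using completion_ex_borel_measurable_euclidean by blast
  have D'[measurable]: "D' \<in> borel_measurable borel" using D'0 by simp
  have D'eq': "AE r in lebesgue. indicator {1<..} r *\<^sub>R D r = D' r"
    using D'eq by (rule AE_completion)
  have "L2_fun ?L D"
  proof -
    have "integrable ?L (\<lambda>r. 2 * (norm (G1 1 r))\<^sup>2 + 2 * (norm (G2 1 r))\<^sup>2)"
      using G' by (auto simp: L2_fun_def)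
    then have "integrable ?L (\<lambda>r. (norm (D r))\<^sup>2)"
    proof (rule Bochner_Integration.integrable_bound)
      show "(\<lambda>r. (norm (D r))\<^sup>2) \<in> borel_measurable ?L"
      proof -
        have [measurable]: "G1 1 \<in> borel_measurable ?L" "G2 1 \<in> borel_measurable ?L"
          using G' by (auto simp: L2_fun_def)
        show ?thesis unfolding D_def by measurable
      qed
      have "(norm (x - y))\<^sup>2 \<le> 2 * (norm x)\<^sup>2 + 2 * (norm y)\<^sup>2" for x y :: 'b
      proof -
        have "(norm (x - y))\<^sup>2 \<le> (norm x + norm y)\<^sup>2"
          by (intro power_mono norm_triangle_ineq4) auto
        also have "\<dots> \<le> 2 * (norm x)\<^sup>2 + 2 * (norm y)\<^sup>2"
          using zero_le_power2[of "norm x - norm y"] by (simp add: power2_sum power2_diff)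
        finally show ?thesis .
      qed
      then show "AE r in ?L. norm ((norm (D r))\<^sup>2) \<le> norm (2 * (norm (G1 1 r))\<^sup>2 + 2 * (norm (G2 1 r))\<^sup>2)"
        by (intro AE_I2) (simp add: D_def)
    qed
    then show ?thesis using G' by (auto simp: L2_fun_def D_def[abs_def])
  qed
  then have "integrable lebesgue (\<lambda>r. indicator {1<..} r *\<^sub>R (norm (D r))\<^sup>2)"
    unfolding L2_fun_def integrable_restrict_space[OF L] by simp
  moreover have "(\<lambda>r. (norm (D' r))\<^sup>2) \<in> borel_measurable lebesgue"
    by (intro measurable_completion) measurable
  moreover have "AE r in lebesgue. indicator {1<..} r *\<^sub>R (norm (D r))\<^sup>2 = (norm (D' r))\<^sup>2"
    using D'eq' by eventually_elim (auto simp: indicator_def split: if_splits)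
  ultimately have "integrable lebesgue (\<lambda>r. (norm (D' r))\<^sup>2)"
    by (rule integrable_cong_AE_imp)
  then have D'2: "integrable lborel (\<lambda>r. (norm (D' r))\<^sup>2)"
    by (subst (asm) integrable_completion) auto
  have zero: "(\<integral>r. \<phi> r *\<^sub>R D' r \<partial>lborel) = 0" if \<phi>: "test_fun {1<..} \<phi>" for \<phi>
  proof -
    have m: "\<phi> \<in> borel_measurable borel" "(\<integral>\<^sup>+r. ennreal ((\<phi> r)\<^sup>2) \<partial>ray) < \<infinity>"
      using test_fun_ray[OF \<phi>] by auto
    have "integrable ray (\<lambda>r. (\<phi> r)\<^sup>2)"
      using m by (simp add: integrable_iff_bounded)
    then have i: "integrable ?L (\<lambda>r. (\<phi> r)\<^sup>2)"
      using m by (subst integral_lebesgue_on_ray(2)) auto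
    have m': "\<phi> \<in> borel_measurable ?L"
      using m(1) by (intro measurable_restrict_space1 measurable_completion) simp
    note int = L2_fun_integrable_mult[OF G'(1) m' i] L2_fun_integrable_mult[OF G'(2) m' i]
    have "(LINT r|?L. \<phi> r *\<^sub>R G1 1 r) = (LINT r|?L. \<phi> r *\<^sub>R G2 1 r)"
    proof -
      have "(LINT r|?L. partial_deriv 1 \<phi> r *\<^sub>R u r) = - (LINT r|?L. \<phi> r *\<^sub>R G1 1 r)"
        "(LINT r|?L. partial_deriv 1 \<phi> r *\<^sub>R u r) = - (LINT r|?L. \<phi> r *\<^sub>R G2 1 r)"
        using G \<phi> unfolding has_weak_gradient_def Basis_real_def by blast+
      then show ?thesis by (metis neg_equal_iff_equal)
    qed
    then have "(LINT r|?L. \<phi> r *\<^sub>R D r) = 0"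
      using int by (simp add: D_def scaleR_diff_right Bochner_Integration.integral_diff)
    also have "(LINT r|?L. \<phi> r *\<^sub>R D r) = (LINT r|lebesgue. \<phi> r *\<^sub>R (indicator {1<..} r *\<^sub>R D r))"
      unfolding integral_restrict_space[OF L] by (simp add: mult.commute)
    also have "\<dots> = (LINT r|lebesgue. \<phi> r *\<^sub>R D' r)"
    proof (rule integral_cong_AE)
      show "(\<lambda>r. \<phi> r *\<^sub>R indicat_real {1<..} r *\<^sub>R D r) \<in> borel_measurable lebesgue"
      proof (rule borel_measurable_scaleR)
        show "\<phi> \<in> borel_measurable lebesgue" using m(1) by (intro measurable_completion) simp
      qed fact
      show "(\<lambda>r. \<phi> r *\<^sub>R D' r) \<in> borel_measurable lebesgue"
        using m(1) D' by (intro measurable_completion borel_measurable_scaleR) simp_all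
    qed (use D'eq' in \<open>eventually_elim, simp\<close>)
    also have "\<dots> = (\<integral>r. \<phi> r *\<^sub>R D' r \<partial>lborel)"
      using m(1) D' by (intro integral_completion borel_measurable_scaleR) simp_all
    finally show ?thesis .
  qed
  have loc: "integrable lborel (\<lambda>r. indicator {a<..<b} r *\<^sub>R D' r)" for a b :: real
  proof (rule L2_fun_integrable_mult)
    show "L2_fun lborel D'" using D'2 by (simp add: L2_fun_def)
    have "integrable lborel (indicat_real {a<..<b})"
      by (cases "a \<le> b") (auto intro!: integrable_real_indicator)
    moreover have "(\<lambda>x. (indicat_real {a<..<b} x)\<^sup>2) = indicat_real {a<..<b}" by (auto simp: indicator_def)
    ultimately show "integrable lborel (\<lambda>x. (indicat_real {a<..<b} x)\<^sup>2)" by simp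
  qed simp
  have int0: "(\<integral>r. indicator {a<..<b} r *\<^sub>R D' r \<partial>lborel) = 0" if "1 < a" for a b :: real
  proof (cases "a < b")
    case True
    obtain \<phi> :: "nat \<Rightarrow> real \<Rightarrow> real" where \<phi>: "\<And>k. test_fun {1<..} (\<phi> k)"
      "\<And>k x. \<bar>\<phi> k x\<bar> \<le> indicator {a<..<b} x" "\<And>x. (\<lambda>k. \<phi> k x) \<longlonglongrightarrow> indicator {a<..<b} x"
      using test_fun_interval_approx[OF \<open>1 < a\<close> True] by blast
    have [measurable]: "\<phi> k \<in> borel_measurable borel" for k
      using test_fun_ray(1)[OF \<phi>(1)] .
    have "(\<lambda>k. \<integral>r. \<phi> k r *\<^sub>R D' r \<partial>lborel) \<longlonglongrightarrow> (\<integral>r. indicator {a<..<b} r *\<^sub>R D' r \<partial>lborel)"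
    proof (rule integral_dominated_convergence[where w="\<lambda>r. norm (indicator {a<..<b} r *\<^sub>R D' r)"])
      show "integrable lborel (\<lambda>r. norm (indicator {a<..<b} r *\<^sub>R D' r))"
        using loc by (rule integrable_norm)
      show "AE r in lborel. (\<lambda>k. \<phi> k r *\<^sub>R D' r) \<longlonglongrightarrow> indicator {a<..<b} r *\<^sub>R D' r"
        by (intro AE_I2 tendsto_intros \<phi>)
      show "AE r in lborel. norm (\<phi> k r *\<^sub>R D' r) \<le> norm (indicator {a<..<b} r *\<^sub>R D' r)" for k
        unfolding norm_scaleR using \<phi>(2) by (intro AE_I2 mult_right_mono) (auto intro: order_trans)
    qed measurable
    then show ?thesis by (simp add: zero[OF \<phi>(1)] LIMSEQ_const_iff)
  qed simp
  \<comment> \<open>These intervals exhaust the half-line and stay at a positive distance from 1. On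
    each of them the function is integrable and its integrals over subintervals vanish.\<close>
  have "AE r in lborel. \<forall>n. indicator {1 + 1 / real (Suc n)<..<real n + 2} r *\<^sub>R D' r = 0"
    unfolding AE_all_countable
  proof
    fix n
    let ?a = "1 + 1 / real (Suc n)" and ?b = "real n + 2"
    show "AE r in lborel. indicator {?a<..<?b} r *\<^sub>R D' r = 0"
    proof (rule AE_eq_0_if_interval_integrals_eq_0[OF loc int0])
      show "1 < ?a" by simp
      fix c d :: real
      have "(LINT x:{c<..<d}|lborel. indicator {?a<..<?b} x *\<^sub>R D' x)
          = (\<integral>r. indicator {max ?a c<..<min ?b d} r *\<^sub>R D' r \<partial>lborel)"
        unfolding set_lebesgue_integral_def by (intro Bochner_Integration.integral_cong) (auto simp: indicator_def)
      also have "\<dots> = 0" by (rule int0) (simp add: less_max_iff_disj)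
      finally show "(LINT x:{c<..<d}|lborel. indicator {?a<..<?b} x *\<^sub>R D' x) = 0" .
    qed
  qed
  then have "AE r in lborel. 1 < r \<longrightarrow> D' r = 0"
  proof eventually_elim
    case (elim r)
    show ?case
    proof
      assume "1 < r"
      then have "0 < min (r - 1) (1 / r)" by simp
      then obtain n where "1 / real (Suc n) < min (r - 1) (1 / r)" using nat_approx_posE by blast
      then have "1 + 1 / real (Suc n) < r" "1 / real (Suc n) < 1 / r" by auto
      moreover from this have "r < real n + 2" using \<open>1 < r\<close> by (simp add: field_simps)
      ultimately show "D' r = 0" using elim[rule_format, of n] by (simp add: indicator_def)
    qed
  qed
  then have "AE r in lebesgue. 1 < r \<longrightarrow> D' r = 0" by (rule AE_completion)
  with D'eq' show ?thesis by eventually_elim (auto simp: D_def)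
qed

section \<open>Curves as limits of C1 curves in S0\<close>

definition S0_proj :: "real^3^3 \<Rightarrow> real^3^3" where
  "S0_proj A = (1/2) *\<^sub>R (A + transpose A) - (trace A / 3) *\<^sub>R mat 1"

lemma S0_proj_in: "S0_proj A \<in> S0"
  by (simp add: S0_def S0_proj_def vec_eq_iff transpose_def trace_def sum_3 mat_def field_simps)

lemma S0_proj_id: "Q \<in> S0 \<Longrightarrow> S0_proj Q = Q"
  by (simp add: S0_def S0_proj_def scaleR_2[symmetric])

lemma linear_S0_proj: "linear S0_proj"
  by (rule linearI) (simp_all add: S0_proj_def vec_eq_iff transpose_def trace_def sum_3 mat_def field_simps)

lemma bounded_linear_S0_proj: "bounded_linear S0_proj"
  using linear_S0_proj by (simp add: linear_conv_bounded_linear)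

lemma norm_S0_proj_le: "norm (S0_proj A) \<le> norm A"
proof -
  have "S0_proj A \<bullet> A = S0_proj A \<bullet> S0_proj A"
    by (simp add: S0_proj_def inner_vec_def sum_3 transpose_def trace_def mat_def field_simps)
  then have "(norm (S0_proj A))\<^sup>2 \<le> norm (S0_proj A) * norm A"
    using norm_cauchy_schwarz[of "S0_proj A" A] by (simp add: power2_norm_eq_inner)
  then show ?thesis by (cases "S0_proj A = 0") (auto simp: power2_eq_square)
qed

lemma closed_S0: "closed S0"
proof -
  have "S0 = {A. S0_proj A = A}"
  proof (rule set_eqI)
    fix A show "A \<in> S0 \<longleftrightarrow> A \<in> {A. S0_proj A = A}"
      using S0_proj_in[of A] S0_proj_id[of A] by auto
  qed
  moreover have "closed {A. S0_proj A = A}"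
    by (intro closed_Collect_eq linear_continuous_on bounded_linear_S0_proj continuous_on_id)
  ultimately show ?thesis by (simp only:)
qed

lemma S0_derivative:
  assumes W: "\<And>r. W r \<in> S0" and d: "(W has_vector_derivative H) (at r)"
  shows "H \<in> S0"
proof -
  have "((\<lambda>r. S0_proj (W r)) has_vector_derivative S0_proj H) (at r)"
    by (rule bounded_linear.has_vector_derivative[OF bounded_linear_S0_proj d])
  then have "S0_proj H = H"
    using d by (simp add: S0_proj_id[OF W] vector_derivative_unique_at)
  then show ?thesis using S0_proj_in[of H] by simp
qed

text \<open>What \<open>has_trace\<close> leaves on a single ray: convergence in H1 of the half-line
  together with convergence at its end point. Since the approximants are differentiable everywhere,
  classical calculus is done on them and then passed to the limit.\<close>

definition C1_approx :: "(real \<Rightarrow> real^3^3) \<Rightarrow> (real \<Rightarrow> real^3^3) \<Rightarrow>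
    (nat \<Rightarrow> real \<Rightarrow> real^3^3) \<Rightarrow> (nat \<Rightarrow> real \<Rightarrow> real^3^3) \<Rightarrow> bool" where
  "C1_approx q G W W' \<longleftrightarrow>
     (\<forall>k r. (W k has_vector_derivative W' k r) (at r)) \<and> (\<forall>k. continuous_on UNIV (W' k)) \<and>
     (\<forall>k r. W k r \<in> S0) \<and> (\<lambda>k. W k 1) \<longlonglongrightarrow> q 1 \<and>
     (\<lambda>k. \<integral>\<^sup>+r. ennreal ((norm (W k r - q r))\<^sup>2) \<partial>ray) \<longlonglongrightarrow> 0 \<and>
     (\<lambda>k. \<integral>\<^sup>+r. ennreal ((norm (W' k r - G r))\<^sup>2) \<partial>ray) \<longlonglongrightarrow> 0"

text \<open>In the following definition \<open>G\<close> is the derivative of \<open>q\<close> and \<open>q\<close> is determined only almost everywhere on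
  \<open>{1<..}\<close>; the value \<open>q 1\<close> is the trace.\<close>

definition H1_curve :: "(real \<Rightarrow> real^3^3) \<Rightarrow> (real \<Rightarrow> real^3^3) \<Rightarrow> bool" where
  "H1_curve q G \<longleftrightarrow> q \<in> borel_measurable borel \<and> G \<in> borel_measurable borel \<and>
     (\<integral>\<^sup>+r. ennreal ((norm (q r - Q_infty))\<^sup>2) \<partial>ray) < \<infinity> \<and>
     (\<integral>\<^sup>+r. ennreal ((norm (G r))\<^sup>2) \<partial>ray) < \<infinity> \<and> (\<exists>W W'. C1_approx q G W W')"

text \<open>The absolutely continuous representative. As \<open>ray\<close> begins at 1, the
  integral runs from 1 to r.\<close>

definition cont_rep :: "(real \<Rightarrow> real^3^3) \<Rightarrow> (real \<Rightarrow> real^3^3) \<Rightarrow> real \<Rightarrow> real^3^3" where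
  "cont_rep q G r = q 1 + (\<integral>s. indicator {..r} s *\<^sub>R G s \<partial>ray)"

lemma cont_rep_1: "cont_rep q G 1 = q 1"
proof -
  have "(\<integral>s. indicator {..1} s *\<^sub>R G s \<partial>ray) = (\<integral>s. 0 \<partial>ray)"
    by (rule Bochner_Integration.integral_cong) auto
  then show ?thesis by (simp add: cont_rep_def)
qed

lemma indicator_atMost_L2_ray: "(\<integral>\<^sup>+s. ennreal ((indicator {..T::real} s)\<^sup>2) \<partial>ray) < \<infinity>"
proof -
  have "(\<integral>\<^sup>+s. ennreal ((indicator {..T::real} s)\<^sup>2) \<partial>ray) \<le> (\<integral>\<^sup>+s. indicator {1..T} s \<partial>lborel)"
    unfolding nn_integral_ray by (intro nn_integral_mono) (auto simp: indicator_def)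
  also have "\<dots> < \<infinity>" by (cases "1 \<le> T") auto
  finally show ?thesis .
qed

lemma FTC_ray:
  fixes W :: "real \<Rightarrow> 'b::euclidean_space"
  assumes d: "\<And>r. (W has_vector_derivative W' r) (at r)" and c: "continuous_on UNIV W'" and r: "1 \<le> r"
  shows "integrable ray (\<lambda>s. indicator {..r} s *\<^sub>R W' s)"
    "W r = W 1 + (\<integral>s. indicator {..r} s *\<^sub>R W' s \<partial>ray)"
proof -
  have "has_bochner_integral lborel (\<lambda>s. indicator {1..r} s *\<^sub>R W' s) (W r - W 1)"
    using r d c by (intro has_bochner_integral_FTC_Icc)
      (auto intro: has_vector_derivative_at_within continuous_on_subset)
  moreover have "AE s in lborel. indicator {1..r} s *\<^sub>R W' s = indicator {1<..} s *\<^sub>R (indicator {..r} s *\<^sub>R W' s)"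
    using AE_lborel_singleton[of 1] by eventually_elim (auto simp: indicator_def)
  moreover have "W' \<in> borel_measurable borel" by (rule borel_measurable_continuous_onI[OF c])
  ultimately have "has_bochner_integral lborel (\<lambda>s. indicator {1<..} s *\<^sub>R (indicator {..r} s *\<^sub>R W' s)) (W r - W 1)"
    by (subst has_bochner_integral_cong_AE[symmetric]) auto
  then show "integrable ray (\<lambda>s. indicator {..r} s *\<^sub>R W' s)"
    "W r = W 1 + (\<integral>s. indicator {..r} s *\<^sub>R W' s \<partial>ray)"
    by (auto simp: integral_ray has_bochner_integral_iff)
qed

text \<open>By the fundamental theorem and Cauchy-Schwarz on the bounded interval, L2 convergence of
  the derivatives and convergence at 1 control the distance uniformly.\<close>

lemma C1_approx_uniform_limit:
  assumes G[measurable]: "G \<in> borel_measurable borel" and G2: "(\<integral>\<^sup>+r. ennreal ((norm (G r))\<^sup>2) \<partial>ray) < \<infinity>"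
    and W: "C1_approx q G W W'"
  shows "uniform_limit {1..T} W (cont_rep q G) sequentially"
proof (rule uniform_limitI)
  fix e :: real assume e: "0 < e"
  have d: "(W k has_vector_derivative W' k r) (at r)" and c: "continuous_on UNIV (W' k)" for k r
    using W by (auto simp: C1_approx_def)
  have [measurable]: "W' k \<in> borel_measurable borel" for k by (rule borel_measurable_continuous_onI[OF c])
  define X where "X k = (\<integral>\<^sup>+s. ennreal (indicator {..T} s) * ennreal (norm (W' k s - G s)) \<partial>ray)" for k
  have intG: "integrable ray (\<lambda>s. indicator {..r} s *\<^sub>R G s)" for r
    by (rule L2_integrable_mult) (use indicator_atMost_L2_ray G2 in auto)
  have le: "ennreal (norm (W k r - cont_rep q G r)) \<le> ennreal (norm (W k 1 - q 1)) + X k" if r: "r \<in> {1..T}" for k r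
  proof -
    have F: "W k r = W k 1 + (\<integral>s. indicator {..r} s *\<^sub>R W' k s \<partial>ray)" "integrable ray (\<lambda>s. indicator {..r} s *\<^sub>R W' k s)"
      using FTC_ray[OF d c, of r] r by auto
    have "W k r - cont_rep q G r = (W k 1 - q 1) + (\<integral>s. indicator {..r} s *\<^sub>R W' k s - indicator {..r} s *\<^sub>R G s \<partial>ray)"
      using F intG[of r] by (simp add: cont_rep_def Bochner_Integration.integral_diff)
    then have "norm (W k r - cont_rep q G r) \<le> norm (W k 1 - q 1)
        + norm (\<integral>s. indicator {..r} s *\<^sub>R W' k s - indicator {..r} s *\<^sub>R G s \<partial>ray)"
      by (simp only: norm_triangle_ineq)
    then have "ennreal (norm (W k r - cont_rep q G r)) \<le> ennreal (norm (W k 1 - q 1))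
        + ennreal (norm (\<integral>s. indicator {..r} s *\<^sub>R W' k s - indicator {..r} s *\<^sub>R G s \<partial>ray))"
      by (simp flip: ennreal_plus)
    also have "ennreal (norm (\<integral>s. indicator {..r} s *\<^sub>R W' k s - indicator {..r} s *\<^sub>R G s \<partial>ray))
        \<le> (\<integral>\<^sup>+s. norm (indicator {..r} s *\<^sub>R W' k s - indicator {..r} s *\<^sub>R G s) \<partial>ray)"
      using F(2) intG[of r] by (intro integral_norm_bound_ennreal) auto
    also have "\<dots> \<le> X k"
      unfolding X_def using r by (intro nn_integral_mono) (auto simp: indicator_def)
    finally show ?thesis by (simp add: add_left_mono)
  qed
  have "(X k)\<^sup>2 \<le> (\<integral>\<^sup>+s. ennreal ((indicator {..T} s)\<^sup>2) \<partial>ray) * (\<integral>\<^sup>+s. ennreal ((norm (W' k s - G s))\<^sup>2) \<partial>ray)" for k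
    using Cauchy_Schwarz_nn_integral[of "\<lambda>s. ennreal (indicator {..T} s)" ray "\<lambda>s. ennreal (norm (W' k s - G s))"]
    by (simp add: X_def ennreal_power)
  moreover have "(\<lambda>k. (\<integral>\<^sup>+s. ennreal ((indicator {..T} s)\<^sup>2) \<partial>ray) * (\<integral>\<^sup>+s. ennreal ((norm (W' k s - G s))\<^sup>2) \<partial>ray))
      \<longlonglongrightarrow> (\<integral>\<^sup>+s. ennreal ((indicator {..T} s)\<^sup>2) \<partial>ray) * 0"
    using indicator_atMost_L2_ray[of T] W
    by (intro tendsto_mult_ennreal tendsto_const) (auto simp: C1_approx_def)
  ultimately have "(\<lambda>k. (X k)\<^sup>2) \<longlonglongrightarrow> 0"
    by (intro tendsto_sandwich[where f="\<lambda>_. 0" and g="\<lambda>k. (X k)\<^sup>2" and net=sequentially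
        and h="\<lambda>k. (\<integral>\<^sup>+s. ennreal ((indicator {..T} s)\<^sup>2) \<partial>ray) * (\<integral>\<^sup>+s. ennreal ((norm (W' k s - G s))\<^sup>2) \<partial>ray)"]
        always_eventually allI) simp_all
  then have "X \<longlonglongrightarrow> 0" by (rule ennreal_tendsto_0_if_square)
  moreover have "(\<lambda>k. ennreal (norm (W k 1 - q 1))) \<longlonglongrightarrow> ennreal 0"
  proof (rule tendsto_ennrealI)
    have "(\<lambda>k. W k 1) \<longlonglongrightarrow> q 1" using W by (simp add: C1_approx_def)
    then show "(\<lambda>k. norm (W k 1 - q 1)) \<longlonglongrightarrow> 0" by (rule tendsto_norm_zero[OF LIM_zero])
  qed
  ultimately have "(\<lambda>k. ennreal (norm (W k 1 - q 1)) + X k) \<longlonglongrightarrow> ennreal 0 + 0"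
    by (intro tendsto_add)
  then have "eventually (\<lambda>k. ennreal (norm (W k 1 - q 1)) + X k < ennreal e) sequentially"
    using e by (intro order_tendstoD(2)) auto
  then show "\<forall>\<^sub>F k in sequentially. \<forall>r\<in>{1..T}. dist (W k r) (cont_rep q G r) < e"
  proof eventually_elim
    case (elim k)
    show ?case
    proof
      fix r assume r: "r \<in> {1..T}"
      have "ennreal (norm (W k r - cont_rep q G r)) < ennreal e"
        using le[OF r] elim by (rule le_less_trans)
      then show "dist (W k r) (cont_rep q G r) < e"
        using e by (simp add: dist_norm ennreal_less_iff)
    qed
  qed
qed

text \<open>Locally uniform limits inherit continuity and the closed constraint S0. Fatou's lemma,
  applied to the L2 distances to q, shows that the limit is q almost everywhere.\<close>

lemma cont_rep_properties:
  assumes q[measurable]: "q \<in> borel_measurable borel" and G[measurable]: "G \<in> borel_measurable borel"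
    and G2: "(\<integral>\<^sup>+r. ennreal ((norm (G r))\<^sup>2) \<partial>ray) < \<infinity>"
    and W: "C1_approx q G W W'"
  shows "continuous_on {1..} (cont_rep q G)" "\<And>r. 1 \<le> r \<Longrightarrow> cont_rep q G r \<in> S0"
    "AE r in ray. cont_rep q G r = q r"
proof -
  have d: "(W k has_vector_derivative W' k r) (at r)" and c: "continuous_on UNIV (W' k)" for k r
    using W by (auto simp: C1_approx_def)
  have Wc: "continuous_on A (W k)" for A k
    using d by (intro continuous_at_imp_continuous_on ballI has_vector_derivative_continuous) auto
  have [measurable]: "W k \<in> borel_measurable borel" for k by (rule borel_measurable_continuous_onI[OF Wc])
  note u = C1_approx_uniform_limit[OF G G2 W]
  have lim: "(\<lambda>k. W k r) \<longlonglongrightarrow> cont_rep q G r" if "1 \<le> r" for r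
    using tendsto_uniform_limitI[OF u[of r], of r] that by simp
  show "cont_rep q G r \<in> S0" if "1 \<le> r" for r
    using W by (intro closed_sequentially[OF closed_S0 _ lim[OF that]]) (auto simp: C1_approx_def)
  have cT: "continuous_on {1..T} (cont_rep q G)" for T
    by (rule uniform_limit_theorem[OF _ u]) (auto intro!: always_eventually Wc)
  show "continuous_on {1..} (cont_rep q G)"
    unfolding continuous_on_eq_continuous_within
  proof
    fix r :: real assume r: "r \<in> {1..}"
    have "at r within {1..} = at r within {1..r + 1}"
      by (rule at_within_nhd[of r "{..<r + 1}"]) auto
    then show "continuous (at r within {1..}) (cont_rep q G)"
      using cT[of "r + 1"] r unfolding continuous_on_eq_continuous_within continuous_within by auto
  qed
  have m: "(\<lambda>r. cont_rep q G r) \<in> borel_measurable ray"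
  proof (rule borel_measurable_LIMSEQ_metric[where f=W])
    show "W k \<in> borel_measurable ray" for k by measurable
  qed (use lim in auto)
  have "(\<integral>\<^sup>+r. ennreal ((norm (cont_rep q G r - q r))\<^sup>2) \<partial>ray)
     = (\<integral>\<^sup>+r. liminf (\<lambda>k. ennreal ((norm (W k r - q r))\<^sup>2)) \<partial>ray)"
  proof (rule nn_integral_cong)
    fix r assume "r \<in> space ray"
    then have "(\<lambda>k. ennreal ((norm (W k r - q r))\<^sup>2)) \<longlonglongrightarrow> ennreal ((norm (cont_rep q G r - q r))\<^sup>2)"
      by (intro tendsto_ennrealI tendsto_intros lim) auto
    then show "ennreal ((norm (cont_rep q G r - q r))\<^sup>2) = liminf (\<lambda>k. ennreal ((norm (W k r - q r))\<^sup>2))"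
      using lim_imp_Liminf[OF sequentially_bot] by metis
  qed
  also have "\<dots> \<le> liminf (\<lambda>k. \<integral>\<^sup>+r. ennreal ((norm (W k r - q r))\<^sup>2) \<partial>ray)"
    by (rule nn_integral_liminf) measurable
  also have "\<dots> = 0"
    using W by (intro lim_imp_Liminf) (auto simp: C1_approx_def)
  finally have "(\<integral>\<^sup>+r. ennreal ((norm (cont_rep q G r - q r))\<^sup>2) \<partial>ray) = 0" by simp
  then have "AE r in ray. ennreal ((norm (cont_rep q G r - q r))\<^sup>2) = 0"
    by (subst (asm) nn_integral_0_iff_AE) (use m in measurable)
  then show "AE r in ray. cont_rep q G r = q r"
    by eventually_elim (simp flip: ennreal_0)
qed

lemma AE_lebesgue_if_AE_ray: "AE r in ray. P r \<Longrightarrow> AE r in lebesgue. 1 < r \<longrightarrow> P r"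
  unfolding AE_ray by (rule AE_completion)

text \<open>Integration by parts is exact for the approximants, and both sides are L2 pairings with
  a fixed function, hence stable in the limit.\<close>

lemma has_weak_gradient_cont_rep:
  assumes H: "H1_curve q G"
  shows "has_weak_gradient {1<..} (\<lambda>r. cont_rep q G r - Q_infty) (\<lambda>_. G)"
    "L2_fun (lebesgue_on {1<..}) (\<lambda>r. cont_rep q G r - Q_infty)"
proof -
  have m[measurable]: "q \<in> borel_measurable borel" "G \<in> borel_measurable borel"
    and q2: "(\<integral>\<^sup>+r. ennreal ((norm (q r - Q_infty))\<^sup>2) \<partial>ray) < \<infinity>"
    and G2: "(\<integral>\<^sup>+r. ennreal ((norm (G r))\<^sup>2) \<partial>ray) < \<infinity>"
    using H by (auto simp: H1_curve_def)
  obtain W W' where W: "C1_approx q G W W'" using H by (auto simp: H1_curve_def)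
  have d: "(W k has_vector_derivative W' k r) (at r)" and c: "continuous_on UNIV (W' k)" for k r
    using W by (auto simp: C1_approx_def)
  have Wc: "continuous_on UNIV (W k)" for k
    using d by (intro continuous_at_imp_continuous_on ballI has_vector_derivative_continuous) auto
  have [measurable]: "W k \<in> borel_measurable borel" "W' k \<in> borel_measurable borel" for k
    by (intro borel_measurable_continuous_onI Wc c)+
  note rep = cont_rep_properties[OF m G2 W]
  \<comment> \<open>Continuity is known on {1..} only; composing with the maximum makes it global,
    and Borel measurability follows.\<close>
  define p where "p r = cont_rep q G (max 1 r)" for r
  have "continuous_on UNIV p"
    unfolding p_def by (rule continuous_on_compose2[OF rep(1)]) (auto intro!: continuous_intros)
  then have p[measurable]: "p \<in> borel_measurable borel" by (rule borel_measurable_continuous_onI)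
  have pr: "p r = cont_rep q G r" if "1 \<le> r" for r using that by (simp add: p_def max_def)
  have pq: "AE r in ray. p r = q r"
  proof -
    have "AE r in ray. 1 < r" by (simp add: AE_ray)
    with rep(3) show ?thesis by eventually_elim (simp add: pr)
  qed
  have cong: "L2_fun (lebesgue_on {1<..}) u \<longleftrightarrow> u \<in> borel_measurable (lebesgue_on {1<..}) \<and> integrable ray (\<lambda>r. (norm (u r))\<^sup>2)"
    if "u \<in> borel_measurable borel" for u :: "real \<Rightarrow> real^3^3"
    unfolding L2_fun_def using that by (subst integral_lebesgue_on_ray(2)) auto
  have bm: "u \<in> borel_measurable (lebesgue_on {1<..})" if "u \<in> borel_measurable borel" for u :: "real \<Rightarrow> real^3^3"
    using that by (intro measurable_restrict_space1 measurable_completion) simp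
  have "L2_fun (lebesgue_on {1<..}) (\<lambda>r. p r - Q_infty)"
  proof (subst cong)
    have "(\<integral>\<^sup>+r. ennreal ((norm (p r - Q_infty))\<^sup>2) \<partial>ray) = (\<integral>\<^sup>+r. ennreal ((norm (q r - Q_infty))\<^sup>2) \<partial>ray)"
      by (rule nn_integral_cong_AE) (use pq in \<open>eventually_elim, simp\<close>)
    then show "(\<lambda>r. p r - Q_infty) \<in> borel_measurable (lebesgue_on {1<..}) \<and> integrable ray (\<lambda>r. (norm (p r - Q_infty))\<^sup>2)"
      using q2 by (intro conjI bm) (auto simp: integrable_iff_bounded)
  qed measurable
  moreover have "L2_fun (lebesgue_on {1<..}) (\<lambda>r. p r - Q_infty) \<longleftrightarrow> L2_fun (lebesgue_on {1<..}) (\<lambda>r. cont_rep q G r - Q_infty)"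
    unfolding L2_fun_def
    by (intro conj_cong measurable_cong Bochner_Integration.integrable_cong refl) (auto simp: space_restrict_space pr)
  ultimately show "L2_fun (lebesgue_on {1<..}) (\<lambda>r. cont_rep q G r - Q_infty)" by simp
  show "has_weak_gradient {1<..} (\<lambda>r. cont_rep q G r - Q_infty) (\<lambda>_. G)"
    unfolding has_weak_gradient_def Basis_real_def
  proof (intro ballI conjI allI impI)
    show "L2_fun (lebesgue_on {1<..}) G"
      using G2 by (subst cong) (auto simp: integrable_iff_bounded intro: bm)
    fix b :: real and \<phi> :: "real \<Rightarrow> real" assume "b \<in> {1}" and \<phi>: "test_fun {1<..} \<phi>"
    note t = test_fun_ray[OF \<phi>]
    have [measurable]: "\<phi> \<in> borel_measurable borel" "partial_deriv 1 \<phi> \<in> borel_measurable borel"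
      by (rule t)+
    have ibp: "integrable ray (\<lambda>r. partial_deriv 1 \<phi> r *\<^sub>R (W k r - Q_infty))" "integrable ray (\<lambda>r. \<phi> r *\<^sub>R W' k r)"
      "(\<integral>r. partial_deriv 1 \<phi> r *\<^sub>R (W k r - Q_infty) \<partial>ray) = - (\<integral>r. \<phi> r *\<^sub>R W' k r \<partial>ray)" for k
    proof -
      have "((\<lambda>r. W k r - Q_infty) has_vector_derivative W' k r) (at r)" for r
        using has_vector_derivative_diff[OF d has_vector_derivative_const] by simp
      from integration_by_parts_ray[OF \<phi> this c]
      show "integrable ray (\<lambda>r. partial_deriv 1 \<phi> r *\<^sub>R (W k r - Q_infty))" "integrable ray (\<lambda>r. \<phi> r *\<^sub>R W' k r)"
        "(\<integral>r. partial_deriv 1 \<phi> r *\<^sub>R (W k r - Q_infty) \<partial>ray) = - (\<integral>r. \<phi> r *\<^sub>R W' k r \<partial>ray)" by auto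
    qed
    have "(\<lambda>k. \<integral>r. partial_deriv 1 \<phi> r *\<^sub>R (W k r - Q_infty) \<partial>ray) \<longlonglongrightarrow> (\<integral>r. partial_deriv 1 \<phi> r *\<^sub>R (q r - Q_infty) \<partial>ray)"
      using W t(4) q2 ibp(1) by (intro L2_pairing_tendsto) (auto simp: C1_approx_def)
    moreover have "(\<lambda>k. - (\<integral>r. \<phi> r *\<^sub>R W' k r \<partial>ray)) \<longlonglongrightarrow> - (\<integral>r. \<phi> r *\<^sub>R G r \<partial>ray)"
      using W t(3) G2 ibp(2) by (intro tendsto_minus L2_pairing_tendsto) (auto simp: C1_approx_def)
    ultimately have "(\<integral>r. partial_deriv 1 \<phi> r *\<^sub>R (q r - Q_infty) \<partial>ray) = - (\<integral>r. \<phi> r *\<^sub>R G r \<partial>ray)"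
      unfolding ibp(3) by (rule LIMSEQ_unique)
    moreover have "(\<integral>r. partial_deriv 1 \<phi> r *\<^sub>R (p r - Q_infty) \<partial>ray) = (\<integral>r. partial_deriv 1 \<phi> r *\<^sub>R (q r - Q_infty) \<partial>ray)"
      by (rule integral_cong_AE) (measurable, use pq in \<open>eventually_elim, simp\<close>)
    moreover have "(LINT r|lebesgue_on {1<..}. partial_deriv 1 \<phi> r *\<^sub>R (p r - Q_infty)) = (\<integral>r. partial_deriv 1 \<phi> r *\<^sub>R (p r - Q_infty) \<partial>ray)"
      by (rule integral_lebesgue_on_ray) measurable
    moreover have "(LINT r|lebesgue_on {1<..}. \<phi> r *\<^sub>R G r) = (\<integral>r. \<phi> r *\<^sub>R G r \<partial>ray)"
      by (rule integral_lebesgue_on_ray) measurable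
    moreover have "(LINT r|lebesgue_on {1<..}. partial_deriv 1 \<phi> r *\<^sub>R (p r - Q_infty))
        = (LINT r|lebesgue_on {1<..}. partial_deriv 1 \<phi> r *\<^sub>R (cont_rep q G r - Q_infty))"
      by (rule Bochner_Integration.integral_cong) (auto simp: space_restrict_space pr)
    ultimately show "(LINT r|lebesgue_on {1<..}. partial_deriv b \<phi> r *\<^sub>R (cont_rep q G r - Q_infty)) = - (LINT r|lebesgue_on {1<..}. \<phi> r *\<^sub>R G r)"
      using \<open>b \<in> {1}\<close> by simp
  qed
qed

lemma Q_infty_in_S0: "Q_infty \<in> S0"
  by (simp add: S0_def Q_infty_def uniaxial_def vec_eq_iff transpose_def trace_def sum_3 mat_def axis_def)

lemma S0_diff: "A \<in> S0 \<Longrightarrow> B \<in> S0 \<Longrightarrow> A - B \<in> S0"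
  using S0_proj_id[of A] S0_proj_id[of B] linear_diff[OF linear_S0_proj, of A B] S0_proj_in[of "A - B"] by simp

lemma D_min_le_F_ray:
  assumes H: "H1_curve q G"
  shows "D_min g0 l (q 1) \<le> F_ray g0 l (cont_rep q G)"
proof -
  have m: "q \<in> borel_measurable borel" "G \<in> borel_measurable borel"
    and G2: "(\<integral>\<^sup>+r. ennreal ((norm (G r))\<^sup>2) \<partial>ray) < \<infinity>"
    using H by (auto simp: H1_curve_def)
  obtain W W' where W: "C1_approx q G W W'" using H by (auto simp: H1_curve_def)
  note rep = cont_rep_properties[OF m G2 W]
  show ?thesis
    unfolding D_min_def
  proof (rule INF_lower, intro CollectI conjI)
    show "(\<lambda>r. cont_rep q G r - Q_infty) \<in> H1 {1<..} S0"
      unfolding H1_def using has_weak_gradient_cont_rep[OF H] rep(2) Q_infty_in_S0 by (auto intro: S0_diff)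
  qed (use rep(1) cont_rep_1 in auto)
qed

lemma weak_gradient_cont_rep:
  assumes H: "H1_curve q G"
  shows "AE r in lebesgue. 1 < r \<longrightarrow> weak_gradient {1<..} (cont_rep q G) 1 r = G r \<and> cont_rep q G r = q r"
proof -
  have m: "q \<in> borel_measurable borel" "G \<in> borel_measurable borel"
    and G2: "(\<integral>\<^sup>+r. ennreal ((norm (G r))\<^sup>2) \<partial>ray) < \<infinity>"
    using H by (auto simp: H1_curve_def)
  obtain W W' where W: "C1_approx q G W W'" using H by (auto simp: H1_curve_def)
  have wg: "has_weak_gradient {1<..} (cont_rep q G) (\<lambda>_. G)"
    by (rule has_weak_gradient_add_const[OF has_weak_gradient_cont_rep[OF H]]) simp
  then have "has_weak_gradient {1<..} (cont_rep q G) (weak_gradient {1<..} (cont_rep q G))"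
    unfolding weak_gradient_def by (rule someI[where P="has_weak_gradient {1<..} (cont_rep q G)"])
  from weak_gradient_ray_unique[OF this wg] AE_lebesgue_if_AE_ray[OF cont_rep_properties(3)[OF m G2 W]]
  show ?thesis by eventually_elim simp
qed

text \<open>Here the choice made by \<open>weak_gradient\<close> and the continuous representative
  are traded for the data q and G, so that later estimates refer to explicit integrands.\<close>

lemma D_min_le_energy:
  assumes H: "H1_curve q G"
  shows "l \<noteq> \<infinity> \<Longrightarrow> D_min g0 l (q 1)
      \<le> (\<integral>\<^sup>+r. ennreal (1/2 * (norm (G r))\<^sup>2 + (enn2real l)\<^sup>2 * f_pot (q r) + g_pot g0 (q r)) \<partial>ray)"
    and "(\<And>r. 1 < r \<Longrightarrow> f_pot (q r) = 0) \<Longrightarrow> D_min g0 \<infinity> (q 1)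
      \<le> (\<integral>\<^sup>+r. ennreal (1/2 * (norm (G r))\<^sup>2 + g_pot g0 (q r)) \<partial>ray)"
proof -
  note AE = weak_gradient_cont_rep[OF H]
  show "D_min g0 l (q 1) \<le> (\<integral>\<^sup>+r. ennreal (1/2 * (norm (G r))\<^sup>2 + (enn2real l)\<^sup>2 * f_pot (q r) + g_pot g0 (q r)) \<partial>ray)"
    if "l \<noteq> \<infinity>"
  proof -
    have "F_ray g0 l (cont_rep q G) =
        (\<integral>\<^sup>+r\<in>{1<..}. ennreal (1/2 * (norm (G r))\<^sup>2 + (enn2real l)\<^sup>2 * f_pot (q r) + g_pot g0 (q r)) \<partial>lebesgue)"
      using that unfolding F_ray_def
      by simp (rule nn_integral_cong_AE, use AE in \<open>eventually_elim, auto simp: indicator_def\<close>)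
    then show ?thesis using D_min_le_F_ray[OF H, of g0 l] by (simp add: nn_integral_ray_lebesgue)
  qed
  show "D_min g0 \<infinity> (q 1) \<le> (\<integral>\<^sup>+r. ennreal (1/2 * (norm (G r))\<^sup>2 + g_pot g0 (q r)) \<partial>ray)"
    if f0: "\<And>r. 1 < r \<Longrightarrow> f_pot (q r) = 0"
  proof -
    have "AE r in lebesgue. 1 < r \<longrightarrow> f_pot (cont_rep q G r) = 0"
      using AE by eventually_elim (auto simp: f0)
    then have "F_ray g0 \<infinity> (cont_rep q G) =
        (\<integral>\<^sup>+r\<in>{1<..}. ennreal (1/2 * (norm (weak_gradient {1<..} (cont_rep q G) 1 r))\<^sup>2 + g_pot g0 (cont_rep q G r)) \<partial>lebesgue)"
      unfolding F_ray_def by simp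
    also have "\<dots> = (\<integral>\<^sup>+r\<in>{1<..}. ennreal (1/2 * (norm (G r))\<^sup>2 + g_pot g0 (q r)) \<partial>lebesgue)"
      by (rule nn_integral_cong_AE, use AE in \<open>eventually_elim, auto simp: indicator_def\<close>)
    finally show ?thesis using D_min_le_F_ray[OF H, of g0 \<infinity>] by (simp add: nn_integral_ray_lebesgue)
  qed
qed

section \<open>The uniaxial problem\<close>

lemma norm3_sq_eq_1: "norm (n::real^3) = 1 \<Longrightarrow> (n$1)\<^sup>2 + (n$2)\<^sup>2 + (n$3)\<^sup>2 = 1"
  using norm_vector_sq[of n] by simp

lemma uniaxial_in_S0: "norm n = 1 \<Longrightarrow> uniaxial n \<in> S0"
  using norm3_sq_eq_1[of n]
  by (simp add: S0_def uniaxial_def vec_eq_iff transpose_def trace_def sum_3 mat_def power2_eq_square mult.commute)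

lemma shifted_uniaxial: "shifted (uniaxial n) = (\<chi> i j. n $ i * n $ j)"
  by (simp add: shifted_def uniaxial_def)

lemma defect_uniaxial:
  assumes "norm n = 1"
  shows "defect (uniaxial n) = 0"
proof -
  have s: "n$1 * n$1 + n$2 * n$2 + n$3 * n$3 = 1"
    using norm3_sq_eq_1[OF assms] by (simp add: power2_eq_square)
  have "(\<Sum>k\<in>UNIV. n $ i * n $ k * (n $ k * n $ j)) = n $ i * n $ j * (n$1 * n$1 + n$2 * n$2 + n$3 * n$3)" for i j
    by (simp add: sum_3 algebra_simps)
  then show ?thesis
    unfolding defect_def shifted_uniaxial s by (simp add: matrix_matrix_mult_def vec_eq_iff s)
qed

lemma f_pot_uniaxial: "norm n = 1 \<Longrightarrow> f_pot (uniaxial n) = 0"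
  by (simp add: f_pot_eq_defect uniaxial_in_S0 defect_uniaxial)

lemma norm_uniaxial_sq:
  assumes "norm n = 1"
  shows "(norm (uniaxial n))\<^sup>2 = 2/3" "(norm (uniaxial n - Q_infty))\<^sup>2 = 2 * (1 - (n$3)\<^sup>2)"
  using norm_sq_defect(1,2)[OF uniaxial_in_S0[OF assms]]
  by (simp_all add: defect_uniaxial[OF assms] trace_def[of 0]) (simp add: uniaxial_def mat_def power2_eq_square)

lemma g_pot_uniaxial:
  assumes "norm n = 1"
  shows "g_pot g0 (uniaxial n) = sqrt (3/2) * (1 - (n$3)\<^sup>2)"
proof -
  define R where "R = sqrt (3/2)"
  have R: "R * R = 3/2" "0 < R" by (simp_all add: R_def)
  have R': "sqrt (2/3) = 2/3 * R"
    using R by (intro real_sqrt_unique) (auto simp: power2_eq_square)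
  have nu: "norm (uniaxial n) = 2/3 * R"
    using norm_uniaxial_sq(1)[OF assms] unfolding R'[symmetric] by (metis norm_ge_zero real_sqrt_unique)
  then have "uniaxial n \<noteq> 0" using R by auto
  moreover have "uniaxial n $ 3 $ 3 = (n$3)\<^sup>2 - 1/3"
    by (simp add: uniaxial_def mat_def power2_eq_square)
  moreover have "x / (2/3 * R) = R * x" for x
  proof -
    have "x = R * x * (2/3 * R)" using R(1) by algebra
    then show ?thesis using R(2) by (simp add: divide_eq_eq)
  qed
  ultimately have "g_pot g0 (uniaxial n) = 2/3 * R - R * ((n$3)\<^sup>2 - 1/3)"
    unfolding g_pot_def R' nu by (simp only: if_False)
  then show ?thesis
    by (simp add: algebra_simps flip: R_def)
qed

lemma uniaxial_uminus: "uniaxial (- n) = uniaxial n"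
  by (simp add: uniaxial_def)

definition outer :: "real^3 \<Rightarrow> real^3 \<Rightarrow> real^3^3" where
  "outer u v = (\<chi> i j. u $ i * v $ j)"

lemma norm_outer_sq: "(norm (outer u v))\<^sup>2 = (norm u)\<^sup>2 * (norm v)\<^sup>2"
  by (simp add: outer_def norm_matrix_sq norm_vector_sq) algebra

lemma bounded_bilinear_outer: "bounded_bilinear outer"
proof
  have "norm (outer u v) = norm u * norm v" for u v
    using norm_outer_sq[of u v] by (metis norm_ge_zero power2_eq_iff_nonneg power_mult_distrib mult_nonneg_nonneg)
  then show "\<exists>K. \<forall>a b. norm (outer a b) \<le> norm a * norm b * K"
    by (intro exI[of _ 1]) auto
qed (simp_all add: outer_def vec_eq_iff algebra_simps)

lemma uniaxial_outer: "uniaxial n = outer n n - (1/3) *\<^sub>R mat 1"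
  by (simp add: uniaxial_def outer_def)

text \<open>This is \<open>2 \<kappa>\<close> with \<open>\<kappa> = (3/2)\<^sup>1\<^sup>/\<^sup>4\<close>.\<close>

definition surface_constant :: real where
  "surface_constant = 2 * sqrt (sqrt (3/2))"

text \<open>A C1 curve serves as its own approximating sequence.\<close>

lemma H1_curve_smooth:
  assumes d: "\<And>r. (q has_vector_derivative G r) (at r)" and c: "continuous_on UNIV G" and S: "\<And>r. q r \<in> S0"
    and "(\<integral>\<^sup>+r. ennreal ((norm (q r - Q_infty))\<^sup>2) \<partial>ray) < \<infinity>"
    and "(\<integral>\<^sup>+r. ennreal ((norm (G r))\<^sup>2) \<partial>ray) < \<infinity>"
  shows "H1_curve q G"
proof -
  have "continuous_on UNIV q"
    using d by (intro continuous_at_imp_continuous_on ballI has_vector_derivative_continuous) auto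
  moreover have "C1_approx q G (\<lambda>_. q) (\<lambda>_. G)"
    using d c S by (simp add: C1_approx_def)
  ultimately show ?thesis
    using assms borel_measurable_continuous_onI unfolding H1_curve_def by blast
qed

text \<open>The competitor rotates the director towards \<open>e\<^sub>3\<close> with polar angle \<open>\<theta>\<close> solving
  \<open>\<theta>' = - \<kappa> sin \<theta>\<close>, for which Young's inequality in the energy is an equality.\<close>

lemma D_min_infinity_le_aux:
  fixes n :: "real^3"
  assumes n: "norm n = 1" and n3: "0 \<le> n$3"
  shows "D_min g0 \<infinity> (uniaxial n) \<le> ennreal (surface_constant * (1 - n$3))"
\<comment> \<open>The hyperbolic tangent never reaches 1, so n = e_3 is treated by the constant
  curve.\<close>
proof (cases "n$3 = 1")
  case True
  have "n$1 = 0" "n$2 = 0"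
    using norm3_sq_eq_1[OF n] True by (simp_all add: sum_power2_eq_zero_iff)
  then have "n = axis 3 1" using True by (simp add: vec_eq_iff forall_3 axis_def)
  then have u: "uniaxial n = Q_infty" by (simp add: Q_infty_def)
  have "H1_curve (\<lambda>_. Q_infty) (\<lambda>_. 0)"
    by (rule H1_curve_smooth) (auto simp: Q_infty_in_S0)
  from D_min_le_energy(2)[OF this, of g0]
  have "D_min g0 \<infinity> Q_infty \<le> (\<integral>\<^sup>+r. ennreal (g_pot g0 Q_infty) \<partial>ray)"
    using f_pot_uniaxial[OF n] by (simp add: u)
  also have "g_pot g0 Q_infty = 0" using g_pot_uniaxial[OF n, of g0] True by (simp add: u)
  finally show ?thesis using True by (simp add: u)
next
  case False
  define \<kappa> where "\<kappa> = sqrt (sqrt (3/2))"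
  have \<kappa>: "0 < \<kappa>" "\<kappa>\<^sup>2 = sqrt (3/2)" by (simp_all add: \<kappa>_def)
  have "n$3 \<le> 1" using norm3_sq_eq_1[OF n] n3
    by (metis abs_of_nonneg component_le_norm_cart n)
  then have lt: "n$3 < 1" using False by simp
  \<comment> \<open>The angle equation is solved by cos \<theta> = tanh z and sin \<theta> = 1 /
    cosh z, with z of slope \<kappa>. The shift a lets the curve start at height n_3.\<close>
  obtain a where ta: "tanh a = n$3"
  proof -
    have "eventually (\<lambda>b::real. n$3 < tanh b \<and> 0 \<le> b) at_top"
      using order_tendstoD(1)[OF tanh_real_at_top lt] eventually_ge_at_top[of 0] by (rule eventually_conj)
    then obtain b :: real where b: "n$3 < tanh b" "0 \<le> b"
      by (auto dest: eventually_happens)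
    have "continuous_on {0..b} (tanh :: real \<Rightarrow> real)"
      by (intro continuous_intros) auto
    then show thesis
      using IVT'[of tanh 0 "n$3" b] b n3 that by auto
  qed
  define w where "w = sqrt (1 - (n$3)\<^sup>2)"
  have "(n$3)\<^sup>2 < 1" using n3 lt by (simp add: power_less_one_iff abs_square_less_1)
  then have w: "0 < w" "w\<^sup>2 = 1 - (n$3)\<^sup>2" by (simp_all add: w_def)
  \<comment> \<open>The horizontal direction of n; w is positive because n differs from e_3.\<close>
  define e :: "real^3" where "e = vector [n$1 / w, n$2 / w, 0]"
  have e: "e$3 = 0" "(e$1)\<^sup>2 + (e$2)\<^sup>2 = 1"
  proof -
    have "(e$1)\<^sup>2 + (e$2)\<^sup>2 = ((n$1)\<^sup>2 + (n$2)\<^sup>2) / w\<^sup>2"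
      by (simp add: e_def power_divide add_divide_distrib)
    also have "(n$1)\<^sup>2 + (n$2)\<^sup>2 = w\<^sup>2" using norm3_sq_eq_1[OF n] w by simp
    finally show "(e$1)\<^sup>2 + (e$2)\<^sup>2 = 1" using w(1) by simp
  qed (simp add: e_def)
  define z where "z r = \<kappa> * (r - 1) + a" for r
  define s where "s r = 1 / cosh (z r)" for r
  define t where "t r = tanh (z r)" for r
  define N :: "real \<Rightarrow> real^3" where "N r = s r *\<^sub>R e + t r *\<^sub>R axis 3 1" for r
  define M :: "real \<Rightarrow> real^3" where "M r = (\<kappa> * s r) *\<^sub>R (- t r *\<^sub>R e + s r *\<^sub>R axis 3 1)" for r
  have st: "(s r)\<^sup>2 + (t r)\<^sup>2 = 1" for r
  proof -
    have "(s r)\<^sup>2 + (t r)\<^sup>2 = (1 + (sinh (z r))\<^sup>2) / (cosh (z r))\<^sup>2"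
      by (simp add: s_def t_def tanh_def power_divide add_divide_distrib)
    also have "1 + (sinh (z r))\<^sup>2 = (cosh (z r))\<^sup>2"
      using hyperbolic_pythagoras[of "z r"] by simp
    finally show ?thesis using cosh_real_pos[of "z r"] by simp
  qed
  have dz: "(z has_real_derivative \<kappa>) (at r)" for r
    unfolding z_def by (auto intro!: derivative_eq_intros)
  have ds: "(s has_real_derivative - \<kappa> * s r * t r) (at r)" for r
    unfolding s_def t_def using cosh_real_pos[of "z r"]
    by (auto intro!: derivative_eq_intros dz simp: tanh_def power2_eq_square)
  have dt: "(t has_real_derivative \<kappa> * (s r)\<^sup>2) (at r)" for r
  proof -
    have "1 - (tanh (z r))\<^sup>2 = (s r)\<^sup>2" using st[of r] by (simp add: t_def)
    then show ?thesis
      unfolding t_def using cosh_real_pos[of "z r"] by (auto intro!: derivative_eq_intros dz)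
  qed
  have dN: "(N has_vector_derivative M r) (at r)" for r
  proof -
    have "(N has_vector_derivative (- \<kappa> * s r * t r) *\<^sub>R e + (\<kappa> * (s r)\<^sup>2) *\<^sub>R axis 3 1) (at r)"
      unfolding N_def
      using has_vector_derivative_add[OF has_vector_derivative_scaleR[OF ds has_vector_derivative_const]
          has_vector_derivative_scaleR[OF dt has_vector_derivative_const]] by simp
    also have "(- \<kappa> * s r * t r) *\<^sub>R e + (\<kappa> * (s r)\<^sup>2) *\<^sub>R axis 3 1 = M r"
      by (simp add: M_def scaleR_diff_right power2_eq_square mult.assoc)
    finally show ?thesis .
  qed
  have contd: "continuous_on UNIV s" "continuous_on UNIV t"
    by (rule DERIV_continuous_on[OF DERIV_subset[OF ds]], simp, rule DERIV_continuous_on[OF DERIV_subset[OF dt]], simp)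
  have nN: "norm (N r) = 1" for r
  proof -
    have "(norm (N r))\<^sup>2 = (s r)\<^sup>2 * ((e$1)\<^sup>2 + (e$2)\<^sup>2) + (t r)\<^sup>2"
      by (simp add: norm_vector_sq N_def e(1) axis_def power_mult_distrib algebra_simps)
    then have "(norm (N r))\<^sup>2 = 1" using e st[of r] by simp
    then show ?thesis using norm_ge_zero[of "N r"] unfolding power2_eq_1_iff by linarith
  qed
  have N3: "N r $ 3 = t r" for r by (simp add: N_def e)
  define q where "q r = uniaxial (N r)" for r
  define G where "G r = outer (N r) (M r) + outer (M r) (N r)" for r
  have dq: "(q has_vector_derivative G r) (at r)" for r
    unfolding q_def G_def uniaxial_outer
    using has_vector_derivative_diff[OF bounded_bilinear.has_vector_derivative[OF bounded_bilinear_outer dN dN] has_vector_derivative_const]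
    by simp
  have cN: "continuous_on UNIV N" "continuous_on UNIV M"
    unfolding N_def M_def by (intro continuous_intros contd)+
  have cG: "continuous_on UNIV G"
    unfolding G_def by (intro continuous_intros bounded_bilinear.continuous_on[OF bounded_bilinear_outer] cN)
  have nG: "(norm (G r))\<^sup>2 = 2 * \<kappa>\<^sup>2 * (s r)\<^sup>2" for r
  proof -
    have NM: "N r \<bullet> M r = 0"
    proof -
      have "N r \<bullet> M r = \<kappa> * s r * (s r * t r - s r * t r * ((e$1)\<^sup>2 + (e$2)\<^sup>2))"
        by (simp add: inner_vec_def sum_3 N_def M_def e(1) axis_def power2_eq_square algebra_simps)
      then show ?thesis using e by simp
    qed
    have "(norm (M r))\<^sup>2 = (\<kappa> * s r)\<^sup>2 * ((t r)\<^sup>2 * ((e$1)\<^sup>2 + (e$2)\<^sup>2) + (s r)\<^sup>2)"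
      by (simp add: norm_vector_sq M_def e(1) axis_def power_mult_distrib algebra_simps)
    then have nM: "(norm (M r))\<^sup>2 = \<kappa>\<^sup>2 * (s r)\<^sup>2"
      using e st[of r] by (simp add: power_mult_distrib add.commute)
    have "(norm (G r))\<^sup>2 = 2 * (norm (N r))\<^sup>2 * (norm (M r))\<^sup>2 + 2 * (N r \<bullet> M r)\<^sup>2"
      by (simp add: G_def outer_def norm_matrix_sq norm_vector_sq inner_vec_def sum_3) algebra
    then show ?thesis using nN NM nM by simp
  qed
  \<comment> \<open>The gradient part and the potential part of the energy are both \<kappa>^2 s^2,
    and t has derivative \<kappa> s^2, so the sum integrates to 2 \<kappa> times the increase of
    t.\<close>
  have tot: "(\<integral>\<^sup>+r. ennreal (2 * \<kappa>\<^sup>2 * (s r)\<^sup>2) \<partial>ray) = ennreal (2 * \<kappa> * (1 - n$3))"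
  proof -
    have "(\<integral>\<^sup>+r. ennreal (2 * \<kappa>\<^sup>2 * (s r)\<^sup>2) \<partial>ray) = (\<integral>\<^sup>+r\<in>{1..}. ennreal (2 * \<kappa>\<^sup>2 * (s r)\<^sup>2) \<partial>lborel)"
      unfolding nn_integral_ray
      by (rule nn_integral_cong_AE) (use AE_lborel_singleton[of 1] in \<open>eventually_elim, auto simp: indicator_def\<close>)
    also have "\<dots> = ennreal (2 * \<kappa> - 2 * \<kappa> * t 1)"
    proof (rule nn_integral_FTC_atLeast)
      show "(\<lambda>r. 2 * \<kappa>\<^sup>2 * (s r)\<^sup>2) \<in> borel_measurable borel"
        by (intro borel_measurable_continuous_onI continuous_intros contd)
      show "((\<lambda>r. 2 * \<kappa> * t r) has_real_derivative 2 * \<kappa>\<^sup>2 * (s r)\<^sup>2) (at r)" for r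
        by (auto intro!: derivative_eq_intros dt simp: power2_eq_square)
      have "filterlim z at_top at_top"
        unfolding z_def using \<kappa>(1) by real_asymp
      then have "(t \<longlongrightarrow> 1) at_top"
        unfolding t_def by (rule filterlim_compose[OF tanh_real_at_top])
      then show "((\<lambda>r. 2 * \<kappa> * t r) \<longlongrightarrow> 2 * \<kappa>) at_top"
        using tendsto_mult_left[of t 1 at_top "2 * \<kappa>"] by simp
    qed auto
    also have "t 1 = n$3" by (simp add: t_def z_def ta)
    finally show ?thesis by (simp add: algebra_simps)
  qed
  have "H1_curve q G"
  proof (rule H1_curve_smooth[OF dq cG])
    show "q r \<in> S0" for r unfolding q_def by (rule uniaxial_in_S0[OF nN])
    have "(norm (q r - Q_infty))\<^sup>2 = 1 / \<kappa>\<^sup>2 * (2 * \<kappa>\<^sup>2 * (s r)\<^sup>2)" for r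
      using norm_uniaxial_sq(2)[OF nN, of r] st[of r] \<kappa>(1) by (simp add: q_def N3)
    then have "(\<integral>\<^sup>+r. ennreal ((norm (q r - Q_infty))\<^sup>2) \<partial>ray) = (\<integral>\<^sup>+r. ennreal (1 / \<kappa>\<^sup>2) * ennreal (2 * \<kappa>\<^sup>2 * (s r)\<^sup>2) \<partial>ray)"
      by (simp only:) (simp add: ennreal_mult[symmetric])
    also have "\<dots> = ennreal (1 / \<kappa>\<^sup>2) * ennreal (2 * \<kappa> * (1 - n$3))"
    proof -
      have "(\<lambda>r. 2 * \<kappa>\<^sup>2 * (s r)\<^sup>2) \<in> borel_measurable borel"
        by (intro borel_measurable_continuous_onI continuous_intros contd)
      then show ?thesis unfolding tot[symmetric] by (intro nn_integral_cmult) auto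
    qed
    finally show "(\<integral>\<^sup>+r. ennreal ((norm (q r - Q_infty))\<^sup>2) \<partial>ray) < \<infinity>" by (simp add: ennreal_mult_less_top)
    show "(\<integral>\<^sup>+r. ennreal ((norm (G r))\<^sup>2) \<partial>ray) < \<infinity>"
      unfolding nG tot by simp
  qed
  from D_min_le_energy(2)[OF this, of g0]
  have "D_min g0 \<infinity> (q 1) \<le> (\<integral>\<^sup>+r. ennreal (1/2 * (norm (G r))\<^sup>2 + g_pot g0 (q r)) \<partial>ray)"
    by (simp add: q_def f_pot_uniaxial nN)
  also have "\<dots> = (\<integral>\<^sup>+r. ennreal (2 * \<kappa>\<^sup>2 * (s r)\<^sup>2) \<partial>ray)"
  proof (intro nn_integral_cong arg_cong[where f=ennreal])
    fix r
    have "1 - (t r)\<^sup>2 = (s r)\<^sup>2" using st[of r] by simp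
    then show "1/2 * (norm (G r))\<^sup>2 + g_pot g0 (q r) = 2 * \<kappa>\<^sup>2 * (s r)\<^sup>2"
      unfolding nG q_def g_pot_uniaxial[OF nN] N3 \<kappa>(2) by simp
  qed
  also have "\<dots> = ennreal (surface_constant * (1 - n$3))"
    unfolding tot by (simp add: surface_constant_def \<kappa>_def)
  also have "q 1 = uniaxial n"
  proof -
    have "s 1 = w"
    proof (rule power2_eq_imp_eq)
      show "(s 1)\<^sup>2 = w\<^sup>2" using st[of 1] w by (simp add: t_def z_def ta)
      show "0 \<le> s 1" by (simp add: s_def cosh_real_nonneg)
    qed (use w in simp)
    then have "N 1 = n"
      using w by (simp add: N_def e_def vec_eq_iff forall_3 t_def z_def ta axis_def)
    then show ?thesis by (simp add: q_def)
  qed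
  finally show ?thesis .
qed

text \<open>The directors n and -n give the same tensor, so the rotation may start in the hemisphere
  of e_3.\<close>

lemma D_min_infinity_le:
  assumes "norm n = 1"
  shows "D_min g0 \<infinity> (uniaxial n) \<le> ennreal (surface_constant * (1 - \<bar>n$3\<bar>))"
proof (cases "0 \<le> n$3")
  case False
  then show ?thesis
    using D_min_infinity_le_aux[of "- n" g0] assms by (simp add: uniaxial_uminus)
qed (use D_min_infinity_le_aux[OF assms] in simp)

section \<open>Lower bounds along a curve\<close>

lemma continuous_on_shifted: "continuous_on A shifted"
  unfolding shifted_def[abs_def] by (intro continuous_intros)

lemma continuous_on_defect: "continuous_on A defect"
  unfolding defect_def[abs_def]
  by (intro continuous_intros bounded_bilinear.continuous_on[OF bounded_bilinear_matrix_mult] continuous_on_shifted)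

lemma continuous_on_calib: "continuous_on A (calib \<epsilon> K)"
  unfolding calib_def[abs_def] smooth33_def
  by (intro continuous_intros bounded_bilinear.continuous_on[OF bounded_bilinear_matrix_mult] continuous_on_shifted continuous_on_defect)

lemma continuous_on_calib_slope: "continuous_on A (calib_slope \<epsilon> \<delta>)"
proof -
  have "continuous_on A (\<lambda>Q. \<chi> i. shifted Q $ i $ 3)"
    by (intro continuous_intros continuous_on_shifted)
  then have "continuous_on A col3"
    by (rule continuous_on_eq)
      (simp add: col3_def matrix_vector_mult_def axis_def if_distrib sum.delta vec_eq_iff cong: if_cong)
  then show ?thesis
    unfolding calib_slope_def[abs_def] by (intro continuous_intros continuous_on_defect)
qed

lemma borel_measurable_f_pot [measurable]: "f_pot \<in> borel_measurable borel"
  unfolding f_pot_def[abs_def] trace_def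
  by (intro borel_measurable_continuous_onI continuous_intros
      bounded_bilinear.continuous_on[OF bounded_bilinear_matrix_mult])

lemma borel_measurable_g_pot [measurable]: "g_pot g0 \<in> borel_measurable borel"
proof -
  have [measurable]: "(\<lambda>Q::real^3^3. Q $ 3 $ 3) \<in> borel_measurable borel"
    by (intro borel_measurable_continuous_onI continuous_intros)
  show ?thesis unfolding g_pot_def[abs_def] by measurable
qed

lemma calib_uniaxial: "norm n = 1 \<Longrightarrow> calib \<epsilon> K (uniaxial n) = \<epsilon> + (n$3)\<^sup>2"
proof -
  assume n: "norm n = 1"
  have "shifted (uniaxial n) ** shifted (uniaxial n) = shifted (uniaxial n)"
    using defect_uniaxial[OF n] by (simp add: defect_def)
  then show ?thesis
    by (simp add: calib_def smooth33_def defect_uniaxial[OF n]) (simp add: shifted_uniaxial power2_eq_square)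
qed

text \<open>The rate of change is at most |W'| times \<kappa> times the slope, and Young's
  inequality bounds this product by half the sum of the squares.\<close>

lemma calib_increment_le:
  fixes W :: "real \<Rightarrow> real^3^3"
  assumes d: "\<And>r. (W has_vector_derivative W' r) (at r)" and c: "continuous_on UNIV W'" and S: "\<And>r. W r \<in> S0"
    and T: "1 \<le> T" and \<epsilon>: "0 < \<epsilon>" and \<delta>: "0 < \<delta>" "\<delta> < 1"
  defines "\<Phi> \<equiv> \<lambda>Q. surface_constant * sqrt (calib \<epsilon> (2/\<delta>) Q)"
  shows "ennreal (\<Phi> (W T) - \<Phi> (W 1))
    \<le> (\<integral>\<^sup>+r. ennreal (indicator {..T} r * (1/2 * (norm (W' r))\<^sup>2 + 1/2 * (sqrt (3/2) * (calib_slope \<epsilon> \<delta> (W r))\<^sup>2))) \<partial>ray)"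
proof -
  define B where "B r = 1/2 * (norm (W' r))\<^sup>2 + 1/2 * (sqrt (3/2) * (calib_slope \<epsilon> \<delta> (W r))\<^sup>2)" for r
  define \<kappa> where "\<kappa> = sqrt (sqrt (3/2))"
  have \<kappa>: "0 < \<kappa>" "\<kappa>\<^sup>2 = sqrt (3/2)" "surface_constant = 2 * \<kappa>" by (simp_all add: \<kappa>_def surface_constant_def)
  have "\<exists>D. ((\<lambda>r. \<Phi> (W r)) has_real_derivative D) (at r) \<and> D \<le> B r" for r
  proof -
    obtain D where D: "((\<lambda>t. sqrt (calib \<epsilon> (2/\<delta>) (W t))) has_real_derivative D) (at r)"
      "\<bar>D\<bar> \<le> norm (W' r) * (calib_slope \<epsilon> \<delta> (W r) / 2)"
      using sqrt_calib_derivative_le[OF d S S0_derivative[OF S d] \<epsilon> \<delta>] by blast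
    have "((\<lambda>r. \<Phi> (W r)) has_real_derivative surface_constant * D) (at r)"
      unfolding \<Phi>_def by (rule DERIV_cmult[OF D(1)])
    moreover have "surface_constant * D \<le> B r"
    proof -
      have "surface_constant * D \<le> surface_constant * (norm (W' r) * (calib_slope \<epsilon> \<delta> (W r) / 2))"
        using D(2) \<kappa> by (intro mult_left_mono) auto
      also have "\<dots> = norm (W' r) * (\<kappa> * calib_slope \<epsilon> \<delta> (W r))" by (simp add: \<kappa>)
      also have "\<dots> \<le> B r"
        using zero_le_power2[of "norm (W' r) - \<kappa> * calib_slope \<epsilon> \<delta> (W r)"]
        by (simp add: B_def power2_diff power_mult_distrib \<kappa>)
      finally show ?thesis .
    qed
    ultimately show ?thesis by blast
  qed
  then obtain D where D: "\<And>r. ((\<lambda>r. \<Phi> (W r)) has_real_derivative D r) (at r)" "\<And>r. D r \<le> B r" by metis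
  have Wc: "continuous_on UNIV W"
    using d by (intro continuous_at_imp_continuous_on ballI has_vector_derivative_continuous) auto
  have Bc: "continuous_on UNIV B"
    unfolding B_def by (intro continuous_intros c continuous_on_compose2[OF continuous_on_calib_slope Wc]) auto
  then have [measurable]: "B \<in> borel_measurable borel" by (rule borel_measurable_continuous_onI)
  have B0: "0 \<le> B r" for r by (simp add: B_def)
  \<comment> \<open>The pointwise derivative D is not known to be measurable, so its integral is
    taken in the Henstock-Kurzweil sense; only the continuous majorant B is turned into a Lebesgue
    integral.\<close>
  have "(D has_integral (\<Phi> (W T) - \<Phi> (W 1))) {1..T}"
    using D(1) T by (intro fundamental_theorem_of_calculus)
      (auto simp: has_real_derivative_iff_has_vector_derivative[symmetric] intro: has_field_derivative_at_within)
  moreover have si: "set_integrable lborel {1..T} B"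
    unfolding set_integrable_def by (intro borel_integrable_compact continuous_on_subset[OF Bc]) auto
  then have "(B has_integral (LINT r:{1..T}|lborel. B r)) {1..T}"
    using set_borel_integral_eq_integral[OF si] by (simp add: integrable_integral)
  ultimately have "\<Phi> (W T) - \<Phi> (W 1) \<le> (LINT r:{1..T}|lborel. B r)"
    by (rule has_integral_le) (use D(2) in auto)
  then have "ennreal (\<Phi> (W T) - \<Phi> (W 1)) \<le> ennreal (LINT r:{1..T}|lborel. B r)" by (rule ennreal_leI)
  also have "\<dots> = (\<integral>\<^sup>+r. ennreal (indicator {1..T} r *\<^sub>R B r) \<partial>lborel)"
    using si B0 unfolding set_lebesgue_integral_def set_integrable_def
    by (intro nn_integral_eq_integral[symmetric]) auto
  also have "\<dots> = (\<integral>\<^sup>+r. ennreal (indicator {..T} r * B r) \<partial>ray)"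
    unfolding nn_integral_ray
    by (rule nn_integral_cong_AE) (use AE_lborel_singleton[of 1] in \<open>eventually_elim, auto simp: indicator_def\<close>)
  finally show ?thesis unfolding B_def .
qed

lemma norm_sq_le_weighted:
  fixes x y :: "'a::real_normed_vector"
  assumes "0 < \<delta>"
  shows "(norm x)\<^sup>2 \<le> (1 + \<delta>) * (norm y)\<^sup>2 + (1 + 1/\<delta>) * (norm (x - y))\<^sup>2"
proof -
  have "norm x \<le> norm y + norm (x - y)" using norm_triangle_ineq[of y "x - y"] by simp
  then have "(norm x)\<^sup>2 \<le> (norm y + norm (x - y))\<^sup>2" by (intro power_mono) auto
  also have "\<dots> \<le> (1 + \<delta>) * (norm y)\<^sup>2 + (1 + 1/\<delta>) * (norm (x - y))\<^sup>2"
  proof -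
    have "0 \<le> (\<delta> * norm y - norm (x - y))\<^sup>2 / \<delta>" using assms by simp
    also have "\<dots> = (1 + \<delta>) * (norm y)\<^sup>2 + (1 + 1/\<delta>) * (norm (x - y))\<^sup>2 - (norm y + norm (x - y))\<^sup>2"
      using assms by (simp add: power2_eq_square field_simps)
    finally show ?thesis by simp
  qed
  finally show ?thesis .
qed

text \<open>The estimate is applied to the C1 approximants. Their uniform convergence on {1..T}
  carries the slope term over. The error of the derivatives enters with the large weight 1 +
  1/\<delta> but tends to 0 in L2, at the price of the factor 1 + \<delta> on |G|^2.\<close>

lemma calib_increment_le_curve:
  assumes m[measurable]: "q \<in> borel_measurable borel" "G \<in> borel_measurable borel"
    and G2: "(\<integral>\<^sup>+r. ennreal ((norm (G r))\<^sup>2) \<partial>ray) < \<infinity>"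
    and W: "C1_approx q G W W'"
    and T: "1 \<le> T" and \<epsilon>: "0 < \<epsilon>" and \<delta>: "0 < \<delta>" "\<delta> < 1"
  defines "\<Phi> \<equiv> \<lambda>Q. surface_constant * sqrt (calib \<epsilon> (2/\<delta>) Q)"
  shows "ennreal (\<Phi> (cont_rep q G T) - \<Phi> (q 1))
    \<le> (\<integral>\<^sup>+r. ennreal ((1 + \<delta>)/2 * (norm (G r))\<^sup>2) \<partial>ray)
      + (\<integral>\<^sup>+r. ennreal (1/2 * (sqrt (3/2) * (calib_slope \<epsilon> \<delta> (q r))\<^sup>2)) \<partial>ray)"
proof (rule ennreal_le_epsilon)
  fix e :: real assume e: "0 < e"
  define p where "p = cont_rep q G"
  define s where "s Q = sqrt (3/2) * (calib_slope \<epsilon> \<delta> Q)\<^sup>2" for Q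
  define a where "a = (\<integral>\<^sup>+r. ennreal ((1 + \<delta>)/2 * (norm (G r))\<^sup>2) \<partial>ray)"
  define b where "b = (\<integral>\<^sup>+r. ennreal (1/2 * s (q r)) \<partial>ray)"
  define E where "E k = (\<integral>\<^sup>+r. ennreal ((norm (W' k r - G r))\<^sup>2) \<partial>ray)" for k
  have d: "(W k has_vector_derivative W' k r) (at r)" and c: "continuous_on UNIV (W' k)" and S: "W k r \<in> S0" for k r
    using W by (auto simp: C1_approx_def)
  have [measurable]: "W' k \<in> borel_measurable borel" for k by (rule borel_measurable_continuous_onI[OF c])
  note rep = cont_rep_properties[OF m G2 W]
  note u = C1_approx_uniform_limit[OF m(2) G2 W]
  have sc: "continuous_on A s" for A
    unfolding s_def[abs_def] by (intro continuous_intros continuous_on_calib_slope)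
  then have [measurable]: "s \<in> borel_measurable borel" by (intro borel_measurable_continuous_onI)
  have s0: "0 \<le> s Q" for Q by (simp add: s_def)
  \<comment> \<open>The slope term may be off by e' along an interval of length T - 1, so that the
    total error stays below e.\<close>
  define e' where "e' = e / T"
  have e': "0 < e'" using e T by (simp add: e'_def)
  have "compact (p ` {1..T})"
    unfolding p_def by (intro compact_continuous_image continuous_on_subset[OF rep(1)]) auto
  then have "bounded (p ` {1..T})" by (rule compact_imp_bounded)
  then obtain R where "\<forall>x\<in>p ` {1..T}. norm x \<le> R" unfolding bounded_iff ..
  then have R: "norm (p r) \<le> R" if "r \<in> {1..T}" for r using that by blast
  \<comment> \<open>The radius R + 1 leaves room for approximants within distance 1 of the limit
    curve, whose norm is at most R on {1..T}.\<close>
  have "uniformly_continuous_on (cball 0 (R + 1)) s"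
    by (intro compact_uniformly_continuous sc) simp
  then obtain \<eta> where \<eta>: "0 < \<eta>" "\<And>x y. x \<in> cball 0 (R + 1) \<Longrightarrow> y \<in> cball 0 (R + 1) \<Longrightarrow> dist y x < \<eta> \<Longrightarrow> dist (s y) (s x) < e'"
    unfolding uniformly_continuous_on_def using e' by metis
  have "\<forall>\<^sub>F k in sequentially. \<forall>r\<in>{1..T}. dist (W k r) (p r) < min \<eta> 1"
    unfolding p_def by (rule uniform_limitD[OF u]) (use \<eta>(1) in simp)
  then have ev: "\<forall>\<^sub>F k in sequentially. ennreal (\<Phi> (W k T) - \<Phi> (W k 1)) \<le> a + ennreal ((1 + 1/\<delta>)/2) * E k + (b + ennreal e)"
  proof eventually_elim
    case (elim k)
    have sW: "s (W k r) \<le> s (p r) + e'" if r: "r \<in> {1..T}" for r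
    proof -
      have "dist (W k r) (p r) < min \<eta> 1" using elim r by blast
      moreover have "norm (W k r) \<le> norm (p r) + dist (W k r) (p r)"
        using norm_triangle_ineq[of "p r" "W k r - p r"] by (simp add: dist_norm)
      ultimately have "dist (s (W k r)) (s (p r)) < e'"
        using R[OF r] by (intro \<eta>(2)) auto
      then show ?thesis by (simp add: dist_real_def)
    qed
    have "ennreal (\<Phi> (W k T) - \<Phi> (W k 1))
        \<le> (\<integral>\<^sup>+r. ennreal (indicator {..T} r * (1/2 * (norm (W' k r))\<^sup>2 + 1/2 * s (W k r))) \<partial>ray)"
      unfolding \<Phi>_def s_def by (rule calib_increment_le[OF d c S T \<epsilon> \<delta>])
    also have "\<dots> \<le> (\<integral>\<^sup>+r. ennreal ((1 + \<delta>)/2 * (norm (G r))\<^sup>2) + ennreal ((1 + 1/\<delta>)/2) * ennreal ((norm (W' k r - G r))\<^sup>2)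
        + (ennreal (1/2 * s (q r)) + ennreal (e'/2) * indicator {..T} r) \<partial>ray)"
    proof (rule nn_integral_mono_AE)
      have "AE r in ray. 1 < r" by (simp add: AE_ray)
      with rep(3) show "AE r in ray. ennreal (indicator {..T} r * (1/2 * (norm (W' k r))\<^sup>2 + 1/2 * s (W k r)))
        \<le> ennreal ((1 + \<delta>)/2 * (norm (G r))\<^sup>2) + ennreal ((1 + 1/\<delta>)/2) * ennreal ((norm (W' k r - G r))\<^sup>2)
        + (ennreal (1/2 * s (q r)) + ennreal (e'/2) * indicator {..T} r)"
      proof eventually_elim
        case (elim r)
        show ?case
        proof (cases "r \<le> T")
          case True
          have "1/2 * (norm (W' k r))\<^sup>2 + 1/2 * s (W k r)
              \<le> (1 + \<delta>)/2 * (norm (G r))\<^sup>2 + (1 + 1/\<delta>)/2 * (norm (W' k r - G r))\<^sup>2 + (1/2 * s (q r) + e'/2)"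
          proof -
            have "s (W k r) \<le> s (q r) + e'" using sW[of r] True elim by (simp add: p_def)
            moreover have "1/2 * x + 1/2 * u \<le> a/2 * g + b/2 * h + (1/2 * v + c/2)"
              if "x \<le> a * g + b * h" "u \<le> v + c" for x u a g b h v c :: real
              using that by simp
            ultimately show ?thesis
              using norm_sq_le_weighted[OF \<delta>(1), of "W' k r" "G r"] by blast
          qed
          then have "ennreal (1/2 * (norm (W' k r))\<^sup>2 + 1/2 * s (W k r))
              \<le> ennreal ((1 + \<delta>)/2 * (norm (G r))\<^sup>2 + (1 + 1/\<delta>)/2 * (norm (W' k r - G r))\<^sup>2 + (1/2 * s (q r) + e'/2))"
            by (rule ennreal_leI)
          also have "\<dots> = ennreal ((1 + \<delta>)/2 * (norm (G r))\<^sup>2) + ennreal ((1 + 1/\<delta>)/2) * ennreal ((norm (W' k r - G r))\<^sup>2)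
              + (ennreal (1/2 * s (q r)) + ennreal (e'/2))"
          proof -
            have "ennreal ((1 + 1/\<delta>)/2) * ennreal ((norm (W' k r - G r))\<^sup>2) = ennreal ((1 + 1/\<delta>)/2 * (norm (W' k r - G r))\<^sup>2)"
              using \<delta> by (subst ennreal_mult) auto
            then show ?thesis
              using \<delta> s0[of "q r"] e' by (simp flip: ennreal_plus)
          qed
          finally show ?thesis using True by simp
        qed simp
      qed
    qed
    also have "\<dots> = a + ennreal ((1 + 1/\<delta>)/2) * E k + (b + ennreal (e'/2) * (\<integral>\<^sup>+r. indicator {..T} r \<partial>ray))"
      unfolding a_def b_def E_def by (simp add: nn_integral_add nn_integral_cmult)
    also have "ennreal (e'/2) * (\<integral>\<^sup>+r. indicator {..T} r \<partial>ray) \<le> ennreal e"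
    proof -
      have "(\<integral>\<^sup>+r. indicator {..T} r \<partial>ray) \<le> (\<integral>\<^sup>+r. indicator {1..T} r \<partial>lborel)"
        unfolding nn_integral_ray by (intro nn_integral_mono) (auto simp: indicator_def)
      also have "\<dots> = ennreal (T - 1)" using T by simp
      finally have "ennreal (e'/2) * (\<integral>\<^sup>+r. indicator {..T} r \<partial>ray) \<le> ennreal (e'/2) * ennreal (T - 1)"
        by (rule mult_left_mono) simp
      also have "\<dots> = ennreal (e'/2 * (T - 1))" using e' T by (subst ennreal_mult) auto
      also have "e'/2 * (T - 1) \<le> e' * T" using e' T by (intro mult_mono) auto
      also have "e' * T = e" using T by (simp add: e'_def)
      finally show ?thesis by (simp add: ennreal_leI)
    qed
    finally show ?case by (simp add: add_left_mono)
  qed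
  have \<Phi>c: "continuous_on UNIV \<Phi>"
    unfolding \<Phi>_def by (intro continuous_intros continuous_on_calib)
  have "(\<lambda>k. \<Phi> (W k T) - \<Phi> (W k 1)) \<longlonglongrightarrow> \<Phi> (p T) - \<Phi> (q 1)"
  proof (intro tendsto_diff)
    show "(\<lambda>k. \<Phi> (W k T)) \<longlonglongrightarrow> \<Phi> (p T)"
      using tendsto_uniform_limitI[OF u[of T], of T] T
      by (intro continuous_on_tendsto_compose[OF \<Phi>c]) (auto simp: p_def)
    show "(\<lambda>k. \<Phi> (W k 1)) \<longlonglongrightarrow> \<Phi> (q 1)"
      using W by (intro continuous_on_tendsto_compose[OF \<Phi>c]) (auto simp: C1_approx_def)
  qed
  then have l1: "(\<lambda>k. ennreal (\<Phi> (W k T) - \<Phi> (W k 1))) \<longlonglongrightarrow> ennreal (\<Phi> (p T) - \<Phi> (q 1))"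
    by (rule tendsto_ennrealI)
  have "E \<longlonglongrightarrow> 0" using W by (simp add: C1_approx_def E_def[abs_def])
  then have l2: "(\<lambda>k. a + ennreal ((1 + 1/\<delta>)/2) * E k + (b + ennreal e)) \<longlonglongrightarrow> a + ennreal ((1 + 1/\<delta>)/2) * 0 + (b + ennreal e)"
    by (intro tendsto_add tendsto_const tendsto_mult_ennreal) auto
  have "ennreal (\<Phi> (p T) - \<Phi> (q 1)) \<le> a + ennreal ((1 + 1/\<delta>)/2) * 0 + (b + ennreal e)"
    by (rule tendsto_le[OF sequentially_bot l2 l1 ev])
  then show "ennreal (\<Phi> (cont_rep q G T) - \<Phi> (q 1)) \<le> (\<integral>\<^sup>+r. ennreal ((1 + \<delta>)/2 * (norm (G r))\<^sup>2) \<partial>ray)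
      + (\<integral>\<^sup>+r. ennreal (1/2 * (sqrt (3/2) * (calib_slope \<epsilon> \<delta> (q r))\<^sup>2)) \<partial>ray) + ennreal e"
    by (simp add: a_def b_def p_def s_def add.assoc)
qed

text \<open>If the distance were at least d at every r \<ge> 1, the square integral over (1, n + 1]
  would be at least d^2 n for every n.\<close>

lemma exists_near_Q_infty:
  assumes c: "continuous_on {1..} p" and fin: "(\<integral>\<^sup>+r. ennreal ((norm (p r - Q_infty))\<^sup>2) \<partial>ray) < \<infinity>" and d: "0 < d"
  shows "\<exists>T\<ge>1. norm (p T - Q_infty) < d"
proof (rule ccontr)
  assume neg: "\<not> ?thesis"
  have "ennreal (d\<^sup>2 * real n) \<le> (\<integral>\<^sup>+r. ennreal ((norm (p r - Q_infty))\<^sup>2) \<partial>ray)" for n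
  proof -
    have "ennreal (d\<^sup>2 * real n) = (\<integral>\<^sup>+r. ennreal (d\<^sup>2) * indicator {1<..real n + 1} r \<partial>lborel)"
      by (simp add: nn_integral_cmult_indicator ennreal_mult)
    also have "\<dots> \<le> (\<integral>\<^sup>+r. ennreal ((norm (p r - Q_infty))\<^sup>2) \<partial>ray)"
      unfolding nn_integral_ray
      using neg d by (intro nn_integral_mono) (auto simp: indicator_def not_less intro!: ennreal_leI power_mono)
    finally show ?thesis .
  qed
  moreover obtain C where "(\<integral>\<^sup>+r. ennreal ((norm (p r - Q_infty))\<^sup>2) \<partial>ray) = ennreal C" "0 \<le> C"
    using fin by (cases "(\<integral>\<^sup>+r. ennreal ((norm (p r - Q_infty))\<^sup>2) \<partial>ray)") auto
  ultimately have "d\<^sup>2 * real n \<le> C" for n by (simp add: ennreal_le_iff)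
  moreover obtain n where "C / d\<^sup>2 < real n" using reals_Archimedean2 by blast
  then have "C < d\<^sup>2 * real n" using d by (simp add: field_simps)
  ultimately show False by (meson not_less)
qed

text \<open>The loss caused by regularising |n_3|, expressed as a factor uniform in n. The
  difference of roots times their sum is (1 - n)(1 + n), and the sum is at most (1 + n)(1 + 2 sqrt
  \<epsilon>).\<close>

lemma sqrt_gap:
  fixes n \<epsilon> :: real
  assumes n: "0 \<le> n" "n \<le> 1" and \<epsilon>: "0 < \<epsilon>"
  shows "(1 - n) / (1 + 2 * sqrt \<epsilon>) \<le> sqrt (\<epsilon> + 1) - sqrt (\<epsilon> + n\<^sup>2)"
proof -
  define a b where "a = sqrt (\<epsilon> + 1)" and "b = sqrt (\<epsilon> + n\<^sup>2)"
  have ab: "a\<^sup>2 = \<epsilon> + 1" "b\<^sup>2 = \<epsilon> + n\<^sup>2" "0 < a" "0 < b"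
    using \<epsilon> by (simp_all add: a_def b_def add_pos_nonneg)
  have "a \<le> sqrt \<epsilon> + 1" "b \<le> sqrt \<epsilon> + n"
    unfolding a_def b_def using \<epsilon> n by (auto intro!: real_le_lsqrt simp: power2_sum)
  moreover have "0 \<le> sqrt \<epsilon> * n" using \<epsilon> n by simp
  ultimately have le: "a + b \<le> (1 + n) * (1 + 2 * sqrt \<epsilon>)"
    by (simp add: algebra_simps)
  have "(1 - n) * (1 + n) = (a - b) * (a + b)"
    using ab by (simp add: power2_eq_square algebra_simps)
  also have "\<dots> \<le> (a - b) * ((1 + n) * (1 + 2 * sqrt \<epsilon>))"
  proof (rule mult_left_mono[OF le])
    have "n\<^sup>2 \<le> 1" using n by (simp add: power_le_one)
    then have "b \<le> a" unfolding a_def b_def by simp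
    then show "0 \<le> a - b" by simp
  qed
  finally have "(1 + n) * (1 - n) \<le> (1 + n) * ((a - b) * (1 + 2 * sqrt \<epsilon>))"
    by (simp add: mult_ac)
  then have "1 - n \<le> (a - b) * (1 + 2 * sqrt \<epsilon>)"
    using n by (subst (asm) mult_le_cancel_left_pos) auto
  moreover have "0 < 1 + 2 * sqrt \<epsilon>" using \<epsilon> by (simp add: add_pos_nonneg)
  ultimately show ?thesis
    unfolding a_def b_def by (simp add: pos_divide_le_eq)
qed

text \<open>At \<delta> = 0 the left side of the inequality is exactly 2, because sqrt(3/2)
  sqrt(2/3) = 1; the rest is continuity.\<close>

lemma calib_parameters:
  assumes "0 < (\<rho>::real)"
  obtains \<delta> :: real where "0 < \<delta>" "\<delta> < 1" "\<delta> \<le> \<rho>"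
    "sqrt (3/2) * (2 * ((1 + \<delta>) * (1 + 2 * \<delta>) / (1 - \<delta>) * (sqrt (2/3) + \<delta>))) \<le> 2 * (1 + \<rho>)"
proof -
  let ?c = "\<lambda>\<delta>::real. sqrt (3/2) * (2 * ((1 + \<delta>) * (1 + 2 * \<delta>) / (1 - \<delta>) * (sqrt (2/3) + \<delta>)))"
  have "sqrt (3/2) * sqrt (2/3) = (1::real)" by (simp flip: real_sqrt_mult)
  then have c0: "?c 0 = 2" by simp
  have "(?c \<longlongrightarrow> ?c 0) (at_right 0)"
    by (intro tendsto_intros) auto
  then have "(?c \<longlongrightarrow> 2) (at_right 0)" unfolding c0 .
  then have "\<forall>\<^sub>F \<delta> in at_right 0. ?c \<delta> < 2 * (1 + \<rho>)"
    using assms by (intro order_tendstoD) auto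
  moreover have "\<forall>\<^sub>F \<delta> in at_right 0. \<delta> \<in> {0<..<min 1 \<rho>}"
    using assms by (intro eventually_at_right_real) auto
  ultimately have "\<forall>\<^sub>F \<delta> in at_right 0. ?c \<delta> < 2 * (1 + \<rho>) \<and> \<delta> \<in> {0<..<min 1 \<rho>}"
    by (rule eventually_conj)
  then obtain \<delta> where "?c \<delta> < 2 * (1 + \<rho>)" "\<delta> \<in> {0<..<min 1 \<rho>}"
    by (auto dest: eventually_happens)
  then show thesis by (intro that[of \<delta>]) auto
qed

text \<open>For large \<mu> the term in f covers every part of the slope estimate that g does not.
  The threshold depends on \<theta> and \<open>g0\<close>, but neither on the curve nor on its
  starting point.\<close>

lemma calibrated_lower_bound:
  assumes \<theta>: "0 < \<theta>" "\<theta> < 1" and g0: "0 \<le> g0"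
  obtains \<Lambda> :: real where "0 < \<Lambda>"
    "\<And>q G n \<mu>. H1_curve q G \<Longrightarrow> norm n = 1 \<Longrightarrow> q 1 = uniaxial n \<Longrightarrow> \<Lambda> \<le> \<mu> \<Longrightarrow>
      ennreal (\<theta> * (surface_constant * (1 - \<bar>n$3\<bar>)))
        \<le> (\<integral>\<^sup>+r. ennreal (1/2 * (norm (G r))\<^sup>2 + \<mu>\<^sup>2 * f_pot (q r) + g_pot g0 (q r)) \<partial>ray)"
proof -
  \<comment> \<open>The factor 1 + \<rho> is lost twice, in the slope estimate and in the
    regularisation, whence (1 + \<rho>)^2 = 1/\<theta>.\<close>
  define \<rho> where "\<rho> = sqrt (1/\<theta>) - 1"
  have "1 < sqrt (1/\<theta>)" using \<theta> by simp
  then have \<rho>: "0 < \<rho>" by (simp add: \<rho>_def)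
  have \<rho>2: "(1 + \<rho>) * (1 + \<rho>) = 1 / \<theta>" using \<theta> by (simp add: \<rho>_def)
  \<comment> \<open>Chosen so that the loss factor 1 + 2 sqrt \<epsilon> of \<open>sqrt_gap\<close>
    equals 1 + \<rho>.\<close>
  define \<epsilon> where "\<epsilon> = (\<rho>/2)\<^sup>2"
  have \<epsilon>: "0 < \<epsilon>" "1 + 2 * sqrt \<epsilon> = 1 + \<rho>" using \<rho> by (simp_all add: \<epsilon>_def)
  obtain \<delta> :: real where \<delta>: "0 < \<delta>" "\<delta> < 1" "\<delta> \<le> \<rho>"
    and c: "sqrt (3/2) * (2 * ((1 + \<delta>) * (1 + 2 * \<delta>) / (1 - \<delta>) * (sqrt (2/3) + \<delta>))) \<le> 2 * (1 + \<rho>)"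
    using calib_parameters[OF \<rho>] by blast
  obtain C where C: "0 \<le> C" "\<And>Q. Q \<in> S0 \<Longrightarrow> (calib_slope \<epsilon> \<delta> Q)\<^sup>2
     \<le> 2 * ((1 + \<delta>) * (1 + 2 * \<delta>) / (1 - \<delta>) * (sqrt (2/3) + \<delta>)) * g_pot g0 Q + C * f_pot Q"
    using calib_slope_sq_le[OF \<epsilon>(1) \<delta>(1,2) g0] by blast
  \<comment> \<open>Half of \<kappa>^2 C is what the slope term demands of f, so \<mu>^2 must exceed
    it; the summand 1 makes the threshold positive.\<close>
  define \<Lambda> where "\<Lambda> = sqrt (sqrt (3/2) * C / 2) + 1"
  have \<Lambda>: "0 < \<Lambda>" using C(1) by (simp add: \<Lambda>_def add_nonneg_pos)
  have \<Lambda>2: "sqrt (3/2) * C / 2 \<le> \<mu>\<^sup>2" if "\<Lambda> \<le> \<mu>" for \<mu>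
  proof -
    have "sqrt (sqrt (3/2) * C / 2) \<le> \<mu>" using that by (simp add: \<Lambda>_def)
    then show ?thesis by (rule sqrt_le_D)
  qed
  define \<Phi> where "\<Phi> = (\<lambda>Q. surface_constant * sqrt (calib \<epsilon> (2/\<delta>) Q))"
  have \<Phi>c: "continuous_on UNIV \<Phi>"
    unfolding \<Phi>_def by (intro continuous_intros continuous_on_calib)
  have \<Phi>u: "\<Phi> (uniaxial n) = surface_constant * sqrt (\<epsilon> + (n$3)\<^sup>2)" if "norm n = 1" for n
    using that by (simp add: \<Phi>_def calib_uniaxial)
  have sc: "0 < surface_constant" by (simp add: surface_constant_def)
  have \<Phi>_inf: "\<Phi> Q_infty = surface_constant * sqrt (\<epsilon> + 1)"
    unfolding Q_infty_def by (subst \<Phi>u) simp_all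
  show thesis
  proof (rule that[OF \<Lambda>])
    fix q G n \<mu>
    assume H: "H1_curve q G" and n: "norm n = 1" and q1: "q 1 = uniaxial n" and \<mu>: "\<Lambda> \<le> \<mu>"
    have m[measurable]: "q \<in> borel_measurable borel" "G \<in> borel_measurable borel"
      and q2: "(\<integral>\<^sup>+r. ennreal ((norm (q r - Q_infty))\<^sup>2) \<partial>ray) < \<infinity>"
      and G2: "(\<integral>\<^sup>+r. ennreal ((norm (G r))\<^sup>2) \<partial>ray) < \<infinity>"
      using H by (auto simp: H1_curve_def)
    obtain W W' where W: "C1_approx q G W W'" using H by (auto simp: H1_curve_def)
    note rep = cont_rep_properties[OF m G2 W]
    define J where "J = (\<integral>\<^sup>+r. ennreal (1/2 * (norm (G r))\<^sup>2 + \<mu>\<^sup>2 * f_pot (q r) + g_pot g0 (q r)) \<partial>ray)"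
    define s where "s = (\<lambda>Q. 1/2 * (sqrt (3/2) * (calib_slope \<epsilon> \<delta> Q)\<^sup>2))"
    have [measurable]: "s \<in> borel_measurable borel"
      unfolding s_def by (intro borel_measurable_continuous_onI continuous_intros continuous_on_calib_slope)
    have sle: "s Q \<le> (1 + \<rho>) * (\<mu>\<^sup>2 * f_pot Q + g_pot g0 Q)" if Q: "Q \<in> S0" for Q
    proof -
      define k where "k = 2 * ((1 + \<delta>) * (1 + 2 * \<delta>) / (1 - \<delta>) * (sqrt (2/3) + \<delta>))"
      have "s Q \<le> 1/2 * (sqrt (3/2) * (k * g_pot g0 Q + C * f_pot Q))"
        unfolding s_def k_def using C(2)[OF Q] by (intro mult_left_mono) auto
      also have "\<dots> = 1/2 * (sqrt (3/2) * k) * g_pot g0 Q + sqrt (3/2) * C / 2 * f_pot Q"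
        by (simp add: algebra_simps)
      also have "\<dots> \<le> 1/2 * (2 * (1 + \<rho>)) * g_pot g0 Q + \<mu>\<^sup>2 * f_pot Q"
        using c \<Lambda>2[OF \<mu>] g_pot_nonneg[OF Q g0] f_pot_nonneg[OF Q]
        by (intro add_mono mult_right_mono mult_left_mono) (auto simp: k_def)
      also have "\<mu>\<^sup>2 * f_pot Q \<le> (1 + \<rho>) * (\<mu>\<^sup>2 * f_pot Q)"
        using f_pot_nonneg[OF Q] \<rho> mult_right_mono[of 1 "1 + \<rho>" "\<mu>\<^sup>2 * f_pot Q"] by simp
      finally show ?thesis by (simp add: algebra_simps)
    qed
    have inc: "ennreal (\<Phi> (cont_rep q G T) - \<Phi> (q 1)) \<le> ennreal (1 + \<rho>) * J" if T: "1 \<le> T" for T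
    proof -
      have "ennreal (\<Phi> (cont_rep q G T) - \<Phi> (q 1))
        \<le> (\<integral>\<^sup>+r. ennreal ((1 + \<delta>)/2 * (norm (G r))\<^sup>2) \<partial>ray) + (\<integral>\<^sup>+r. ennreal (s (q r)) \<partial>ray)"
        unfolding \<Phi>_def s_def by (rule calib_increment_le_curve[OF m G2 W T \<epsilon>(1) \<delta>(1,2)])
      also have "\<dots> = (\<integral>\<^sup>+r. ennreal ((1 + \<delta>)/2 * (norm (G r))\<^sup>2) + ennreal (s (q r)) \<partial>ray)"
        by (rule nn_integral_add[symmetric]) measurable
      also have "\<dots> \<le> (\<integral>\<^sup>+r. ennreal (1 + \<rho>) * ennreal (1/2 * (norm (G r))\<^sup>2 + \<mu>\<^sup>2 * f_pot (q r) + g_pot g0 (q r)) \<partial>ray)"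
      proof (rule nn_integral_mono_AE)
        have "AE r in ray. 1 < r" by (simp add: AE_ray)
        with rep(3) show "AE r in ray. ennreal ((1 + \<delta>)/2 * (norm (G r))\<^sup>2) + ennreal (s (q r))
            \<le> ennreal (1 + \<rho>) * ennreal (1/2 * (norm (G r))\<^sup>2 + \<mu>\<^sup>2 * f_pot (q r) + g_pot g0 (q r))"
        proof eventually_elim
          case (elim r)
          have S: "q r \<in> S0" using rep(2)[of r] elim by simp
          have "(1 + \<delta>)/2 * (norm (G r))\<^sup>2 \<le> (1 + \<rho>)/2 * (norm (G r))\<^sup>2"
            using \<delta>(3) by (intro mult_right_mono) auto
          then have "(1 + \<delta>)/2 * (norm (G r))\<^sup>2 + s (q r)
              \<le> (1 + \<rho>)/2 * (norm (G r))\<^sup>2 + (1 + \<rho>) * (\<mu>\<^sup>2 * f_pot (q r) + g_pot g0 (q r))"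
            using sle[OF S] by (rule add_mono)
          also have "\<dots> = (1 + \<rho>) * (1/2 * (norm (G r))\<^sup>2 + \<mu>\<^sup>2 * f_pot (q r) + g_pot g0 (q r))"
            by (simp add: algebra_simps)
          finally have "ennreal ((1 + \<delta>)/2 * (norm (G r))\<^sup>2 + s (q r))
              \<le> ennreal ((1 + \<rho>) * (1/2 * (norm (G r))\<^sup>2 + \<mu>\<^sup>2 * f_pot (q r) + g_pot g0 (q r)))"
            by (rule ennreal_leI)
          moreover have "ennreal ((1 + \<delta>)/2 * (norm (G r))\<^sup>2 + s (q r)) = ennreal ((1 + \<delta>)/2 * (norm (G r))\<^sup>2) + ennreal (s (q r))"
            using \<delta> by (intro ennreal_plus) (auto simp: s_def)
          moreover have "ennreal ((1 + \<rho>) * (1/2 * (norm (G r))\<^sup>2 + \<mu>\<^sup>2 * f_pot (q r) + g_pot g0 (q r)))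
              = ennreal (1 + \<rho>) * ennreal (1/2 * (norm (G r))\<^sup>2 + \<mu>\<^sup>2 * f_pot (q r) + g_pot g0 (q r))"
            using \<rho> by (intro ennreal_mult') simp
          ultimately show ?case by (simp only:)
        qed
      qed
      also have "\<dots> \<le> ennreal (1 + \<rho>) * J"
        unfolding J_def by (subst nn_integral_cmult) simp_all
      finally show ?thesis .
    qed
    \<comment> \<open>A finite T at which the curve is close to \<open>Q_infty\<close> already gives
      the full increment up to e.\<close>
    have "ennreal (\<Phi> Q_infty - \<Phi> (q 1)) \<le> ennreal (1 + \<rho>) * J"
    proof (rule ennreal_le_epsilon)
      fix e :: real assume e: "0 < e"
      have "continuous (at Q_infty) \<Phi>" using \<Phi>c by (simp add: continuous_on_eq_continuous_at)
      then obtain d where d: "0 < d" "\<And>Q. dist Q Q_infty < d \<Longrightarrow> dist (\<Phi> Q) (\<Phi> Q_infty) < e"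
        unfolding continuous_at_eps_delta dist_norm using e by metis
      have "(\<integral>\<^sup>+r. ennreal ((norm (cont_rep q G r - Q_infty))\<^sup>2) \<partial>ray) = (\<integral>\<^sup>+r. ennreal ((norm (q r - Q_infty))\<^sup>2) \<partial>ray)"
        by (rule nn_integral_cong_AE) (use rep(3) in \<open>eventually_elim, simp\<close>)
      then obtain T where T: "1 \<le> T" "norm (cont_rep q G T - Q_infty) < d"
        using exists_near_Q_infty[OF rep(1) _ d(1)] q2 by auto
      then have "\<Phi> Q_infty - \<Phi> (q 1) \<le> (\<Phi> (cont_rep q G T) - \<Phi> (q 1)) + e"
        using d(2)[of "cont_rep q G T"] by (simp add: dist_norm)
      then have "ennreal (\<Phi> Q_infty - \<Phi> (q 1)) \<le> ennreal ((\<Phi> (cont_rep q G T) - \<Phi> (q 1)) + e)"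
        by (rule ennreal_leI)
      also have "\<dots> \<le> ennreal (\<Phi> (cont_rep q G T) - \<Phi> (q 1)) + ennreal e"
        using e by (cases "0 \<le> \<Phi> (cont_rep q G T) - \<Phi> (q 1)") (auto simp: ennreal_neg intro!: ennreal_leI simp flip: ennreal_plus)
      also have "\<dots> \<le> ennreal (1 + \<rho>) * J + ennreal e"
        by (intro add_right_mono inc T)
      finally show "ennreal (\<Phi> Q_infty - \<Phi> (q 1)) \<le> ennreal (1 + \<rho>) * J + ennreal e" .
    qed
    moreover have "surface_constant * ((1 - \<bar>n$3\<bar>) / (1 + \<rho>)) \<le> \<Phi> Q_infty - \<Phi> (q 1)"
    proof -
      have "\<bar>n$3\<bar> \<le> 1" using component_le_norm_cart[of n 3] n by simp
      then have "(1 - \<bar>n$3\<bar>) / (1 + \<rho>) \<le> sqrt (\<epsilon> + 1) - sqrt (\<epsilon> + (n$3)\<^sup>2)"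
        using sqrt_gap[of "\<bar>n$3\<bar>" \<epsilon>] \<epsilon> by simp
      then have "surface_constant * ((1 - \<bar>n$3\<bar>) / (1 + \<rho>)) \<le> surface_constant * (sqrt (\<epsilon> + 1) - sqrt (\<epsilon> + (n$3)\<^sup>2))"
        using sc by (intro mult_left_mono) auto
      then show ?thesis unfolding \<Phi>_inf q1 \<Phi>u[OF n] by (simp add: right_diff_distrib)
    qed
    ultimately have le: "ennreal (surface_constant * ((1 - \<bar>n$3\<bar>) / (1 + \<rho>))) \<le> ennreal (1 + \<rho>) * J"
      by (meson ennreal_leI order_trans)
    have "\<theta> * (surface_constant * (1 - \<bar>n$3\<bar>)) = (1 / (1 + \<rho>)) * (surface_constant * ((1 - \<bar>n$3\<bar>) / (1 + \<rho>)))"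
    proof -
      have "\<theta> = 1 / ((1 + \<rho>) * (1 + \<rho>))" using \<rho>2 by simp
      then show ?thesis by (simp add: ac_simps)
    qed
    then have "ennreal (\<theta> * (surface_constant * (1 - \<bar>n$3\<bar>)))
        = ennreal (1 / (1 + \<rho>)) * ennreal (surface_constant * ((1 - \<bar>n$3\<bar>) / (1 + \<rho>)))"
      using \<rho> by (simp only:) (rule ennreal_mult', simp)
    also have "\<dots> \<le> ennreal (1 / (1 + \<rho>)) * (ennreal (1 + \<rho>) * J)"
      by (intro mult_left_mono le) simp
    also have "\<dots> = J"
    proof -
      have "ennreal (1 / (1 + \<rho>)) * ennreal (1 + \<rho>) = 1"
        using \<rho> by (subst ennreal_mult[symmetric]) auto
      then show ?thesis by (simp flip: mult.assoc)
    qed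
    finally show "ennreal (\<theta> * (surface_constant * (1 - \<bar>n$3\<bar>)))
        \<le> (\<integral>\<^sup>+r. ennreal (1/2 * (norm (G r))\<^sup>2 + \<mu>\<^sup>2 * f_pot (q r) + g_pot g0 (q r)) \<partial>ray)"
      unfolding J_def .
  qed
qed

section \<open>Rescaling, and comparison with the minimal one-dimensional energy\<close>

lemma nn_integral_ray_scale:
  assumes F[measurable]: "F \<in> borel_measurable borel" and \<eta>: "0 < \<eta>"
  shows "(\<integral>\<^sup>+r. F (1 + \<eta> * (r - 1)) \<partial>ray) = ennreal (1/\<eta>) * (\<integral>\<^sup>+r. F r \<partial>ray)"
proof -
  have "(\<integral>\<^sup>+r. F r \<partial>ray) = ennreal \<eta> * (\<integral>\<^sup>+r. F (1 - \<eta> + \<eta> * r) * indicator {1<..} (1 - \<eta> + \<eta> * r) \<partial>lborel)"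
    unfolding nn_integral_ray using \<eta>
    by (subst nn_integral_real_affine[of _ \<eta> "1 - \<eta>"]) auto
  also have "(\<integral>\<^sup>+r. F (1 - \<eta> + \<eta> * r) * indicator {1<..} (1 - \<eta> + \<eta> * r) \<partial>lborel) = (\<integral>\<^sup>+r. F (1 + \<eta> * (r - 1)) \<partial>ray)"
    unfolding nn_integral_ray
  proof (rule nn_integral_cong)
    fix r
    have e: "1 - \<eta> + \<eta> * r = 1 + \<eta> * (r - 1)" by (simp add: algebra_simps)
    show "F (1 - \<eta> + \<eta> * r) * indicator {1<..} (1 - \<eta> + \<eta> * r) = F (1 + \<eta> * (r - 1)) * indicator {1<..} r"
      unfolding e using \<eta> by (simp add: indicator_def zero_less_mult_iff)
  qed
  finally have "(\<integral>\<^sup>+r. F r \<partial>ray) = ennreal \<eta> * (\<integral>\<^sup>+r. F (1 + \<eta> * (r - 1)) \<partial>ray)" .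
  moreover have "ennreal (1/\<eta>) * ennreal \<eta> = 1"
    using \<eta> by (subst ennreal_mult[symmetric]) auto
  ultimately show ?thesis by (simp flip: mult.assoc)
qed

text \<open>The substitution fixes the point 1, so the trace is kept, and the L2 norms change by
  powers of \<eta> only.\<close>

lemma H1_curve_scale:
  assumes H: "H1_curve q G" and \<eta>: "0 < \<eta>"
  shows "H1_curve (\<lambda>r. q (1 + \<eta> * (r - 1))) (\<lambda>r. \<eta> *\<^sub>R G (1 + \<eta> * (r - 1)))"
proof -
  have m[measurable]: "q \<in> borel_measurable borel" "G \<in> borel_measurable borel"
    and q2: "(\<integral>\<^sup>+r. ennreal ((norm (q r - Q_infty))\<^sup>2) \<partial>ray) < \<infinity>"
    and G2: "(\<integral>\<^sup>+r. ennreal ((norm (G r))\<^sup>2) \<partial>ray) < \<infinity>"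
    using H by (auto simp: H1_curve_def)
  obtain W W' where W: "C1_approx q G W W'" using H by (auto simp: H1_curve_def)
  have d: "(W k has_vector_derivative W' k r) (at r)" and c: "continuous_on UNIV (W' k)" for k r
    using W by (auto simp: C1_approx_def)
  have Wc: "continuous_on UNIV (W k)" for k
    using d by (intro continuous_at_imp_continuous_on ballI has_vector_derivative_continuous) auto
  have [measurable]: "W k \<in> borel_measurable borel" "W' k \<in> borel_measurable borel" for k
    by (intro borel_measurable_continuous_onI Wc c)+
  have sq: "(\<integral>\<^sup>+r. ennreal ((norm (\<eta> *\<^sub>R g (1 + \<eta> * (r - 1))))\<^sup>2) \<partial>ray)
      = ennreal (1/\<eta>) * (ennreal (\<eta>\<^sup>2) * (\<integral>\<^sup>+r. ennreal ((norm (g r))\<^sup>2) \<partial>ray))"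
    if [measurable]: "g \<in> borel_measurable borel" for g :: "real \<Rightarrow> real^3^3"
  proof -
    have "(\<integral>\<^sup>+r. ennreal ((norm (\<eta> *\<^sub>R g (1 + \<eta> * (r - 1))))\<^sup>2) \<partial>ray)
        = (\<integral>\<^sup>+r. ennreal (\<eta>\<^sup>2) * ennreal ((norm (g (1 + \<eta> * (r - 1))))\<^sup>2) \<partial>ray)"
      by (intro nn_integral_cong) (simp add: power_mult_distrib ennreal_mult)
    also have "\<dots> = ennreal (1/\<eta>) * (\<integral>\<^sup>+r. ennreal (\<eta>\<^sup>2) * ennreal ((norm (g r))\<^sup>2) \<partial>ray)"
      by (rule nn_integral_ray_scale[OF _ \<eta>]) measurable
    finally show ?thesis by (simp add: nn_integral_cmult)
  qed
  have "C1_approx (\<lambda>r. q (1 + \<eta> * (r - 1))) (\<lambda>r. \<eta> *\<^sub>R G (1 + \<eta> * (r - 1)))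
      (\<lambda>k r. W k (1 + \<eta> * (r - 1))) (\<lambda>k r. \<eta> *\<^sub>R W' k (1 + \<eta> * (r - 1)))"
    unfolding C1_approx_def
  proof (intro conjI allI)
    fix k r
    have "((\<lambda>r. 1 + \<eta> * (r - 1)) has_vector_derivative \<eta>) (at r)"
      by (auto intro!: derivative_eq_intros)
    from vector_diff_chain_at[OF this d]
    show "((\<lambda>r. W k (1 + \<eta> * (r - 1))) has_vector_derivative \<eta> *\<^sub>R W' k (1 + \<eta> * (r - 1))) (at r)"
      by (simp add: o_def)
    show "continuous_on UNIV (\<lambda>r. \<eta> *\<^sub>R W' k (1 + \<eta> * (r - 1)))"
      by (intro continuous_intros continuous_on_compose2[OF c]) auto
    show "W k (1 + \<eta> * (r - 1)) \<in> S0" using W by (simp add: C1_approx_def)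
  next
    show "(\<lambda>k. W k (1 + \<eta> * (1 - 1))) \<longlonglongrightarrow> q (1 + \<eta> * (1 - 1))"
      using W by (simp add: C1_approx_def)
    have "(\<lambda>k. ennreal (1/\<eta>) * (\<integral>\<^sup>+r. ennreal ((norm (W k r - q r))\<^sup>2) \<partial>ray)) \<longlonglongrightarrow> ennreal (1/\<eta>) * 0"
      using W by (intro tendsto_mult_ennreal tendsto_const) (auto simp: C1_approx_def)
    moreover have "(\<integral>\<^sup>+r. ennreal ((norm (W k (1 + \<eta> * (r - 1)) - q (1 + \<eta> * (r - 1))))\<^sup>2) \<partial>ray)
        = ennreal (1/\<eta>) * (\<integral>\<^sup>+r. ennreal ((norm (W k r - q r))\<^sup>2) \<partial>ray)" for k
      by (rule nn_integral_ray_scale[OF _ \<eta>]) measurable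
    ultimately show "(\<lambda>k. \<integral>\<^sup>+r. ennreal ((norm (W k (1 + \<eta> * (r - 1)) - q (1 + \<eta> * (r - 1))))\<^sup>2) \<partial>ray) \<longlonglongrightarrow> 0"
      by simp
    have "(\<lambda>k. ennreal (1/\<eta>) * (ennreal (\<eta>\<^sup>2) * (\<integral>\<^sup>+r. ennreal ((norm (W' k r - G r))\<^sup>2) \<partial>ray))) \<longlonglongrightarrow> ennreal (1/\<eta>) * (ennreal (\<eta>\<^sup>2) * 0)"
      using W by (intro tendsto_mult_ennreal tendsto_const) (auto simp: C1_approx_def)
    moreover have "(\<integral>\<^sup>+r. ennreal ((norm (\<eta> *\<^sub>R W' k (1 + \<eta> * (r - 1)) - \<eta> *\<^sub>R G (1 + \<eta> * (r - 1))))\<^sup>2) \<partial>ray)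
        = ennreal (1/\<eta>) * (ennreal (\<eta>\<^sup>2) * (\<integral>\<^sup>+r. ennreal ((norm (W' k r - G r))\<^sup>2) \<partial>ray))" for k
      using sq[of "\<lambda>r. W' k r - G r"] by (simp add: scaleR_diff_right)
    ultimately show "(\<lambda>k. \<integral>\<^sup>+r. ennreal ((norm (\<eta> *\<^sub>R W' k (1 + \<eta> * (r - 1)) - \<eta> *\<^sub>R G (1 + \<eta> * (r - 1))))\<^sup>2) \<partial>ray) \<longlonglongrightarrow> 0"
      by simp
  qed
  moreover have "(\<integral>\<^sup>+r. ennreal ((norm (q (1 + \<eta> * (r - 1)) - Q_infty))\<^sup>2) \<partial>ray) < \<infinity>"
    using q2 nn_integral_ray_scale[of "\<lambda>r. ennreal ((norm (q r - Q_infty))\<^sup>2)", OF _ \<eta>]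
    by (simp add: ennreal_mult_less_top)
  moreover have "(\<integral>\<^sup>+r. ennreal ((norm (\<eta> *\<^sub>R G (1 + \<eta> * (r - 1))))\<^sup>2) \<partial>ray) < \<infinity>"
    unfolding sq[OF m(2)] using G2 by (simp add: ennreal_mult_less_top)
  moreover have "(\<lambda>r. q (1 + \<eta> * (r - 1))) \<in> borel_measurable borel"
    "(\<lambda>r. \<eta> *\<^sub>R G (1 + \<eta> * (r - 1))) \<in> borel_measurable borel"
    by measurable
  ultimately show ?thesis
    unfolding H1_curve_def by blast
qed

text \<open>One index threshold serves all curves. At \<lambda> = \<infinity> the rotating director
  and the calibration meet at the same explicit value; for finite \<lambda> each term of the
  integrand, multiplied by \<theta>, is at most its counterpart with \<mu>.\<close>

lemma eventually_D_min_le_energy: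
  fixes \<mu> :: "'i \<Rightarrow> real"
  assumes lim: "((\<lambda>i. ennreal (\<mu> i)) \<longlongrightarrow> l) F" and pos: "\<forall>\<^sub>F i in F. 0 < \<mu> i"
    and \<theta>: "0 < \<theta>" "\<theta> < 1" and g0: "0 \<le> g0"
  shows "\<forall>\<^sub>F i in F. \<forall>q G n. H1_curve q G \<longrightarrow> norm n = 1 \<longrightarrow> q 1 = uniaxial n \<longrightarrow>
    ennreal \<theta> * D_min g0 l (uniaxial n)
      \<le> (\<integral>\<^sup>+r. ennreal (1/2 * (norm (G r))\<^sup>2 + (\<mu> i)\<^sup>2 * f_pot (q r) + g_pot g0 (q r)) \<partial>ray)"
proof (cases "l = \<infinity>")
  case True
  obtain \<Lambda> :: real where \<Lambda>: "0 < \<Lambda>"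
    "\<And>q G n \<mu>. H1_curve q G \<Longrightarrow> norm n = 1 \<Longrightarrow> q 1 = uniaxial n \<Longrightarrow> \<Lambda> \<le> \<mu> \<Longrightarrow>
      ennreal (\<theta> * (surface_constant * (1 - \<bar>n$3\<bar>)))
        \<le> (\<integral>\<^sup>+r. ennreal (1/2 * (norm (G r))\<^sup>2 + \<mu>\<^sup>2 * f_pot (q r) + g_pot g0 (q r)) \<partial>ray)"
    using calibrated_lower_bound[OF \<theta> g0] by blast
  have "\<forall>\<^sub>F i in F. ennreal \<Lambda> < ennreal (\<mu> i)"
    using lim True by (intro order_tendstoD(1)) auto
  then show ?thesis
  proof eventually_elim
    case (elim i)
    then have le: "\<Lambda> \<le> \<mu> i" using \<Lambda>(1) by (simp add: ennreal_less_iff)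
    show ?case
    proof (intro allI impI)
      fix q G :: "real \<Rightarrow> real^3^3" and n :: "real^3"
      assume H: "H1_curve q G" "norm n = 1" "q 1 = uniaxial n"
      have "ennreal \<theta> * D_min g0 l (uniaxial n) \<le> ennreal \<theta> * ennreal (surface_constant * (1 - \<bar>n$3\<bar>))"
        unfolding True by (intro mult_left_mono D_min_infinity_le H) simp
      also have "\<dots> = ennreal (\<theta> * (surface_constant * (1 - \<bar>n$3\<bar>)))"
        using \<theta> by (simp add: ennreal_mult')
      also have "\<dots> \<le> (\<integral>\<^sup>+r. ennreal (1/2 * (norm (G r))\<^sup>2 + (\<mu> i)\<^sup>2 * f_pot (q r) + g_pot g0 (q r)) \<partial>ray)"
        by (rule \<Lambda>(2)[OF H le])
      finally show "ennreal \<theta> * D_min g0 l (uniaxial n)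
        \<le> (\<integral>\<^sup>+r. ennreal (1/2 * (norm (G r))\<^sup>2 + (\<mu> i)\<^sup>2 * f_pot (q r) + g_pot g0 (q r)) \<partial>ray)" .
    qed
  qed
next
  case False
  define lam where "lam = enn2real l"
  have l: "l = ennreal lam" "0 \<le> lam" using False by (simp_all add: lam_def less_top)
  have "\<forall>\<^sub>F i in F. sqrt \<theta> * lam \<le> \<mu> i"
  \<comment> \<open>At \<lambda> = 0 there is no room strictly below the limit, and positivity of
    \<mu> takes over. The root of \<theta> appears because \<lambda> enters the energy
    squared.\<close>
  proof (cases "lam = 0")
    case True
    show ?thesis using pos by eventually_elim (use True in simp)
  next
    case False
    have "sqrt \<theta> < 1" using \<theta> by simp
    then have "sqrt \<theta> * lam < lam" using False l(2) by simp
    then have "\<forall>\<^sub>F i in F. ennreal (sqrt \<theta> * lam) < ennreal (\<mu> i)"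
      using lim l \<theta> by (intro order_tendstoD(1)) (auto simp: ennreal_less_iff)
    then show ?thesis
      by eventually_elim (use \<theta> l(2) in \<open>simp add: ennreal_less_iff\<close>)
  qed
  then show ?thesis
  proof eventually_elim
    case (elim i)
    have "(sqrt \<theta> * lam)\<^sup>2 \<le> (\<mu> i)\<^sup>2" using elim \<theta> l(2) by (intro power_mono) auto
    then have \<mu>: "\<theta> * lam\<^sup>2 \<le> (\<mu> i)\<^sup>2" using \<theta> by (simp add: power_mult_distrib)
    show ?case
    proof (intro allI impI)
      fix q G :: "real \<Rightarrow> real^3^3" and n :: "real^3"
      assume H: "H1_curve q G" "norm n = 1" "q 1 = uniaxial n"
      have m[measurable]: "q \<in> borel_measurable borel" "G \<in> borel_measurable borel"
        and G2: "(\<integral>\<^sup>+r. ennreal ((norm (G r))\<^sup>2) \<partial>ray) < \<infinity>"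
        using H by (auto simp: H1_curve_def)
      obtain W W' where W: "C1_approx q G W W'" using H by (auto simp: H1_curve_def)
      note rep = cont_rep_properties[OF m G2 W]
      have "ennreal \<theta> * D_min g0 l (uniaxial n)
          \<le> ennreal \<theta> * (\<integral>\<^sup>+r. ennreal (1/2 * (norm (G r))\<^sup>2 + lam\<^sup>2 * f_pot (q r) + g_pot g0 (q r)) \<partial>ray)"
        using D_min_le_energy(1)[OF H(1) False, of g0] by (intro mult_left_mono) (auto simp: H(3) lam_def)
      also have "\<dots> = (\<integral>\<^sup>+r. ennreal \<theta> * ennreal (1/2 * (norm (G r))\<^sup>2 + lam\<^sup>2 * f_pot (q r) + g_pot g0 (q r)) \<partial>ray)"
        by (rule nn_integral_cmult[symmetric]) measurable
      also have "\<dots> \<le> (\<integral>\<^sup>+r. ennreal (1/2 * (norm (G r))\<^sup>2 + (\<mu> i)\<^sup>2 * f_pot (q r) + g_pot g0 (q r)) \<partial>ray)"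
      proof (rule nn_integral_mono_AE)
        have "AE r in ray. 1 < r" by (simp add: AE_ray)
        with rep(3) show "AE r in ray. ennreal \<theta> * ennreal (1/2 * (norm (G r))\<^sup>2 + lam\<^sup>2 * f_pot (q r) + g_pot g0 (q r))
          \<le> ennreal (1/2 * (norm (G r))\<^sup>2 + (\<mu> i)\<^sup>2 * f_pot (q r) + g_pot g0 (q r))"
        proof eventually_elim
          case (elim r)
          have S: "q r \<in> S0" using rep(2)[of r] elim by simp
          have "\<theta> * (1/2 * (norm (G r))\<^sup>2) \<le> 1 * (1/2 * (norm (G r))\<^sup>2)"
            using \<theta> by (intro mult_right_mono) auto
          moreover have "\<theta> * g_pot g0 (q r) \<le> 1 * g_pot g0 (q r)"
            using \<theta> g_pot_nonneg[OF S g0] by (intro mult_right_mono) auto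
          moreover have "\<theta> * lam\<^sup>2 * f_pot (q r) \<le> (\<mu> i)\<^sup>2 * f_pot (q r)"
            using f_pot_nonneg[OF S] by (intro mult_right_mono \<mu>)
          ultimately have "\<theta> * (1/2 * (norm (G r))\<^sup>2 + lam\<^sup>2 * f_pot (q r) + g_pot g0 (q r))
              \<le> 1/2 * (norm (G r))\<^sup>2 + (\<mu> i)\<^sup>2 * f_pot (q r) + g_pot g0 (q r)"
            by (simp add: algebra_simps)
          then show ?case using \<theta> by (simp add: ennreal_leI flip: ennreal_mult')
        qed
      qed
      finally show "ennreal \<theta> * D_min g0 l (uniaxial n)
        \<le> (\<integral>\<^sup>+r. ennreal (1/2 * (norm (G r))\<^sup>2 + (\<mu> i)\<^sup>2 * f_pot (q r) + g_pot g0 (q r)) \<partial>ray)" .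
    qed
  qed
qed

section \<open>Restriction to rays\<close>

text \<open>Indices with integrals below 2^(-j) make the sum of the selected functions finite almost
  everywhere, so its terms tend to 0. The selection is not claimed to be increasing.\<close>

lemma AE_subseq_tendsto_0:
  fixes X :: "nat \<Rightarrow> 'a \<Rightarrow> ennreal"
  assumes [measurable]: "\<And>k. X k \<in> borel_measurable M" and lim: "(\<lambda>k. \<integral>\<^sup>+x. X k x \<partial>M) \<longlonglongrightarrow> 0"
  obtains s :: "nat \<Rightarrow> nat" where "AE x in M. (\<lambda>j. X (s j) x) \<longlonglongrightarrow> 0"
proof -
  have "\<exists>k. (\<integral>\<^sup>+x. X k x \<partial>M) < ennreal ((1/2)^j)" for j :: nat
    using order_tendstoD(2)[OF lim, of "ennreal ((1/2)^j)"] by (auto dest: eventually_happens)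
  then obtain s where s: "\<And>j. (\<integral>\<^sup>+x. X (s j) x \<partial>M) < ennreal ((1/2)^j)" by metis
  have "(\<integral>\<^sup>+x. (\<Sum>j. X (s j) x) \<partial>M) = (\<Sum>j. \<integral>\<^sup>+x. X (s j) x \<partial>M)"
    by (rule nn_integral_suminf) measurable
  also have "\<dots> \<le> (\<Sum>j. ennreal ((1/2)^j))"
    using s by (intro suminf_le) (auto intro: less_imp_le)
  also have "\<dots> = ennreal (\<Sum>j. (1/2)^j)"
    by (intro suminf_ennreal2) (auto intro: summable_geometric)
  also have "\<dots> < \<infinity>" by simp
  finally have "AE x in M. (\<Sum>j. X (s j) x) \<noteq> \<infinity>"
    by (intro nn_integral_noteq_infinite) auto
  then have "AE x in M. (\<lambda>j. X (s j) x) \<longlonglongrightarrow> 0"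
  proof eventually_elim
    case (elim x)
    have fin: "X (s j) x \<noteq> \<infinity>" for j
    proof
      assume "X (s j) x = \<infinity>"
      then show False using elim sum_le_suminf[of "\<lambda>j. X (s j) x" "{j}"] by (simp add: top_unique)
    qed
    define f where "f j = enn2real (X (s j) x)" for j
    have f: "X (s j) x = ennreal (f j)" for j using fin[of j] by (simp add: f_def less_top)
    have "summable f"
    proof (rule summable_suminf_not_top)
      show "0 \<le> f j" for j by (simp add: f_def)
      show "(\<Sum>j. ennreal (f j)) \<noteq> top" using elim by (simp flip: f)
    qed
    then have "(\<lambda>j. ennreal (f j)) \<longlonglongrightarrow> ennreal 0"
      by (intro tendsto_ennrealI summable_LIMSEQ_zero)
    then show ?case by (simp add: f)
  qed
  then show thesis by (rule that)
qed

lemma space_sphere_measure [simp]: "space sphere_measure = sphere 0 1"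
  by (simp add: sphere_measure_def space_restrict_space hausdorff2_def)

lemma measurable_sphere_measure:
  "f \<in> measurable borel N \<Longrightarrow> f \<in> measurable sphere_measure N"
  unfolding sphere_measure_def
  by (intro measurable_completion measurable_restrict_space1) (simp cong: measurable_cong_sets)

lemma exterior_domain_borel [measurable]: "exterior_domain \<in> sets borel"
  by (simp add: exterior_domain_def)

lemma nn_integral_rays_le:
  fixes h :: "real^3 \<Rightarrow> ennreal"
  assumes "h \<in> borel_measurable borel"
  shows "(\<integral>\<^sup>+\<omega>. (\<integral>\<^sup>+t. h (t *\<^sub>R \<omega>) \<partial>ray) \<partial>sphere_measure) \<le> (\<integral>\<^sup>+x\<in>exterior_domain. h x \<partial>lborel)"
  unfolding nn_integral_ray by (rule ray_integral_le[OF assms])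

lemma measurable_ray_integral [measurable]:
  fixes h :: "real^3 \<Rightarrow> ennreal"
  assumes [measurable]: "h \<in> borel_measurable borel"
  shows "(\<lambda>\<omega>. \<integral>\<^sup>+t. h (t *\<^sub>R \<omega>) \<partial>ray) \<in> borel_measurable borel"
  unfolding nn_integral_ray by measurable

text \<open>The sum is the derivative in the unit direction \<omega>; its tangential complement is
  discarded.\<close>

lemma norm_sum_Basis_le:
  fixes d :: "'a::euclidean_space \<Rightarrow> 'b::real_normed_vector"
  assumes "norm \<omega> = 1"
  shows "(norm (\<Sum>e\<in>Basis. (\<omega> \<bullet> e) *\<^sub>R d e))\<^sup>2 \<le> (\<Sum>e\<in>Basis. (norm (d e))\<^sup>2)"
proof -
  have "norm (\<Sum>e\<in>Basis. (\<omega> \<bullet> e) *\<^sub>R d e) \<le> (\<Sum>e\<in>Basis. \<bar>\<omega> \<bullet> e\<bar> * norm (d e))"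
    using norm_sum[of "\<lambda>e. (\<omega> \<bullet> e) *\<^sub>R d e" Basis] by simp
  then have "(norm (\<Sum>e\<in>Basis. (\<omega> \<bullet> e) *\<^sub>R d e))\<^sup>2 \<le> (\<Sum>e\<in>Basis. \<bar>\<omega> \<bullet> e\<bar> * norm (d e))\<^sup>2"
    by (intro power_mono) auto
  also have "\<dots> \<le> (\<Sum>e\<in>Basis. \<bar>\<omega> \<bullet> e\<bar>\<^sup>2) * (\<Sum>e\<in>Basis. (norm (d e))\<^sup>2)"
    by (rule Cauchy_Schwarz_ineq_sum)
  also have "(\<Sum>e\<in>Basis. \<bar>\<omega> \<bullet> e\<bar>\<^sup>2) = (norm \<omega>)\<^sup>2"
    unfolding power2_norm_eq_inner euclidean_inner[of \<omega> \<omega>] by (simp add: power2_eq_square)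
  finally show ?thesis using assms by simp
qed

text \<open>A Lebesgue measurable function may lose its measurability when restricted to a ray,
  whereas a Borel function keeps it.\<close>

lemma lebesgue_on_borel_version:
  fixes u :: "'a::euclidean_space \<Rightarrow> 'b::euclidean_space"
  assumes "u \<in> borel_measurable (lebesgue_on \<Omega>)" and \<Omega>: "\<Omega> \<in> sets borel"
  shows "\<exists>u'\<in>borel_measurable borel. AE x in lebesgue. x \<in> \<Omega> \<longrightarrow> u' x = u x"
proof -
  have "(\<lambda>x. indicator \<Omega> x *\<^sub>R u x) \<in> borel_measurable lebesgue"
    using assms by (subst borel_measurable_restrict_space_iff[symmetric]) auto
  then obtain u' where u': "u' \<in> borel_measurable lborel" "AE x in lborel. indicator \<Omega> x *\<^sub>R u x = u' x"
    using completion_ex_borel_measurable_euclidean by blast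
  from AE_completion[OF u'(2)] have "AE x in lebesgue. x \<in> \<Omega> \<longrightarrow> u' x = u x"
    by eventually_elim auto
  then show ?thesis using u'(1) by (intro bexI[of _ u']) auto
qed

text \<open>The functions that define the trace approximate Q in H1 of the exterior domain and
  \<open>Qb\<close> on the sphere at the same time. Integrated over all rays, the errors along rays
  are bounded by those in the domain, so for a suitable selection of indices they vanish on almost
  every ray. There the restricted functions witness \<open>C1_approx\<close> with end point value
  \<open>Qb\<close>.\<close>

lemma rays_of_admissible:
  assumes Q: "Q \<in> admissible Qb" and Qb: "Qb \<in> borel_measurable sphere_measure"
    and Qb_S0: "\<And>\<omega>. \<omega> \<in> sphere 0 1 \<Longrightarrow> Qb \<omega> \<in> S0"
  obtains QB GB where "QB \<in> borel_measurable borel" "\<And>e. e \<in> Basis \<Longrightarrow> GB e \<in> borel_measurable borel"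
    "\<And>x. QB x \<in> S0"
    "AE x in lebesgue. x \<in> exterior_domain \<longrightarrow> QB x = Q x \<and> (\<forall>e\<in>Basis. GB e x = weak_gradient exterior_domain Q e x)"
    "AE \<omega> in sphere_measure. \<exists>q G. H1_curve q G \<and> q 1 = Qb \<omega> \<and>
       (\<forall>t>1. q t = QB (t *\<^sub>R \<omega>) \<and> (norm (G t))\<^sup>2 \<le> (\<Sum>e\<in>Basis. (norm (GB e (t *\<^sub>R \<omega>)))\<^sup>2))"
proof -
  let ?E = "exterior_domain"
  let ?wg = "weak_gradient ?E Q"
  have H1: "(\<lambda>x. Q x - Q_infty) \<in> H1 ?E S0" and tr: "has_trace Q Qb"
    using Q by (auto simp: admissible_def)
  have L2: "L2_fun (lebesgue_on ?E) (\<lambda>x. Q x - Q_infty)" using H1 by (simp add: H1_def)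
  obtain G0 where "has_weak_gradient ?E (\<lambda>x. Q x - Q_infty) G0" using H1 by (auto simp: H1_def)
  then have "has_weak_gradient ?E Q G0"
    by (rule has_weak_gradient_add_const[OF _ L2]) simp
  then have "has_weak_gradient ?E Q ?wg"
    unfolding weak_gradient_def by (rule someI[where P="has_weak_gradient ?E Q"])
  then have wgL2: "L2_fun (lebesgue_on ?E) (?wg e)" if "e \<in> Basis" for e
    using that by (simp add: has_weak_gradient_def)
  have QS: "Q x \<in> S0" if "x \<in> ?E" for x
  proof -
    have "Q x - Q_infty \<in> S0" using H1 that by (simp add: H1_def)
    then have "S0_proj (Q x) = Q x"
      using S0_proj_id[of "Q x - Q_infty"] S0_proj_id[OF Q_infty_in_S0] linear_diff[OF linear_S0_proj, of "Q x" Q_infty] by simp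
    then show ?thesis using S0_proj_in[of "Q x"] by simp
  qed
  obtain U where U: "U \<in> borel_measurable borel" "AE x in lebesgue. x \<in> ?E \<longrightarrow> U x = Q x - Q_infty"
    using lebesgue_on_borel_version[of "\<lambda>x. Q x - Q_infty" ?E] L2 by (auto simp: L2_fun_def)
  have "\<forall>e\<in>Basis. \<exists>u'. u' \<in> borel_measurable borel \<and> (AE x in lebesgue. x \<in> ?E \<longrightarrow> u' x = ?wg e x)"
    using lebesgue_on_borel_version[of "?wg _" ?E] wgL2 by (auto simp: L2_fun_def)
  from bchoice[OF this] obtain GB
    where "\<forall>e\<in>Basis. GB e \<in> borel_measurable borel \<and> (AE x in lebesgue. x \<in> ?E \<longrightarrow> GB e x = ?wg e x)" ..
  then have GB: "\<And>e. e \<in> Basis \<Longrightarrow> GB e \<in> borel_measurable borel"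
    "\<And>e. e \<in> Basis \<Longrightarrow> AE x in lebesgue. x \<in> ?E \<longrightarrow> GB e x = ?wg e x" by blast+
  \<comment> \<open>The projection leaves Q unchanged almost everywhere on the domain and puts QB
    into S0 at every point, so the rays carry no exceptional points.\<close>
  define QB where "QB x = S0_proj (U x + Q_infty)" for x
  have [measurable]: "S0_proj \<in> borel_measurable borel"
    by (intro borel_measurable_continuous_onI linear_continuous_on bounded_linear_S0_proj)
  have QB[measurable]: "QB \<in> borel_measurable borel"
    unfolding QB_def using U(1) by measurable
  have QBS: "QB x \<in> S0" for x by (simp add: QB_def S0_proj_in)
  have QBeq: "AE x in lebesgue. x \<in> ?E \<longrightarrow> QB x = Q x"
    using U(2) by eventually_elim (simp add: QB_def S0_proj_id QS)
  have GBall: "AE x in lebesgue. \<forall>e\<in>Basis. x \<in> ?E \<longrightarrow> GB e x = ?wg e x"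
    by (intro AE_finite_allI GB(2)) simp_all
  have eq: "AE x in lebesgue. x \<in> ?E \<longrightarrow> QB x = Q x \<and> (\<forall>e\<in>Basis. GB e x = ?wg e x)"
    using QBeq GBall by eventually_elim simp
  obtain w where w: "\<And>k. C1_fun (w k)"
     "(\<lambda>k. \<integral>\<^sup>+x\<in>?E. ennreal ((norm (w k x - Q x))\<^sup>2) \<partial>lebesgue) \<longlonglongrightarrow> 0"
     "\<And>e. e \<in> Basis \<Longrightarrow> (\<lambda>k. \<integral>\<^sup>+x\<in>?E. ennreal ((norm (partial_deriv e (w k) x - ?wg e x))\<^sup>2) \<partial>lebesgue) \<longlonglongrightarrow> 0"
     "(\<lambda>k. \<integral>\<^sup>+\<omega>. ennreal ((norm (w k \<omega> - Qb \<omega>))\<^sup>2) \<partial>sphere_measure) \<longlonglongrightarrow> 0"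
    using tr unfolding has_trace_def by blast
  obtain w' where w': "\<And>k x. (w k has_derivative blinfun_apply (w' k x)) (at x)" "\<And>k. continuous_on UNIV (w' k)"
    using w(1) unfolding C1_fun_def by metis
  have pd: "partial_deriv e (w k) x = w' k x e" for e k x
    using frechet_derivative_at[OF w'(1)] by metis
  have wc: "continuous_on UNIV (w k)" for k
    using w'(1) by (intro continuous_at_imp_continuous_on ballI has_derivative_continuous) auto
  have [measurable]: "w k \<in> borel_measurable borel" for k
    by (rule borel_measurable_continuous_onI[OF wc])
  have [measurable]: "(\<lambda>x. w' k x e) \<in> borel_measurable borel" for k e
    by (intro borel_measurable_continuous_onI continuous_intros w')
  \<comment> \<open>The density of the H1 error, Borel on all of space so that it may be restricted
    to rays.\<close>
  define A where "A k x = ennreal ((norm (w k x - QB x))\<^sup>2) + (\<Sum>e\<in>Basis. ennreal ((norm (w' k x e - GB e x))\<^sup>2))" for k x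
  have [measurable]: "A k \<in> borel_measurable borel" for k
    unfolding A_def using GB(1) by measurable
  have A0: "(\<lambda>k. \<integral>\<^sup>+x\<in>?E. A k x \<partial>lborel) \<longlonglongrightarrow> 0"
  proof -
    have "(\<integral>\<^sup>+x\<in>?E. A k x \<partial>lborel) = (\<integral>\<^sup>+x\<in>?E. ennreal ((norm (w k x - Q x))\<^sup>2) \<partial>lebesgue)
        + (\<Sum>e\<in>Basis. \<integral>\<^sup>+x\<in>?E. ennreal ((norm (w' k x e - ?wg e x))\<^sup>2) \<partial>lebesgue)" for k
    proof -
      have mE: "(\<lambda>x. ennreal ((norm (w' k x e - GB e x))\<^sup>2) * indicator ?E x) \<in> borel_measurable lborel" if "e \<in> Basis" for e
      proof -
        have [measurable]: "GB e \<in> borel_measurable borel" by (rule GB(1)[OF that])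
        show ?thesis by measurable
      qed
      have "(\<integral>\<^sup>+x\<in>?E. A k x \<partial>lborel) = (\<integral>\<^sup>+x. ennreal ((norm (w k x - QB x))\<^sup>2) * indicator ?E x
          + (\<Sum>e\<in>Basis. ennreal ((norm (w' k x e - GB e x))\<^sup>2) * indicator ?E x) \<partial>lborel)"
        by (simp only: A_def distrib_right sum_distrib_right)
      also have "\<dots> = (\<integral>\<^sup>+x\<in>?E. ennreal ((norm (w k x - QB x))\<^sup>2) \<partial>lborel)
          + (\<Sum>e\<in>Basis. \<integral>\<^sup>+x\<in>?E. ennreal ((norm (w' k x e - GB e x))\<^sup>2) \<partial>lborel)"
      proof (subst nn_integral_add)
        show "(\<lambda>x. \<Sum>e\<in>Basis. ennreal ((norm (w' k x e - GB e x))\<^sup>2) * indicator ?E x) \<in> borel_measurable lborel"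
          by (intro borel_measurable_sum mE)
      next
        have "(\<integral>\<^sup>+x. (\<Sum>e\<in>Basis. ennreal ((norm (w' k x e - GB e x))\<^sup>2) * indicator ?E x) \<partial>lborel)
            = (\<Sum>e\<in>Basis. \<integral>\<^sup>+x\<in>?E. ennreal ((norm (w' k x e - GB e x))\<^sup>2) \<partial>lborel)"
          by (intro nn_integral_sum mE)
        then show "(\<integral>\<^sup>+x\<in>?E. ennreal ((norm (w k x - QB x))\<^sup>2) \<partial>lborel)
            + (\<integral>\<^sup>+x. (\<Sum>e\<in>Basis. ennreal ((norm (w' k x e - GB e x))\<^sup>2) * indicator ?E x) \<partial>lborel)
            = (\<integral>\<^sup>+x\<in>?E. ennreal ((norm (w k x - QB x))\<^sup>2) \<partial>lborel)
            + (\<Sum>e\<in>Basis. \<integral>\<^sup>+x\<in>?E. ennreal ((norm (w' k x e - GB e x))\<^sup>2) \<partial>lborel)" by simp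
      qed measurable
      also have "(\<integral>\<^sup>+x\<in>?E. ennreal ((norm (w k x - QB x))\<^sup>2) \<partial>lborel) = (\<integral>\<^sup>+x\<in>?E. ennreal ((norm (w k x - Q x))\<^sup>2) \<partial>lebesgue)"
        unfolding nn_integral_completion[of lborel, symmetric]
        by (rule nn_integral_cong_AE) (use QBeq in \<open>eventually_elim, auto simp: indicator_def\<close>)
      also have "(\<Sum>e\<in>Basis. \<integral>\<^sup>+x\<in>?E. ennreal ((norm (w' k x e - GB e x))\<^sup>2) \<partial>lborel)
          = (\<Sum>e\<in>Basis. \<integral>\<^sup>+x\<in>?E. ennreal ((norm (w' k x e - ?wg e x))\<^sup>2) \<partial>lebesgue)"
        unfolding nn_integral_completion[of lborel, symmetric]
      proof (rule sum.cong[OF refl], rule nn_integral_cong_AE)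
        fix e :: "real^3" assume "e \<in> Basis"
        from GB(2)[OF this] show "AE x in lebesgue. ennreal ((norm (w' k x e - GB e x))\<^sup>2) * indicator ?E x
            = ennreal ((norm (w' k x e - ?wg e x))\<^sup>2) * indicator ?E x"
          by eventually_elim (auto simp: indicator_def)
      qed
      finally show ?thesis .
    qed
    moreover have "(\<lambda>k. (\<integral>\<^sup>+x\<in>?E. ennreal ((norm (w k x - Q x))\<^sup>2) \<partial>lebesgue)
        + (\<Sum>e\<in>Basis. \<integral>\<^sup>+x\<in>?E. ennreal ((norm (w' k x e - ?wg e x))\<^sup>2) \<partial>lebesgue)) \<longlonglongrightarrow> 0 + (\<Sum>e\<in>(Basis::(real^3) set). 0)"
      using w(2,3) unfolding pd by (intro tendsto_add tendsto_sum)
    ultimately show ?thesis by simp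
  qed
  \<comment> \<open>The error of the boundary value at \<omega> and the H1 error along its ray in
    one function, so that a single selection of indices serves both.\<close>
  define X where "X k \<omega> = ennreal ((norm (w k \<omega> - Qb \<omega>))\<^sup>2) + (\<integral>\<^sup>+t. A k (t *\<^sub>R \<omega>) \<partial>ray)" for k \<omega>
  have X1[measurable]: "(\<lambda>\<omega>. ennreal ((norm (w k \<omega> - Qb \<omega>))\<^sup>2)) \<in> borel_measurable sphere_measure" for k
  proof -
    have [measurable]: "w k \<in> borel_measurable sphere_measure" "Qb \<in> borel_measurable sphere_measure"
      by (rule measurable_sphere_measure, measurable) (rule Qb)
    show ?thesis by measurable
  qed
  have X2[measurable]: "(\<lambda>\<omega>. \<integral>\<^sup>+t. A k (t *\<^sub>R \<omega>) \<partial>ray) \<in> borel_measurable sphere_measure" for k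
    by (intro measurable_sphere_measure measurable_ray_integral) measurable
  have Xm: "X k \<in> borel_measurable sphere_measure" for k
    unfolding X_def by measurable
  have X0: "(\<lambda>k. \<integral>\<^sup>+\<omega>. X k \<omega> \<partial>sphere_measure) \<longlonglongrightarrow> 0"
  proof (rule tendsto_sandwich[OF _ _ tendsto_const])
    show "(\<lambda>k. (\<integral>\<^sup>+\<omega>. ennreal ((norm (w k \<omega> - Qb \<omega>))\<^sup>2) \<partial>sphere_measure) + (\<integral>\<^sup>+x\<in>?E. A k x \<partial>lborel)) \<longlonglongrightarrow> 0"
      using tendsto_add[OF w(4) A0] by simp
    have "(\<integral>\<^sup>+\<omega>. X k \<omega> \<partial>sphere_measure) \<le> (\<integral>\<^sup>+\<omega>. ennreal ((norm (w k \<omega> - Qb \<omega>))\<^sup>2) \<partial>sphere_measure) + (\<integral>\<^sup>+x\<in>?E. A k x \<partial>lborel)" for k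
    proof -
      have "(\<integral>\<^sup>+\<omega>. X k \<omega> \<partial>sphere_measure) = (\<integral>\<^sup>+\<omega>. ennreal ((norm (w k \<omega> - Qb \<omega>))\<^sup>2) \<partial>sphere_measure)
          + (\<integral>\<^sup>+\<omega>. (\<integral>\<^sup>+t. A k (t *\<^sub>R \<omega>) \<partial>ray) \<partial>sphere_measure)"
        unfolding X_def by (rule nn_integral_add[OF X1 X2])
      then show ?thesis
        using nn_integral_rays_le[of "A k"] by (simp add: add_left_mono)
    qed
    then show "\<forall>\<^sub>F k in sequentially. (\<integral>\<^sup>+\<omega>. X k \<omega> \<partial>sphere_measure)
        \<le> (\<integral>\<^sup>+\<omega>. ennreal ((norm (w k \<omega> - Qb \<omega>))\<^sup>2) \<partial>sphere_measure) + (\<integral>\<^sup>+x\<in>?E. A k x \<partial>lborel)"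
      by (intro always_eventually allI)
  qed simp
  obtain s :: "nat \<Rightarrow> nat" where s: "AE \<omega> in sphere_measure. (\<lambda>j. X (s j) \<omega>) \<longlonglongrightarrow> 0"
    using AE_subseq_tendsto_0[OF Xm X0] by blast
  define B where "B x = ennreal ((norm (QB x - Q_infty))\<^sup>2) + (\<Sum>e\<in>Basis. ennreal ((norm (GB e x))\<^sup>2))" for x
  have [measurable]: "B \<in> borel_measurable borel"
    unfolding B_def using GB(1) by measurable
  \<comment> \<open>Almost every ray inherits finite H1 norm, since the integral over all rays is
    bounded by the one over the exterior domain.\<close>
  have fin: "AE \<omega> in sphere_measure. (\<integral>\<^sup>+t. B (t *\<^sub>R \<omega>) \<partial>ray) \<noteq> \<infinity>"
  proof (rule nn_integral_noteq_infinite)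
    have "(\<integral>\<^sup>+\<omega>. (\<integral>\<^sup>+t. B (t *\<^sub>R \<omega>) \<partial>ray) \<partial>sphere_measure) \<le> (\<integral>\<^sup>+x\<in>?E. B x \<partial>lborel)"
      by (rule nn_integral_rays_le) measurable
    also have "\<dots> = (\<integral>\<^sup>+x\<in>?E. ennreal ((norm (Q x - Q_infty))\<^sup>2 + (\<Sum>e\<in>Basis. (norm (?wg e x))\<^sup>2)) \<partial>lebesgue)"
      unfolding nn_integral_completion[of lborel, symmetric]
    proof (rule nn_integral_cong_AE)
      show "AE x in lebesgue. B x * indicator ?E x = ennreal ((norm (Q x - Q_infty))\<^sup>2 + (\<Sum>e\<in>Basis. (norm (?wg e x))\<^sup>2)) * indicator ?E x"
        using eq
      proof eventually_elim
        case (elim x)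
        show ?case
        proof (cases "x \<in> ?E")
          case True
          then have "B x = ennreal ((norm (Q x - Q_infty))\<^sup>2) + (\<Sum>e\<in>Basis. ennreal ((norm (?wg e x))\<^sup>2))"
            using elim by (simp add: B_def)
          also have "\<dots> = ennreal ((norm (Q x - Q_infty))\<^sup>2 + (\<Sum>e\<in>Basis. (norm (?wg e x))\<^sup>2))"
            by (simp add: sum_nonneg ennreal_plus)
          finally show ?thesis by simp
        qed simp
      qed
    qed
    also have "\<dots> = (\<integral>\<^sup>+x. ennreal ((norm (Q x - Q_infty))\<^sup>2 + (\<Sum>e\<in>Basis. (norm (?wg e x))\<^sup>2)) \<partial>lebesgue_on ?E)"
      by (rule nn_integral_restrict_space[symmetric]) simp
    also have "\<dots> < \<infinity>"
    proof -
      have "integrable (lebesgue_on ?E) (\<lambda>x. (norm (Q x - Q_infty))\<^sup>2 + (\<Sum>e\<in>Basis. (norm (?wg e x))\<^sup>2))"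
        using L2 wgL2 by (intro Bochner_Integration.integrable_add Bochner_Integration.integrable_sum) (auto simp: L2_fun_def)
      moreover have "ennreal (norm ((norm (Q x - Q_infty))\<^sup>2 + (\<Sum>e\<in>Basis. (norm (?wg e x))\<^sup>2)))
          = ennreal ((norm (Q x - Q_infty))\<^sup>2 + (\<Sum>e\<in>Basis. (norm (?wg e x))\<^sup>2))" for x
        by (subst real_norm_def, subst abs_of_nonneg) (auto intro!: add_nonneg_nonneg sum_nonneg)
      ultimately show ?thesis by (simp only: integrable_iff_bounded)
    qed
    finally show "(\<integral>\<^sup>+\<omega>. (\<integral>\<^sup>+t. B (t *\<^sub>R \<omega>) \<partial>ray) \<partial>sphere_measure) \<noteq> \<infinity>" by simp
  qed (intro measurable_sphere_measure measurable_ray_integral, measurable)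
  have "AE \<omega> in sphere_measure. \<exists>q G. H1_curve q G \<and> q 1 = Qb \<omega> \<and>
       (\<forall>t>1. q t = QB (t *\<^sub>R \<omega>) \<and> (norm (G t))\<^sup>2 \<le> (\<Sum>e\<in>Basis. (norm (GB e (t *\<^sub>R \<omega>)))\<^sup>2))"
    using s fin AE_space
  proof eventually_elim
    case (elim \<omega>)
    then have \<omega>: "norm \<omega> = 1" by simp
    \<comment> \<open>The boundary datum is attached at t = 1; the sphere is a null set, so QB
      carries no information there.\<close>
    define q where "q t = (if 1 < t then QB (t *\<^sub>R \<omega>) else Qb \<omega>)" for t :: real
    define G where "G t = S0_proj (\<Sum>e\<in>Basis. (\<omega> \<bullet> e) *\<^sub>R GB e (t *\<^sub>R \<omega>))" for t :: real
    define W where "W j t = S0_proj (w (s j) (t *\<^sub>R \<omega>))" for j and t :: real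
    define W' where "W' j t = S0_proj (w' (s j) (t *\<^sub>R \<omega>) \<omega>)" for j and t :: real
    have qm[measurable]: "q \<in> borel_measurable borel" unfolding q_def by measurable
    have Gm[measurable]: "G \<in> borel_measurable borel" unfolding G_def using GB(1) by measurable
    have Gle: "(norm (G t))\<^sup>2 \<le> (\<Sum>e\<in>Basis. (norm (GB e (t *\<^sub>R \<omega>)))\<^sup>2)" for t
    proof -
      have "(norm (G t))\<^sup>2 \<le> (norm (\<Sum>e\<in>Basis. (\<omega> \<bullet> e) *\<^sub>R GB e (t *\<^sub>R \<omega>)))\<^sup>2"
        unfolding G_def by (intro power_mono norm_S0_proj_le) simp
      also note norm_sum_Basis_le[OF \<omega>]
      finally show ?thesis .
    qed
    have Bfin: "(\<integral>\<^sup>+t. B (t *\<^sub>R \<omega>) \<partial>ray) < \<infinity>" using elim by (simp add: less_top)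
    have "(\<integral>\<^sup>+r. ennreal ((norm (q r - Q_infty))\<^sup>2) \<partial>ray) \<le> (\<integral>\<^sup>+t. B (t *\<^sub>R \<omega>) \<partial>ray)"
      by (rule nn_integral_mono) (auto simp: q_def B_def)
    then have q2: "(\<integral>\<^sup>+r. ennreal ((norm (q r - Q_infty))\<^sup>2) \<partial>ray) < \<infinity>" using Bfin by (rule le_less_trans)
    have "(\<integral>\<^sup>+r. ennreal ((norm (G r))\<^sup>2) \<partial>ray) \<le> (\<integral>\<^sup>+t. B (t *\<^sub>R \<omega>) \<partial>ray)"
    proof (rule nn_integral_mono)
      fix r
      have "ennreal ((norm (G r))\<^sup>2) \<le> (\<Sum>e\<in>Basis. ennreal ((norm (GB e (r *\<^sub>R \<omega>)))\<^sup>2))"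
        using ennreal_leI[OF Gle[of r]] by (simp add: sum_ennreal)
      then show "ennreal ((norm (G r))\<^sup>2) \<le> B (r *\<^sub>R \<omega>)" by (simp add: B_def add_increasing)
    qed
    then have G2: "(\<integral>\<^sup>+r. ennreal ((norm (G r))\<^sup>2) \<partial>ray) < \<infinity>" using Bfin by (rule le_less_trans)
    have Ale: "(\<lambda>j. \<integral>\<^sup>+t. A (s j) (t *\<^sub>R \<omega>) \<partial>ray) \<longlonglongrightarrow> 0"
      by (rule tendsto_sandwich[OF _ _ tendsto_const elim(1)]) (auto simp: X_def)
    have "C1_approx q G W W'"
      unfolding C1_approx_def
    proof (intro conjI allI)
      fix j r
      have "((\<lambda>t. t *\<^sub>R \<omega>) has_vector_derivative \<omega>) (at r)"
        by (auto intro!: derivative_eq_intros)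
      then have "((\<lambda>t. w (s j) (t *\<^sub>R \<omega>)) has_vector_derivative w' (s j) (r *\<^sub>R \<omega>) \<omega>) (at r)"
        using vector_derivative_diff_chain_within[of "\<lambda>t. t *\<^sub>R \<omega>" \<omega> r UNIV "w (s j)" "w' (s j) (r *\<^sub>R \<omega>)"] w'(1)
        by (simp add: o_def has_derivative_at_withinI)
      then show "(W j has_vector_derivative W' j r) (at r)"
        unfolding W_def W'_def by (rule bounded_linear.has_vector_derivative[OF bounded_linear_S0_proj])
      show "continuous_on UNIV (W' j)"
        unfolding W'_def
        by (intro bounded_linear.continuous_on[OF bounded_linear_S0_proj] continuous_intros continuous_on_compose2[OF w'(2)]) auto
      show "W j r \<in> S0" by (simp add: W_def S0_proj_in)
    next
      have "(\<lambda>j. ennreal ((norm (w (s j) \<omega> - Qb \<omega>))\<^sup>2)) \<longlonglongrightarrow> 0"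
        by (rule tendsto_sandwich[OF _ _ tendsto_const elim(1)]) (auto simp: X_def)
      then have "(\<lambda>j. (norm (w (s j) \<omega> - Qb \<omega>))\<^sup>2) \<longlonglongrightarrow> 0"
        using tendsto_ennrealD[of "\<lambda>j. (norm (w (s j) \<omega> - Qb \<omega>))\<^sup>2" 0 sequentially] by simp
      then have "(\<lambda>j. norm (w (s j) \<omega> - Qb \<omega>)) \<longlonglongrightarrow> 0"
        using tendsto_real_sqrt by fastforce
      then have "(\<lambda>j. w (s j) \<omega>) \<longlonglongrightarrow> Qb \<omega>"
        by (rule LIM_zero_cancel[OF tendsto_norm_zero_cancel])
      then have "(\<lambda>j. S0_proj (w (s j) \<omega>)) \<longlonglongrightarrow> S0_proj (Qb \<omega>)"
        by (rule bounded_linear.tendsto[OF bounded_linear_S0_proj])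
      then show "(\<lambda>j. W j 1) \<longlonglongrightarrow> q 1"
        using Qb_S0[of \<omega>] \<omega> by (simp add: W_def q_def S0_proj_id)
      show "(\<lambda>j. \<integral>\<^sup>+r. ennreal ((norm (W j r - q r))\<^sup>2) \<partial>ray) \<longlonglongrightarrow> 0"
      proof (rule tendsto_sandwich[OF _ _ tendsto_const Ale])
        have "(\<integral>\<^sup>+r. ennreal ((norm (W j r - q r))\<^sup>2) \<partial>ray) \<le> (\<integral>\<^sup>+t. A (s j) (t *\<^sub>R \<omega>) \<partial>ray)" for j
        proof (rule nn_integral_mono)
          fix r assume "r \<in> space ray"
          then have "W j r - q r = S0_proj (w (s j) (r *\<^sub>R \<omega>) - QB (r *\<^sub>R \<omega>))"
            by (simp add: W_def q_def linear_diff[OF linear_S0_proj] S0_proj_id QBS)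
          then have "(norm (W j r - q r))\<^sup>2 \<le> (norm (w (s j) (r *\<^sub>R \<omega>) - QB (r *\<^sub>R \<omega>)))\<^sup>2"
            by (simp add: norm_S0_proj_le power_mono)
          then show "ennreal ((norm (W j r - q r))\<^sup>2) \<le> A (s j) (r *\<^sub>R \<omega>)"
            unfolding A_def by (intro add_increasing2 ennreal_leI) auto
        qed
        then show "\<forall>\<^sub>F j in sequentially. (\<integral>\<^sup>+r. ennreal ((norm (W j r - q r))\<^sup>2) \<partial>ray) \<le> (\<integral>\<^sup>+t. A (s j) (t *\<^sub>R \<omega>) \<partial>ray)"
          by (intro always_eventually allI)
      qed simp
      show "(\<lambda>j. \<integral>\<^sup>+r. ennreal ((norm (W' j r - G r))\<^sup>2) \<partial>ray) \<longlonglongrightarrow> 0"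
      proof (rule tendsto_sandwich[OF _ _ tendsto_const Ale])
        have "(\<integral>\<^sup>+r. ennreal ((norm (W' j r - G r))\<^sup>2) \<partial>ray) \<le> (\<integral>\<^sup>+t. A (s j) (t *\<^sub>R \<omega>) \<partial>ray)" for j
        proof (rule nn_integral_mono)
          fix r
          let ?L = "w' (s j) (r *\<^sub>R \<omega>)"
          have "blinfun_apply ?L \<omega> = blinfun_apply ?L (\<Sum>e\<in>Basis. (\<omega> \<bullet> e) *\<^sub>R e)"
            by (simp add: euclidean_representation)
          also have "\<dots> = (\<Sum>e\<in>Basis. (\<omega> \<bullet> e) *\<^sub>R ?L e)"
            by (simp add: blinfun.sum_right blinfun.scaleR_right)
          finally have "W' j r - G r = S0_proj (\<Sum>e\<in>Basis. (\<omega> \<bullet> e) *\<^sub>R (?L e - GB e (r *\<^sub>R \<omega>)))"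
            by (simp add: W'_def G_def scaleR_diff_right sum_subtractf flip: linear_diff[OF linear_S0_proj])
          then have "(norm (W' j r - G r))\<^sup>2 \<le> (norm (\<Sum>e\<in>Basis. (\<omega> \<bullet> e) *\<^sub>R (?L e - GB e (r *\<^sub>R \<omega>))))\<^sup>2"
            by (simp add: norm_S0_proj_le power_mono)
          also have "\<dots> \<le> (\<Sum>e\<in>Basis. (norm (?L e - GB e (r *\<^sub>R \<omega>)))\<^sup>2)"
            by (rule norm_sum_Basis_le[OF \<omega>])
          finally have "ennreal ((norm (W' j r - G r))\<^sup>2) \<le> ennreal (\<Sum>e\<in>Basis. (norm (?L e - GB e (r *\<^sub>R \<omega>)))\<^sup>2)"
            by (rule ennreal_leI)
          also have "\<dots> = (\<Sum>e\<in>Basis. ennreal ((norm (?L e - GB e (r *\<^sub>R \<omega>)))\<^sup>2))"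
            by (simp add: sum_ennreal)
          finally show "ennreal ((norm (W' j r - G r))\<^sup>2) \<le> A (s j) (r *\<^sub>R \<omega>)"
            unfolding A_def by (rule add_increasing[rotated]) simp
        qed
        then show "\<forall>\<^sub>F j in sequentially. (\<integral>\<^sup>+r. ennreal ((norm (W' j r - G r))\<^sup>2) \<partial>ray) \<le> (\<integral>\<^sup>+t. A (s j) (t *\<^sub>R \<omega>) \<partial>ray)"
          by (intro always_eventually allI)
      qed simp
    qed
    then have "H1_curve q G"
      unfolding H1_curve_def using qm Gm q2 G2 by blast
    moreover have "q 1 = Qb \<omega>" "\<forall>t>1. q t = QB (t *\<^sub>R \<omega>)" by (auto simp: q_def)
    ultimately show ?case using Gle by blast
  qed
  then show thesis
    using that[OF QB GB(1) QBS eq] by blast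
qed

section \<open>The energy in a cone\<close>

lemma continuous_on_uniaxial: "continuous_on A uniaxial"
  unfolding uniaxial_def[abs_def] by (intro continuous_intros)

lemma cone_over_eq:
  fixes U :: "(real^3) set"
  assumes "U \<subseteq> sphere 0 1"
  shows "cone_over U = {x. 1 < norm x} \<inter> sgn -` U"
proof (intro set_eqI iffI)
  fix x assume "x \<in> cone_over U"
  then obtain t \<omega> where "x = t *\<^sub>R \<omega>" "1 < t" "\<omega> \<in> U" by (auto simp: cone_over_def)
  moreover from this have "norm \<omega> = 1" using assms by auto
  ultimately show "x \<in> {x. 1 < norm x} \<inter> sgn -` U" by (simp add: sgn_scaleR sgn_div_norm)
next
  fix x :: "real^3" assume x: "x \<in> {x. 1 < norm x} \<inter> sgn -` U"
  then have "norm x \<noteq> 0" by auto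
  then have "x = norm x *\<^sub>R sgn x" by (simp add: sgn_div_norm)
  with x show "x \<in> cone_over U" unfolding cone_over_def by blast
qed

lemma cone_over_borel:
  fixes U :: "(real^3) set"
  assumes "U \<subseteq> sphere 0 1" "U \<in> sets borel"
  shows "cone_over U \<in> sets borel"
  unfolding cone_over_eq[OF assms(1)] using measurable_sets[OF borel_measurable_sgn assms(2)]
  by (intro sets.Int) (auto intro!: borel_open open_Collect_less continuous_intros)

text \<open>The bound assumed for all curves is applied to the rescaled curve on almost every ray
  and then integrated over directions. D stays an arbitrary function of the director, known only
  through this pointwise bound.\<close>

lemma cone_energy_ge:
  assumes Q: "Q \<in> admissible (\<lambda>\<omega>. uniaxial (v \<omega>))"
    and v: "v \<in> borel_measurable sphere_measure" "\<And>\<omega>. \<omega> \<in> sphere 0 1 \<Longrightarrow> norm (v \<omega>) = 1"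
    and \<xi>: "0 < \<xi>" and \<eta>: "0 < \<eta>" and \<theta>: "0 < \<theta>" and g0: "0 \<le> g0" and U: "U \<in> sets sphere_measure"
    and bound: "\<And>q G n. H1_curve q G \<Longrightarrow> norm n = 1 \<Longrightarrow> q 1 = uniaxial n \<Longrightarrow> ennreal \<theta> * D n
      \<le> (\<integral>\<^sup>+r. ennreal (1/2 * (norm (G r))\<^sup>2 + (\<eta> / \<xi>)\<^sup>2 * f_pot (q r) + g_pot g0 (q r)) \<partial>ray)"
  shows "ennreal \<theta> * (\<integral>\<^sup>+\<omega>\<in>U. D (v \<omega>) \<partial>sphere_measure) \<le> ennreal \<eta> * energy g0 \<xi> \<eta> (cone_over U) Q"
proof -
  let ?E = "exterior_domain"
  let ?S = "restrict_space hausdorff2 (sphere 0 1) :: (real^3) measure"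
  have Qbm: "(\<lambda>\<omega>. uniaxial (v \<omega>)) \<in> borel_measurable sphere_measure"
    by (rule measurable_compose[OF v(1) borel_measurable_continuous_onI[OF continuous_on_uniaxial]])
  obtain QB GB where B: "QB \<in> borel_measurable borel" "\<And>e. e \<in> Basis \<Longrightarrow> GB e \<in> borel_measurable borel"
    "\<And>x. QB x \<in> S0"
    "AE x in lebesgue. x \<in> ?E \<longrightarrow> QB x = Q x \<and> (\<forall>e\<in>Basis. GB e x = weak_gradient ?E Q e x)"
    "AE \<omega> in sphere_measure. \<exists>q G. H1_curve q G \<and> q 1 = uniaxial (v \<omega>) \<and>
       (\<forall>t>1. q t = QB (t *\<^sub>R \<omega>) \<and> (norm (G t))\<^sup>2 \<le> (\<Sum>e\<in>Basis. (norm (GB e (t *\<^sub>R \<omega>)))\<^sup>2))"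
    using rays_of_admissible[OF Q Qbm uniaxial_in_S0[OF v(2)]] by blast
  define dens where "dens x = ennreal (1/2 * (\<Sum>e\<in>Basis. (norm (GB e x))\<^sup>2) + (1/\<xi>\<^sup>2) * f_pot (QB x) + (1/\<eta>\<^sup>2) * g_pot g0 (QB x))" for x
  have [measurable]: "dens \<in> borel_measurable borel"
  proof -
    have [measurable]: "(\<lambda>x. \<Sum>e\<in>Basis. (norm (GB e x))\<^sup>2) \<in> borel_measurable borel"
    proof (intro borel_measurable_sum)
      fix e :: "real^3" assume "e \<in> Basis"
      then have [measurable]: "GB e \<in> borel_measurable borel" by (rule B(2))
      show "(\<lambda>x. (norm (GB e x))\<^sup>2) \<in> borel_measurable borel" by measurable
    qed
    show ?thesis unfolding dens_def using B(1) by measurable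
  qed
  \<comment> \<open>U is Borel only up to a null set. Its main part has a Borel cone, contained in
    the cone over U, and the integral over directions does not see the difference.\<close>
  define U' where "U' = main_part ?S U"
  have Uc: "U \<in> sets (completion ?S)" using U by (simp add: sphere_measure_def)
  have U'S: "U' \<in> sets ?S" unfolding U'_def by (rule main_part_sets[OF Uc])
  have U': "U' \<in> sets borel" "U' \<subseteq> sphere 0 1"
    using U'S by (auto simp: sets_restrict_space)
  have U'm: "U' \<in> sets sphere_measure" using U'S by (simp add: sphere_measure_def)
  have Usub: "U' \<subseteq> U" unfolding U'_def using main_part_null_part_Un[OF Uc] by blast
  have AEU: "AE \<omega> in sphere_measure. \<omega> \<in> U \<longrightarrow> \<omega> \<in> U'"
  proof -
    obtain N where N: "N \<in> null_sets ?S" "null_part ?S U \<subseteq> N" using null_part[OF Uc] by blast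
    have "AE \<omega> in ?S. \<omega> \<notin> N" by (rule AE_not_in[OF N(1)])
    then have "AE \<omega> in ?S. \<omega> \<in> U \<longrightarrow> \<omega> \<in> U'"
    proof eventually_elim
      case (elim \<omega>)
      then show ?case using N(2) main_part_null_part_Un[OF Uc] unfolding U'_def by blast
    qed
    then show ?thesis unfolding sphere_measure_def by (rule AE_completion)
  qed
  define e where "e \<omega> = (\<integral>\<^sup>+t. ennreal \<eta> * dens (t *\<^sub>R \<omega>) \<partial>ray)" for \<omega>
  have em[measurable]: "e \<in> borel_measurable sphere_measure"
    unfolding e_def by (intro measurable_sphere_measure measurable_ray_integral) measurable
  \<comment> \<open>The factor is placed beside e, which is measurable, so that it can be pulled out
    of the integral; D composed with v is not known to be measurable.\<close>
  have ray: "AE \<omega> in sphere_measure. D (v \<omega>) \<le> ennreal (1/\<theta>) * e \<omega>"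
    using B(5) AE_space
  proof eventually_elim
    case (elim \<omega>)
    then obtain q G where H: "H1_curve q G" "q 1 = uniaxial (v \<omega>)"
      and t: "\<And>t. 1 < t \<Longrightarrow> q t = QB (t *\<^sub>R \<omega>)" "\<And>t. 1 < t \<Longrightarrow> (norm (G t))\<^sup>2 \<le> (\<Sum>e\<in>Basis. (norm (GB e (t *\<^sub>R \<omega>)))\<^sup>2)"
      by blast
    have nv: "norm (v \<omega>) = 1" using v(2) elim(2) by simp
    have [measurable]: "q \<in> borel_measurable borel" "G \<in> borel_measurable borel"
      using H(1) by (auto simp: H1_curve_def)
    define F where "F t = \<eta>\<^sup>2 * (1/2 * (norm (G t))\<^sup>2) + (\<eta> / \<xi>)\<^sup>2 * f_pot (q t) + g_pot g0 (q t)" for t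
    have [measurable]: "F \<in> borel_measurable borel" unfolding F_def by measurable
    have "ennreal \<theta> * D (v \<omega>) \<le> (\<integral>\<^sup>+r. ennreal (1/2 * (norm (\<eta> *\<^sub>R G (1 + \<eta> * (r - 1))))\<^sup>2
        + (\<eta> / \<xi>)\<^sup>2 * f_pot (q (1 + \<eta> * (r - 1))) + g_pot g0 (q (1 + \<eta> * (r - 1)))) \<partial>ray)"
      using bound[OF H1_curve_scale[OF H(1) \<eta>] nv] H(2) by simp
    also have "\<dots> = (\<integral>\<^sup>+r. ennreal (F (1 + \<eta> * (r - 1))) \<partial>ray)"
      by (intro nn_integral_cong arg_cong[where f=ennreal]) (simp add: F_def power_mult_distrib)
    also have "\<dots> = ennreal (1/\<eta>) * (\<integral>\<^sup>+r. ennreal (F r) \<partial>ray)"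
      by (rule nn_integral_ray_scale[OF _ \<eta>]) measurable
    also have "\<dots> = (\<integral>\<^sup>+r. ennreal (1/\<eta>) * ennreal (F r) \<partial>ray)"
      by (rule nn_integral_cmult[symmetric]) measurable
    also have "\<dots> \<le> e \<omega>"
      unfolding e_def
    proof (rule nn_integral_mono)
      fix r assume "r \<in> space ray"
      then have r: "1 < r" by simp
      \<comment> \<open>The factor 1/\<eta> from the substitution times the rescaled integrand is
        \<eta> times the energy density with the radial derivative, which the full gradient then
        dominates.\<close>
      have "1/\<eta> * F r = \<eta> * (1/2 * (norm (G r))\<^sup>2 + (1/\<xi>\<^sup>2) * f_pot (q r) + (1/\<eta>\<^sup>2) * g_pot g0 (q r))"
        using \<xi> \<eta> by (simp add: F_def field_simps power2_eq_square)
      also have "\<dots> \<le> \<eta> * (1/2 * (\<Sum>e\<in>Basis. (norm (GB e (r *\<^sub>R \<omega>)))\<^sup>2) + (1/\<xi>\<^sup>2) * f_pot (q r) + (1/\<eta>\<^sup>2) * g_pot g0 (q r))"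
        using t(2)[OF r] \<eta> by (intro mult_left_mono add_right_mono) auto
      finally have "ennreal (1/\<eta> * F r) \<le> ennreal (\<eta> * (1/2 * (\<Sum>e\<in>Basis. (norm (GB e (r *\<^sub>R \<omega>)))\<^sup>2)
          + (1/\<xi>\<^sup>2) * f_pot (q r) + (1/\<eta>\<^sup>2) * g_pot g0 (q r)))"
        by (rule ennreal_leI)
      also have "\<dots> = ennreal \<eta> * dens (r *\<^sub>R \<omega>)"
        unfolding dens_def t(1)[OF r] using \<eta> by (intro ennreal_mult') simp
      also have "ennreal (1/\<eta> * F r) = ennreal (1/\<eta>) * ennreal (F r)"
        using \<eta> by (intro ennreal_mult') simp
      finally show "ennreal (1/\<eta>) * ennreal (F r) \<le> ennreal \<eta> * dens (r *\<^sub>R \<omega>)" .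
    qed
    finally have "ennreal (1/\<theta>) * (ennreal \<theta> * D (v \<omega>)) \<le> ennreal (1/\<theta>) * e \<omega>"
      by (rule mult_left_mono) simp
    moreover have "ennreal (1/\<theta>) * ennreal \<theta> = 1" using \<theta> by (subst ennreal_mult[symmetric]) auto
    ultimately show ?case by (simp flip: mult.assoc)
  qed
  define h where "h x = ennreal \<eta> * dens x * indicator (cone_over U') x" for x
  have [measurable]: "cone_over U' \<in> sets borel" by (rule cone_over_borel[OF U'(2,1)])
  have hm: "h \<in> borel_measurable borel" unfolding h_def by measurable
  have "(\<integral>\<^sup>+\<omega>\<in>U. D (v \<omega>) \<partial>sphere_measure) \<le> (\<integral>\<^sup>+\<omega>. ennreal (1/\<theta>) * (e \<omega> * indicator U' \<omega>) \<partial>sphere_measure)"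
    by (rule nn_integral_mono_AE) (use ray AEU in \<open>eventually_elim, auto simp: indicator_def mult_right_mono\<close>)
  also have "\<dots> = ennreal (1/\<theta>) * (\<integral>\<^sup>+\<omega>. e \<omega> * indicator U' \<omega> \<partial>sphere_measure)"
    using U'm em by (intro nn_integral_cmult borel_measurable_times_ennreal borel_measurable_indicator)
  also have "(\<integral>\<^sup>+\<omega>. e \<omega> * indicator U' \<omega> \<partial>sphere_measure) = (\<integral>\<^sup>+\<omega>. (\<integral>\<^sup>+t. h (t *\<^sub>R \<omega>) \<partial>ray) \<partial>sphere_measure)"
  proof (rule nn_integral_cong)
    fix \<omega> :: "real^3" assume "\<omega> \<in> space sphere_measure"
    then have \<omega>: "norm \<omega> = 1" by simp
    have "t *\<^sub>R \<omega> \<in> cone_over U' \<longleftrightarrow> \<omega> \<in> U'" if "1 < t" for t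
      using that \<omega> by (simp add: cone_over_eq[OF U'(2)] sgn_scaleR sgn_div_norm)
    then have "(\<integral>\<^sup>+t. h (t *\<^sub>R \<omega>) \<partial>ray) = (\<integral>\<^sup>+t. ennreal \<eta> * dens (t *\<^sub>R \<omega>) * indicator U' \<omega> \<partial>ray)"
      by (intro nn_integral_cong) (simp add: h_def indicator_def)
    also have "\<dots> = e \<omega> * indicator U' \<omega>"
      unfolding e_def by (rule nn_integral_multc) measurable
    finally show "e \<omega> * indicator U' \<omega> = (\<integral>\<^sup>+t. h (t *\<^sub>R \<omega>) \<partial>ray)" ..
  qed
  also have "\<dots> \<le> (\<integral>\<^sup>+x\<in>?E. h x \<partial>lborel)" by (rule nn_integral_rays_le[OF hm])
  also have "\<dots> = (\<integral>\<^sup>+x\<in>?E. h x \<partial>lebesgue)" by (simp add: nn_integral_completion)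
  also have "\<dots> \<le> (\<integral>\<^sup>+x. ennreal \<eta> * (dens x * indicator ?E x * indicator (cone_over U') x) \<partial>lebesgue)"
    by (intro nn_integral_mono) (auto simp: h_def indicator_def)
  also have "\<dots> = ennreal \<eta> * (\<integral>\<^sup>+x. dens x * indicator ?E x * indicator (cone_over U') x \<partial>lebesgue)"
    unfolding nn_integral_completion by (intro nn_integral_cmult) measurable
  also have "(\<integral>\<^sup>+x. dens x * indicator ?E x * indicator (cone_over U') x \<partial>lebesgue) \<le> energy g0 \<xi> \<eta> (cone_over U) Q"
    unfolding energy_def
  proof (rule nn_integral_mono_AE)
    have "cone_over U' \<subseteq> cone_over U" using Usub by (auto simp: cone_over_def)
    from B(4) show "AE x in lebesgue. dens x * indicator ?E x * indicator (cone_over U') x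
      \<le> ennreal (1/2 * (\<Sum>e\<in>Basis. (norm (weak_gradient ?E Q e x))\<^sup>2) + 1/\<xi>\<^sup>2 * f_pot (Q x) + 1/\<eta>\<^sup>2 * g_pot g0 (Q x)) * indicator (cone_over U) x"
    proof eventually_elim
      case (elim x)
      then show ?case using \<open>cone_over U' \<subseteq> cone_over U\<close> by (auto simp: dens_def indicator_def)
    qed
  qed
  finally have "(\<integral>\<^sup>+\<omega>\<in>U. D (v \<omega>) \<partial>sphere_measure) \<le> ennreal (1/\<theta>) * (ennreal \<eta> * energy g0 \<xi> \<eta> (cone_over U) Q)"
    by (simp add: mult_left_mono)
  then have "ennreal \<theta> * (\<integral>\<^sup>+\<omega>\<in>U. D (v \<omega>) \<partial>sphere_measure) \<le> ennreal \<theta> * (ennreal (1/\<theta>) * (ennreal \<eta> * energy g0 \<xi> \<eta> (cone_over U) Q))"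
    by (rule mult_left_mono) simp
  also have "\<dots> = ennreal \<eta> * energy g0 \<xi> \<eta> (cone_over U) Q"
  proof -
    have "ennreal \<theta> * ennreal (1/\<theta>) = 1" using \<theta> by (subst ennreal_mult[symmetric]) auto
    then show ?thesis by (simp flip: mult.assoc)
  qed
  finally show ?thesis .
qed

theorem theorem1p1:
  fixes v :: "real^3 \<Rightarrow> real^3"
    and Q :: "real \<Rightarrow> real \<Rightarrow> real^3 \<Rightarrow> real^3^3"
    and g0 :: real
    and \<xi> \<eta> :: "'i \<Rightarrow> real" and F :: "'i filter"
    and l :: ennreal
    and U :: "(real^3) set"
  assumes "g0 \<ge> 0"
    and "v \<in> borel_measurable sphere_measure"
    and "\<forall>\<omega>\<in>sphere 0 1. v \<omega> \<in> sphere 0 1 \<and> v \<omega> \<bullet> \<omega> = 0"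
    and "\<And>x e. x > 0 \<Longrightarrow> e > 0 \<Longrightarrow>
           is_arg_min (energy g0 x e exterior_domain)
             (\<lambda>P. P \<in> admissible (\<lambda>\<omega>. uniaxial (v \<omega>))) (Q x e)"
    and "\<forall>\<^sub>F i in F. \<xi> i > 0 \<and> \<eta> i > 0"
    and "(\<xi> \<longlongrightarrow> 0) F" and "(\<eta> \<longlongrightarrow> 0) F"
    and "((\<lambda>i. ennreal (\<eta> i / \<xi> i)) \<longlongrightarrow> l) F"
    and "U \<in> sets sphere_measure"
  shows "Liminf F (\<lambda>i. ennreal (\<eta> i) * energy g0 (\<xi> i) (\<eta> i) (cone_over U) (Q (\<xi> i) (\<eta> i)))
           \<ge> (\<integral>\<^sup>+\<omega>\<in>U. D_min g0 l (uniaxial (v \<omega>)) \<partial>sphere_measure)"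
proof -
  let ?R = "\<integral>\<^sup>+\<omega>\<in>U. D_min g0 l (uniaxial (v \<omega>)) \<partial>sphere_measure"
  let ?L = "Liminf F (\<lambda>i. ennreal (\<eta> i) * energy g0 (\<xi> i) (\<eta> i) (cone_over U) (Q (\<xi> i) (\<eta> i)))"
  have adm: "Q x e \<in> admissible (\<lambda>\<omega>. uniaxial (v \<omega>))" if "0 < x" "0 < e" for x e
    using assms(4)[OF that] by (simp add: is_arg_min_def)
  have nv: "norm (v \<omega>) = 1" if "\<omega> \<in> sphere 0 1" for \<omega>
    using assms(3) that by simp
  \<comment> \<open>The threshold index depends on \<theta> but neither on the ray nor on the curve,
    so it can be fixed before integrating over U.\<close>
  have *: "ennreal \<theta> * ?R \<le> ?L" if \<theta>: "0 < \<theta>" "\<theta> < 1" for \<theta> :: real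
  proof (rule Liminf_bounded)
    have "\<forall>\<^sub>F i in F. 0 < \<eta> i / \<xi> i" using assms(5) by eventually_elim simp
    from eventually_D_min_le_energy[OF assms(8) this \<theta> assms(1)] assms(5)
    show "\<forall>\<^sub>F i in F. ennreal \<theta> * ?R \<le> ennreal (\<eta> i) * energy g0 (\<xi> i) (\<eta> i) (cone_over U) (Q (\<xi> i) (\<eta> i))"
    proof eventually_elim
      case (elim i)
      show ?case
        by (rule cone_energy_ge[where D="\<lambda>n. D_min g0 l (uniaxial n)", OF adm assms(2) nv _ _ \<theta>(1) assms(1) assms(9)])
          (use elim in auto)
    qed
  qed
  \<comment> \<open>Letting the factor tend to 1 is legitimate even if the right-hand integral is
    infinite, as the limit factor is not 0.\<close>
  have "((\<lambda>\<theta>. ennreal \<theta> * ?R) \<longlongrightarrow> ennreal 1 * ?R) (at_left (1::real))"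
    by (intro tendsto_mult_ennreal tendsto_ennrealI tendsto_intros) auto
  moreover have "eventually (\<lambda>\<theta>. ennreal \<theta> * ?R \<le> ?L) (at_left (1::real))"
    using eventually_at_left_real[of 0 "1::real"] * by (auto elim!: eventually_mono)
  ultimately have "ennreal 1 * ?R \<le> ?L"
    by (rule tendsto_upperbound) simp
  then show ?thesis by simp
qed

end
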